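(* Let $\widehat\delta$ be a $K_0$-homogeneous locally nilpotent derivation of a trinomial algebra $R(A,P_0)$. Then $\widehat\delta=h\delta$, where $\delta$ is one of the basic derivations of $R(A,P_0)$ and $h$ has the following form. (a) If $R(A,P_0)$ is of type 1 and $\delta=\frac{\partial}{\partial S_p}$: $h=F(T_1^{l_1})\prod_{i,j}T_{ij}^{b_{ij}}\prod_{k\ne p}S_k^{d_k}$ for some $b_{ij},d_k\in\mathbb Z_{\ge0}$ and some polynomial $F$ in one variable over $\mathbb K$. (b) If $R(A,P_0)$ is of type 1 and $\delta=\delta_C$: $h=\alpha\prod_{T_{ij}\in\ker\delta}T_{ij}^{b_{ij}}\prod_k S_k^{d_k}$ for some $b_{ij},d_k\in\mathbb Z_{\ge0}$ and $\alpha\in\mathbb K$. (c) If $R(A,P_0)$ is of type 2 and $\delta=\frac{\partial}{\partial S_p}$: $h=F(T_1^{l_1},T_2^{l_2})\prod_{i,j}T_{ij}^{b_{ij}}\prod_{k\ne p}S_k^{d_k}$ for some $b_{ij},d_k\in\mathbb Z_{\ge0}$ and some homogeneous polynomial $F$ in two variables over $\mathbb K$. (d) If $R(A,P_0)$ is of type 2 and $\delta=\delta_{C,\beta}$: $h=\alpha(\beta_2T_1^{l_1}-\beta_1T_2^{l_2})^{s}\prod_{T_{ij}\in\ker\delta}T_{ij}^{b_{ij}}\prod_k S_k^{d_k}$ for some $s,b_{ij},d_k\in\mathbb Z_{\ge0}$ and $\alpha\in\mathbb K$.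
   Context: Ground field: $\mathbb K$ is an algebraically closed field of characteristic zero. Derivations: a derivation of a commutative $\mathbb K$-algebra $R$ is a $\mathbb K$-linear map $\delta:R\to R$ with $\delta(ab)=\delta(a)b+a\delta(b)$; it is locally nilpotent if for every $a\in R$ there is $n\ge 0$ with $\delta^n(a)=0$. If $R=\bigoplus_{g\in G}R_g$ is graded by an abelian group $G$, $\delta$ is $G$-homogeneous if there is $d\in G$ with $\delta(R_g)\subseteq R_{g+d}$ for all $g\in G$. Trinomial algebras: fix integers $r,n>0$, $m\ge 0$, $\iota\in\{0,1\}$, a partition $n=n_\iota+\dots+n_r$ with $n_i>0$, and for each $i=\iota,\dots,r$ a tuple of positive integers $l_i=(l_{i1},\dots,l_{in_i})$. Put $T_i^{l_i}=T_{i1}^{l_{i1}}\cdots T_{in_i}^{l_{in_i}}$ in the polynomial ring $\mathbb K[T_{ij},S_k]$ ($\iota\le i\le r$, $1\le j\le n_i$, $1\le k\le m$). Type 1: $\iota=1$, $I=\{1,\dots,r-1\}$, $A=(a_1,\dots,a_r)\in\mathbb K^r$ with pairwise different entries, $\mathfrak g_i=T_i^{l_i}-T_{i+1}^{l_{i+1}}-(a_{i+1}-a_i)$ for $i\in I$; $P_0$ is the integer $r\times(n+m)$ matrix (columns indexed by the variables $T_{ij}$, then $S_k$) whose $i$-th row ($1\le i\le r$) has $l_i$ in the block of columns $T_{i1},\dots,T_{in_i}$ and $0$ elsewhere. Type 2: $\iota=0$, $I=\{0,\dots,r-2\}$, $A=(a_0,\dots,a_r)$ is a matrix with pairwise linearly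 independent columns $a_0,\dots,a_r\in\mathbb K^2$, $\mathfrak g_i=\det\begin{pmatrix}T_i^{l_i}&T_{i+1}^{l_{i+1}}&T_{i+2}^{l_{i+2}}\\ a_i&a_{i+1}&a_{i+2}\end{pmatrix}$ for $i\in I$; $P_0$ is the $r\times(n+m)$ matrix whose $i$-th row ($1\le i\le r$) has $-l_0$ in the block of $T_{01},\dots,T_{0n_0}$, $l_i$ in the block of $T_{i1},\dots,T_{in_i}$, and $0$ elsewhere. The trinomial algebra is $R(A,P_0)=\mathbb K[T_{ij},S_k]/(\mathfrak g_i\mid i\in I)$. Let $K_0=\mathbb Z^{n+m}/\mathrm{im}(P_0^T)$ with quotient map $Q:\mathbb Z^{n+m}\to K_0$, and let $v_{ij},v_k$ be the standard basis vectors of $\mathbb Z^{n+m}$. The $K_0$-grading of $R(A,P_0)$ is induced by $\deg T_{ij}=Q(v_{ij})$, $\deg S_k=Q(v_k)$ (the $\mathfrak g_i$ are homogeneous). Basic derivations of $R(A,P_0)$ (each is given on generators and is well defined on the quotient): (0) For $1\le p\le m$: $\frac{\partial}{\partial S_p}(T_{ij})=0$ for all $(i,j)$; $\frac{\partial}{\partial S_p}(S_k)=1$ if $k=p$ and $0$ if $k\ne p$. (1) In type 1, for a tuple $C=(c_1,\dots,c_r)$ with $1\le c_i\le n_i$ and $l_{ic_i}=1$ for all $i$ except at most one: $\delta_C(T_{ic_i})=\prod_{k\ne i}\frac{\partial T_k^{l_k}}{\partial T_{kc_k}}$, $\delta_C(T_{ij})=0$ for $j\neq c_i$, $\delta_C(S_k)=0$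 for all $k$. (2) In type 2, let $\beta=(\beta_0,\dots,\beta_r)\in\mathbb K^{r+1}$ be a vector lying in the row space of $A$ (if $\beta\ne0$, then either all $\beta_i\neq 0$ or exactly one $\beta_{i_0}$ is zero). (2.1) If all $\beta_i\ne0$ and $C=(c_0,\dots,c_r)$ satisfies $1\le c_i\le n_i$ and $l_{ic_i}=1$ for all $i$ except at most one: $\delta_{C,\beta}(T_{ic_i})=\beta_i\prod_{k\ne i}\frac{\partial T_k^{l_k}}{\partial T_{kc_k}}$, $\delta_{C,\beta}(T_{ij})=0$ for $j\ne c_i$, $\delta_{C,\beta}(S_k)=0$ for all $k$. (2.2) If $\beta_{i_0}=0$ for exactly one $i_0$ and $C=(c_0,\dots,c_r)$ satisfies $1\le c_i\le n_i$ and $l_{ic_i}=1$ for all $i\ne i_0$ except at most one: $\delta_{C,\beta}(T_{ic_i})=\beta_i\prod_{k\ne i,i_0}\frac{\partial T_k^{l_k}}{\partial T_{kc_k}}$, $\delta_{C,\beta}(T_{ij})=0$ for $j\ne c_i$, $\delta_{C,\beta}(S_k)=0$ for all $k$.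
   Formalization: The zero derivation is excluded when R(A,P_0) has no basic derivation (e.g. type 2, r=2, m=0, n_i=1, l=2,3,7), where the claim fails; in type 2 with r=1, where T_2 and β_2 do not exist, the indices 0,1 replace 1,2 in (c) and (d). *)

theory Defs
  imports "HOL-Analysis.Analysis" "HOL-Algebra.Free_Abelian_Groups" "HOL-Algebra.QuotRing" "HOL-Computational_Algebra.Polynomial"
begin

section \<open>Polynomials in several variables\<close>

text \<open>
  A polynomial is a finitely supported family of coefficients indexed by monomials, a monomial
  being a finitely supported family of exponents.  The variable type may contain more variables
  than are wanted: \<open>mpoly_ring V\<close> is the polynomial ring in the variables from \<open>V\<close>.
\<close>

type_synonym ('v, 'k) mpoly = "('v \<Rightarrow>\<^sub>0 nat) \<Rightarrow>\<^sub>0 'k"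

definition mconst :: "'k::comm_ring_1 \<Rightarrow> ('v, 'k) mpoly" where
  "mconst c = Poly_Mapping.single 0 c"

definition mvar :: "'v \<Rightarrow> ('v, 'k::comm_ring_1) mpoly" where
  "mvar v = Poly_Mapping.single (Poly_Mapping.single v 1) 1"

definition mpderiv :: "'v \<Rightarrow> ('v, 'k::comm_ring_1) mpoly \<Rightarrow> ('v, 'k) mpoly" where
  "mpderiv v p = (\<Sum>t\<in>Poly_Mapping.keys p. Poly_Mapping.single (t - Poly_Mapping.single v 1)
     (of_nat (Poly_Mapping.lookup t v) * Poly_Mapping.lookup p t))"

definition mpoly_ring :: "'v set \<Rightarrow> ('v, 'k::comm_ring_1) mpoly ring" where
  "mpoly_ring V = \<lparr>carrier = {p. \<forall>t\<in>Poly_Mapping.keys p. Poly_Mapping.keys t \<subseteq> V},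
     monoid.mult = (*), one = 1, ring.zero = 0, add = (+)\<rparr>"

definition subst_poly :: "'k::comm_ring_1 poly \<Rightarrow> ('v, 'k) mpoly \<Rightarrow> ('v, 'k) mpoly" where
  "subst_poly F x = poly (map_poly mconst F) x"

text \<open>The homogeneous polynomial of degree \<open>N\<close> in two variables with coefficient \<open>f e\<close>
  at \<open>x ^ e * y ^ (N - e)\<close>.\<close>

definition subst_binary_form ::
    "nat \<Rightarrow> (nat \<Rightarrow> 'k::comm_ring_1) \<Rightarrow> ('v, 'k) mpoly \<Rightarrow> ('v, 'k) mpoly \<Rightarrow> ('v, 'k) mpoly" where
  "subst_binary_form N f x y = (\<Sum>e\<le>N. mconst (f e) * x ^ e * y ^ (N - e))"


section \<open>Derivations\<close>

text \<open>The algebra structure of \<open>R\<close> is given by its structure map \<open>\<eta>\<close> from the ground field.\<close>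

definition derivation :: "('r, 'b) ring_scheme \<Rightarrow> ('k \<Rightarrow> 'r) \<Rightarrow> ('r \<Rightarrow> 'r) \<Rightarrow> bool" where
  "derivation R \<eta> \<delta> \<longleftrightarrow>
     \<delta> \<in> carrier R \<rightarrow> carrier R \<and>
     (\<forall>x\<in>carrier R. \<forall>y\<in>carrier R. \<delta> (x \<oplus>\<^bsub>R\<^esub> y) = \<delta> x \<oplus>\<^bsub>R\<^esub> \<delta> y) \<and>
     (\<forall>c. \<forall>x\<in>carrier R. \<delta> (\<eta> c \<otimes>\<^bsub>R\<^esub> x) = \<eta> c \<otimes>\<^bsub>R\<^esub> \<delta> x) \<and>
     (\<forall>x\<in>carrier R. \<forall>y\<in>carrier R.
        \<delta> (x \<otimes>\<^bsub>R\<^esub> y) = (\<delta> x \<otimes>\<^bsub>R\<^esub> y) \<oplus>\<^bsub>R\<^esub> (x \<otimes>\<^bsub>R\<^esub> \<delta> y))"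

definition locally_nilpotent :: "('r, 'b) ring_scheme \<Rightarrow> ('r \<Rightarrow> 'r) \<Rightarrow> bool" where
  "locally_nilpotent R \<delta> \<longleftrightarrow> (\<forall>x\<in>carrier R. \<exists>n. (\<delta> ^^ n) x = \<zero>\<^bsub>R\<^esub>)"

text \<open>The grading group is written multiplicatively; \<open>Rg g\<close> is the component of degree \<open>g\<close>.\<close>

definition homogeneous_map :: "('g, 'b) monoid_scheme \<Rightarrow> ('g \<Rightarrow> 'r set) \<Rightarrow> ('r \<Rightarrow> 'r) \<Rightarrow> bool" where
  "homogeneous_map G Rg \<delta> \<longleftrightarrow>
     (\<exists>d\<in>carrier G. \<forall>g\<in>carrier G. \<delta> ` Rg g \<subseteq> Rg (g \<otimes>\<^bsub>G\<^esub> d))"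


section \<open>Trinomial data\<close>

datatype tvar = T nat nat | S nat

text \<open>\<open>Type1 a\<close> carries the scalars \<open>a 1, \<dots>, a r\<close> and \<open>Type2 a\<close> the columns \<open>a 0, \<dots>, a r\<close> of
  the matrix \<open>A\<close>; values at other indices are irrelevant.\<close>

datatype 'k coeffs = Type1 "nat \<Rightarrow> 'k" | Type2 "nat \<Rightarrow> 'k ^ 2"

record 'k trinomial_data =
  tr_r :: nat
  tr_n :: "nat \<Rightarrow> nat"
  tr_l :: "nat \<Rightarrow> nat \<Rightarrow> nat"
  tr_m :: nat
  tr_A :: "'k coeffs"

definition iota :: "'k trinomial_data \<Rightarrow> nat" where
  "iota D = (case tr_A D of Type1 _ \<Rightarrow> 1 | Type2 _ \<Rightarrow> 0)"

definition blocks :: "'k trinomial_data \<Rightarrow> nat set" where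
  "blocks D = {iota D..tr_r D}"

definition T_indices :: "'k trinomial_data \<Rightarrow> (nat \<times> nat) set" where
  "T_indices D = {(i, j). i \<in> blocks D \<and> j \<in> {1..tr_n D i}}"

definition tvars :: "'k trinomial_data \<Rightarrow> tvar set" where
  "tvars D = {T i j | i j. (i, j) \<in> T_indices D} \<union> {S k | k. k \<in> {1..tr_m D}}"

definition trinomial_data :: "'k::field trinomial_data \<Rightarrow> bool" where
  "trinomial_data D \<longleftrightarrow>
     tr_r D > 0 \<and>
     (\<forall>i\<in>blocks D. tr_n D i > 0) \<and>
     (\<forall>(i, j)\<in>T_indices D. tr_l D i j > 0) \<and>
     (case tr_A D of
        Type1 a \<Rightarrow> inj_on a (blocks D)
      | Type2 a \<Rightarrow> \<forall>i\<in>blocks D. \<forall>k\<in>blocks D. i \<noteq> k \<longrightarrow> a i \<noteq> a k \<and> vec.independent {a i, a k})"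


section \<open>Trinomial algebras\<close>

definition Tpow :: "'k::field trinomial_data \<Rightarrow> nat \<Rightarrow> (tvar, 'k) mpoly" where
  "Tpow D i = (\<Prod>j=1..tr_n D i. mvar (T i j) ^ tr_l D i j)"

definition relations :: "'k::field trinomial_data \<Rightarrow> (tvar, 'k) mpoly set" where
  "relations D = (case tr_A D of
      Type1 a \<Rightarrow> {Tpow D i - Tpow D (i + 1) - mconst (a (i + 1) - a i) | i. 1 \<le> i \<and> i + 1 \<le> tr_r D}
    | Type2 a \<Rightarrow> {det (vector [vector [Tpow D i, Tpow D (i + 1), Tpow D (i + 2)],
                          vector [mconst (a i $ 1), mconst (a (i + 1) $ 1), mconst (a (i + 2) $ 1)],
                          vector [mconst (a i $ 2), mconst (a (i + 1) $ 2), mconst (a (i + 2) $ 2)]]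
                        :: (tvar, 'k) mpoly ^ 3 ^ 3) | i. i + 2 \<le> tr_r D})"

definition trinomial_ideal :: "'k::field trinomial_data \<Rightarrow> (tvar, 'k) mpoly set" where
  "trinomial_ideal D = Idl\<^bsub>mpoly_ring (tvars D)\<^esub> (relations D)"

definition trinomial_algebra :: "'k::field trinomial_data \<Rightarrow> (tvar, 'k) mpoly set ring" where
  "trinomial_algebra D = mpoly_ring (tvars D) Quot trinomial_ideal D"

definition cls :: "'k::field trinomial_data \<Rightarrow> (tvar, 'k) mpoly \<Rightarrow> (tvar, 'k) mpoly set" where
  "cls D p = trinomial_ideal D +>\<^bsub>mpoly_ring (tvars D)\<^esub> p"

abbreviation algebra_derivation ::
    "'k::field trinomial_data \<Rightarrow> ((tvar, 'k) mpoly set \<Rightarrow> (tvar, 'k) mpoly set) \<Rightarrow> bool" where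
  "algebra_derivation D \<equiv> derivation (trinomial_algebra D) (\<lambda>c. cls D (mconst c))"


section \<open>The \<open>K\<^sub>0\<close>-grading\<close>

fun P0 :: "'k trinomial_data \<Rightarrow> nat \<Rightarrow> tvar \<Rightarrow> int" where
  "P0 D i (T k j) = (if k = 0 then - int (tr_l D 0 j) else if k = i then int (tr_l D i j) else 0)"
| "P0 D i (S k) = 0"

text \<open>In type 1 there is no block \<open>0\<close>, so the first case of \<open>P0\<close> only concerns type 2.\<close>

definition im_P0T :: "'k trinomial_data \<Rightarrow> (tvar \<Rightarrow>\<^sub>0 int) set" where
  "im_P0T D = {\<Sum>v\<in>tvars D. Poly_Mapping.single v (\<Sum>i=1..tr_r D. P0 D i v * u i) | u. True}"

definition K0 :: "'k trinomial_data \<Rightarrow> (tvar \<Rightarrow>\<^sub>0 int) set monoid" where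
  "K0 D = free_Abelian_group (tvars D) Mod im_P0T D"

definition Q :: "'k trinomial_data \<Rightarrow> (tvar \<Rightarrow>\<^sub>0 int) \<Rightarrow> (tvar \<Rightarrow>\<^sub>0 int) set" where
  "Q D w = im_P0T D #>\<^bsub>free_Abelian_group (tvars D)\<^esub> w"

definition monomial_degree :: "'k trinomial_data \<Rightarrow> (tvar \<Rightarrow>\<^sub>0 nat) \<Rightarrow> (tvar \<Rightarrow>\<^sub>0 int) set" where
  "monomial_degree D t =
     Q D (\<Sum>v\<in>Poly_Mapping.keys t. Poly_Mapping.single v (int (Poly_Mapping.lookup t v)))"

definition K0_component ::
    "'k::field trinomial_data \<Rightarrow> (tvar \<Rightarrow>\<^sub>0 int) set \<Rightarrow> (tvar, 'k) mpoly set set" where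
  "K0_component D g = cls D ` {p \<in> carrier (mpoly_ring (tvars D)).
     \<forall>t\<in>Poly_Mapping.keys p. monomial_degree D t = g}"


section \<open>Basic derivations\<close>

text \<open>A derivation of the trinomial algebra is determined on its carrier by its values on the
  generators, here given by polynomials \<open>f v\<close>.\<close>

definition derivation_with_values ::
    "'k::field trinomial_data \<Rightarrow> (tvar \<Rightarrow> (tvar, 'k) mpoly) \<Rightarrow>
     ((tvar, 'k) mpoly set \<Rightarrow> (tvar, 'k) mpoly set) \<Rightarrow> bool" where
  "derivation_with_values D f \<delta> \<longleftrightarrow>
     algebra_derivation D \<delta> \<and> (\<forall>v\<in>tvars D. \<delta> (cls D (mvar v)) = cls D (f v))"

definition is_partial_S ::
    "'k::field trinomial_data \<Rightarrow> nat \<Rightarrow> ((tvar, 'k) mpoly set \<Rightarrow> (tvar, 'k) mpoly set) \<Rightarrow> bool" where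
  "is_partial_S D p \<delta> \<longleftrightarrow>
     p \<in> {1..tr_m D} \<and> derivation_with_values D (\<lambda>v. if v = S p then 1 else 0) \<delta>"

definition block_choice :: "'k trinomial_data \<Rightarrow> (nat \<Rightarrow> nat) \<Rightarrow> bool" where
  "block_choice D c \<longleftrightarrow> (\<forall>i\<in>blocks D. c i \<in> {1..tr_n D i})"

definition linear_but_one :: "'k trinomial_data \<Rightarrow> nat set \<Rightarrow> (nat \<Rightarrow> nat) \<Rightarrow> bool" where
  "linear_but_one D B c \<longleftrightarrow> card {i \<in> B. tr_l D i (c i) \<noteq> 1} \<le> 1"

text \<open>The values on the generators of the derivations \<open>\<delta>\<^sub>C\<close> (with \<open>\<beta> = 1\<close>) and \<open>\<delta>\<^sub>C\<^sub>,\<^sub>\<beta>\<close>; the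
  products run over the blocks in \<open>B\<close>.\<close>

fun delta_values :: "'k::field trinomial_data \<Rightarrow> nat set \<Rightarrow> (nat \<Rightarrow> nat) \<Rightarrow> (nat \<Rightarrow> 'k) \<Rightarrow>
    tvar \<Rightarrow> (tvar, 'k) mpoly" where
  "delta_values D B c \<beta> (T i j) =
     (if j = c i then mconst (\<beta> i) * (\<Prod>k\<in>B - {i}. mpderiv (T k (c k)) (Tpow D k)) else 0)"
| "delta_values D B c \<beta> (S k) = 0"

definition is_delta_C ::
    "'k::field trinomial_data \<Rightarrow> (nat \<Rightarrow> nat) \<Rightarrow>
     ((tvar, 'k) mpoly set \<Rightarrow> (tvar, 'k) mpoly set) \<Rightarrow> bool" where
  "is_delta_C D c \<delta> \<longleftrightarrow>
     block_choice D c \<and> linear_but_one D (blocks D) c \<and>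
     derivation_with_values D (delta_values D (blocks D) c (\<lambda>_. 1)) \<delta>"

definition in_row_space :: "'k::field trinomial_data \<Rightarrow> (nat \<Rightarrow> 'k ^ 2) \<Rightarrow> (nat \<Rightarrow> 'k) \<Rightarrow> bool" where
  "in_row_space D a \<beta> \<longleftrightarrow> (\<exists>x y. \<forall>i\<in>blocks D. \<beta> i = x * a i $ 1 + y * a i $ 2)"

definition is_delta_C_beta ::
    "'k::field trinomial_data \<Rightarrow> (nat \<Rightarrow> 'k ^ 2) \<Rightarrow> (nat \<Rightarrow> nat) \<Rightarrow> (nat \<Rightarrow> 'k) \<Rightarrow>
     ((tvar, 'k) mpoly set \<Rightarrow> (tvar, 'k) mpoly set) \<Rightarrow> bool" where
  "is_delta_C_beta D a c \<beta> \<delta> \<longleftrightarrow>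
     block_choice D c \<and> in_row_space D a \<beta> \<and>
     ((\<forall>i\<in>blocks D. \<beta> i \<noteq> 0) \<and> linear_but_one D (blocks D) c \<and>
        derivation_with_values D (delta_values D (blocks D) c \<beta>) \<delta>
      \<or> (\<exists>i0\<in>blocks D. \<beta> i0 = 0 \<and> (\<forall>i\<in>blocks D - {i0}. \<beta> i \<noteq> 0) \<and>
           linear_but_one D (blocks D - {i0}) c \<and>
           derivation_with_values D (delta_values D (blocks D - {i0}) c \<beta>) \<delta>))"

text \<open>
  Some trinomial algebras have no basic derivation, and on these the zero derivation is
  not a multiple of one.
\<close>

definition is_basic_derivation ::
    "'k::field trinomial_data \<Rightarrow> ((tvar, 'k) mpoly set \<Rightarrow> (tvar, 'k) mpoly set) \<Rightarrow> bool" where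
  "is_basic_derivation D \<delta> \<longleftrightarrow>
     (\<exists>p. is_partial_S D p \<delta>) \<or>
     (case tr_A D of
        Type1 _ \<Rightarrow> \<exists>c. is_delta_C D c \<delta>
      | Type2 a \<Rightarrow> \<exists>c \<beta>. is_delta_C_beta D a c \<beta> \<delta>)"


section \<open>Monomial factors\<close>

definition T_monomial :: "(nat \<times> nat) set \<Rightarrow> (nat \<Rightarrow> nat \<Rightarrow> nat) \<Rightarrow> (tvar, 'k::field) mpoly" where
  "T_monomial U b = (\<Prod>(i, j)\<in>U. mvar (T i j) ^ b i j)"

definition S_monomial :: "nat set \<Rightarrow> (nat \<Rightarrow> nat) \<Rightarrow> (tvar, 'k::field) mpoly" where
  "S_monomial U d = (\<Prod>k\<in>U. mvar (S k) ^ d k)"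

definition T_in_kernel ::
    "'k::field trinomial_data \<Rightarrow> ((tvar, 'k) mpoly set \<Rightarrow> (tvar, 'k) mpoly set) \<Rightarrow> (nat \<times> nat) set" where
  "T_in_kernel D \<delta> = {(i, j) \<in> T_indices D. \<delta> (cls D (mvar (T i j))) = \<zero>\<^bsub>trinomial_algebra D\<^esub>}"

text \<open>The two blocks used in type 2 are \<open>1\<close> and \<open>2\<close>.  For \<open>r = 1\<close> there is no block \<open>2\<close> (and no
  relation); there the only two blocks \<open>0\<close> and \<open>1\<close> take their place.\<close>

definition block_p :: "'k trinomial_data \<Rightarrow> nat" where
  "block_p D = (if tr_r D = 1 then 0 else 1)"

definition block_q :: "'k trinomial_data \<Rightarrow> nat" where
  "block_q D = (if tr_r D = 1 then 1 else 2)"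

end

theory Submission
  imports Defs
begin

text \<open>
  Homogeneous elements of the trinomial algebra are multiples \<open>t * F(Y\<^sub>p, Y\<^sub>q)\<close> of a reduced monomial \<open>t\<close>
  by a binary form in two of the block monomials \<open>Y\<^sub>i\<close>; evaluating along a curve of points of the
  variety shows that they form a domain.  Hence a homogeneous locally nilpotent derivation \<open>E\<close> has an
  additive degree function \<open>nu\<close> on them, and \<open>x\<close> divides \<open>E x\<close> only if \<open>E x = 0\<close>.

  If \<open>E\<close> kills all \<open>T\<^sub>i\<^sub>j\<close>, the exponents of the \<open>S\<^sub>k\<close> leave room for only one nonzero \<open>E S\<^sub>p\<close>.  Otherwise
  every \<open>E Y\<^sub>i\<close> is a form times one and the same reduced monomial \<open>t\<^sub>0\<close>, in which \<open>T\<^sub>i\<^sub>j\<close> with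
  \<open>E T\<^sub>i\<^sub>j \<noteq> 0\<close> has exponent \<open>l\<^sub>i\<^sub>j - 1\<close> and the other variables of its block have exponent at least \<open>l\<^sub>i\<^sub>j\<close>;
  so there is exactly one such variable in every block with \<open>E Y\<^sub>i \<noteq> 0\<close>.  A linear factor \<open>L\<close> of
  \<open>Y\<^sub>q * E Y\<^sub>p - Y\<^sub>p * E Y\<^sub>q\<close> divides \<open>E L\<close>, so \<open>E L = 0\<close>, and comparing values of \<open>nu\<close> shows that
  \<open>E Y\<^sub>i = \<beta>\<^sub>i * t\<^sub>0 * L\<^sup>N\<close> up to a constant and that at most one of the exponents \<open>l\<^sub>i\<^sub>j\<close> above exceeds \<open>1\<close>.
\<close>

text \<open>Up to nonzero scalars all nonzero \<open>E (Y i)\<close> equal one element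
  \<open>W\<close> modulo the ideal. A chosen variable \<open>T\<close> of exponent \<open>l\<close>
  satisfies \<open>l * nu T = nu (Y i) = 1 + nu W\<close>, and \<open>W\<close> contains
  \<open>T ^ (l - 1)\<close>, which contributes the fraction \<open>1 - 1/l\<close> of
  \<open>1 + nu W\<close> to \<open>nu W\<close>. Two exponents \<open>l \<ge> 2\<close> would
  contribute at least \<open>1 + nu W\<close>, which is too much. Likewise a linear form outside the
  kernel has degree \<open>1 + nu W\<close> and cannot be a factor of \<open>W\<close>; the kernel
  contains only one linear form up to scalars, whence the power of \<open>L\<close>. A linear factor
  \<open>L\<close> divides \<open>E L\<close> because, at the zero of \<open>L\<close> on the
  projective line with coordinates \<open>Y\<^sub>p\<close>, \<open>Y\<^sub>q\<close>, the vector of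
  the images is parallel to the vector of coordinates. The monomial \<open>t\<^sub>0\<close> is
  shared because all block monomials have the same degree and a reduced monomial is determined by
  its degree modulo that one. The computations take place in the polynomial ring modulo the ideal,
  with homogeneous representatives of the values of the derivation on the variables.\<close>

lemma mpoly_sum_singles: "(\<Sum>t\<in>Poly_Mapping.keys p. Poly_Mapping.single t (Poly_Mapping.lookup p t)) = p"
proof (rule poly_mapping_eqI)
  fix s
  show "Poly_Mapping.lookup (\<Sum>t\<in>Poly_Mapping.keys p. Poly_Mapping.single t (Poly_Mapping.lookup p t)) s
      = Poly_Mapping.lookup p s"
    by (simp add: lookup_sum lookup_single when_def in_keys_iff)
qed

text \<open>Reduces bilinear identities, such as the product rule and the multiplicativity of
  evaluation, to pairs of monomials.\<close>

lemma mpoly_induct [case_names zero single add]: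
  assumes "P 0" "\<And>t c. P (Poly_Mapping.single t c)" "\<And>p q. P p \<Longrightarrow> P q \<Longrightarrow> P (p + q)"
  shows "P (p :: ('a, 'b::comm_monoid_add) poly_mapping)"
proof -
  have "P (\<Sum>t\<in>A. Poly_Mapping.single t (Poly_Mapping.lookup p t))" if "finite A" for A
    using that by induction (auto intro: assms)
  from this[of "Poly_Mapping.keys p"] show ?thesis by (simp add: mpoly_sum_singles)
qed

section \<open>Partial derivatives of polynomials\<close>

lemma mpderiv_superset:
  assumes "finite A" "Poly_Mapping.keys p \<subseteq> A"
  shows "mpderiv v p = (\<Sum>t\<in>A. Poly_Mapping.single (t - Poly_Mapping.single v 1)
     (of_nat (Poly_Mapping.lookup t v) * Poly_Mapping.lookup p t))"
  unfolding mpderiv_def using assms by (intro sum.mono_neutral_left) (auto simp: in_keys_iff)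

lemma mpderiv_add: "mpderiv v (p + q) = mpderiv v p + mpderiv v q"
proof -
  let ?A = "Poly_Mapping.keys p \<union> Poly_Mapping.keys q"
  have "finite ?A" "Poly_Mapping.keys p \<subseteq> ?A" "Poly_Mapping.keys q \<subseteq> ?A" "Poly_Mapping.keys (p + q) \<subseteq> ?A"
    using keys_add[of p q] by auto
  then show ?thesis
    by (simp add: mpderiv_superset[of ?A] lookup_add algebra_simps single_add sum.distrib)
qed

lemma mpderiv_0 [simp]: "mpderiv v 0 = 0"
  by (simp add: mpderiv_def)

lemma mpderiv_single: "mpderiv v (Poly_Mapping.single t c) =
    Poly_Mapping.single (t - Poly_Mapping.single v 1) (of_nat (Poly_Mapping.lookup t v) * c)"
  by (subst mpderiv_superset[of "{t}"]) auto

text \<open>Subtraction of exponents is truncated, hence the positivity assumption. Where the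
  exponent of \<open>v\<close> is 0, the coefficient of the derivative vanishes instead.\<close>

lemma monomial_diff_add:
  fixes s t :: "'v \<Rightarrow>\<^sub>0 nat"
  assumes "Poly_Mapping.lookup s v > 0"
  shows "s - Poly_Mapping.single v 1 + t = s + t - Poly_Mapping.single v 1"
  using assms by (intro poly_mapping_eqI) (auto simp: lookup_add lookup_minus lookup_single when_def)

lemma mpderiv_mult_singles:
  "mpderiv v (Poly_Mapping.single s a * Poly_Mapping.single t b) =
    mpderiv v (Poly_Mapping.single s a) * Poly_Mapping.single t b +
    Poly_Mapping.single s a * mpderiv v (Poly_Mapping.single t b)"
proof -
  have "Poly_Mapping.single (s - Poly_Mapping.single v 1 + t) (of_nat (Poly_Mapping.lookup s v) * a * b)
      = Poly_Mapping.single (s + t - Poly_Mapping.single v 1) (of_nat (Poly_Mapping.lookup s v) * a * b)"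
    by (cases "Poly_Mapping.lookup s v > 0") (use monomial_diff_add[of s v t] in auto)
  moreover have "Poly_Mapping.single (s + (t - Poly_Mapping.single v 1)) (a * (of_nat (Poly_Mapping.lookup t v) * b))
      = Poly_Mapping.single (s + t - Poly_Mapping.single v 1) (a * (of_nat (Poly_Mapping.lookup t v) * b))"
    by (cases "Poly_Mapping.lookup t v > 0") (use monomial_diff_add[of t v s] in \<open>auto simp: add.commute\<close>)
  ultimately show ?thesis
    by (simp add: mpderiv_single mult_single lookup_add algebra_simps flip: single_add)
qed

lemma mpderiv_mult: "mpderiv v (p * q) = mpderiv v p * q + p * mpderiv v q"
proof (induction p rule: mpoly_induct)
  case (single s a)
  show ?case
    by (induction q rule: mpoly_induct)
      (auto simp: mpderiv_mult_singles mpderiv_add algebra_simps)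
qed (auto simp: mpderiv_add algebra_simps)

section \<open>Evaluation of polynomials at points\<close>

definition mon_eval :: "('v \<Rightarrow> 'k::comm_ring_1) \<Rightarrow> ('v \<Rightarrow>\<^sub>0 nat) \<Rightarrow> 'k" where
  "mon_eval P t = (\<Prod>v\<in>Poly_Mapping.keys t. P v ^ Poly_Mapping.lookup t v)"

definition meval :: "('v \<Rightarrow> 'k::comm_ring_1) \<Rightarrow> ('v, 'k) mpoly \<Rightarrow> 'k" where
  "meval P p = (\<Sum>t\<in>Poly_Mapping.keys p. Poly_Mapping.lookup p t * mon_eval P t)"

lemma mon_eval_superset:
  assumes "finite A" "Poly_Mapping.keys t \<subseteq> A"
  shows "mon_eval P t = (\<Prod>v\<in>A. P v ^ Poly_Mapping.lookup t v)"
  unfolding mon_eval_def using assms by (intro prod.mono_neutral_left) (auto simp: in_keys_iff)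

lemma mon_eval_add: "mon_eval P (s + t) = mon_eval P s * mon_eval P t"
proof -
  let ?A = "Poly_Mapping.keys s \<union> Poly_Mapping.keys t"
  have "finite ?A" "Poly_Mapping.keys s \<subseteq> ?A" "Poly_Mapping.keys t \<subseteq> ?A" "Poly_Mapping.keys (s + t) \<subseteq> ?A"
    using keys_add[of s t] by auto
  then show ?thesis
    by (simp add: mon_eval_superset[of ?A] lookup_add power_add prod.distrib)
qed

lemma mon_eval_0 [simp]: "mon_eval P 0 = 1"
  by (simp add: mon_eval_def)

lemma meval_superset:
  assumes "finite A" "Poly_Mapping.keys p \<subseteq> A"
  shows "meval P p = (\<Sum>t\<in>A. Poly_Mapping.lookup p t * mon_eval P t)"
  unfolding meval_def using assms by (intro sum.mono_neutral_left) (auto simp: in_keys_iff)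

lemma meval_add: "meval P (p + q) = meval P p + meval P q"
proof -
  let ?A = "Poly_Mapping.keys p \<union> Poly_Mapping.keys q"
  have "finite ?A" "Poly_Mapping.keys p \<subseteq> ?A" "Poly_Mapping.keys q \<subseteq> ?A" "Poly_Mapping.keys (p + q) \<subseteq> ?A"
    using keys_add[of p q] by auto
  then show ?thesis
    by (simp add: meval_superset[of ?A] lookup_add algebra_simps sum.distrib)
qed

lemma meval_0 [simp]: "meval P 0 = 0"
  by (simp add: meval_def)

lemma meval_single: "meval P (Poly_Mapping.single t c) = c * mon_eval P t"
  by (subst meval_superset[of "{t}"]) auto

lemma meval_mult: "meval P (p * q) = meval P p * meval P q"
proof (induction p rule: mpoly_induct)
  case (single s a)
  show ?case
    by (induction q rule: mpoly_induct)
      (auto simp: meval_single mult_single mon_eval_add meval_add algebra_simps)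
qed (auto simp: meval_add algebra_simps)

lemma meval_mconst [simp]: "meval P (mconst c) = c"
  by (simp add: mconst_def meval_single)

lemma meval_mvar [simp]: "meval P (mvar v) = P v"
  by (simp add: mvar_def meval_single mon_eval_def)

lemma mconst_0 [simp]: "mconst 0 = 0"
  and mconst_1 [simp]: "mconst 1 = 1"
  by (simp_all add: mconst_def)

lemma mconst_add: "mconst (a + b) = mconst a + mconst b"
  by (simp add: mconst_def single_add)

lemma mconst_uminus: "mconst (- a) = - mconst a"
  by (simp add: mconst_def single_uminus)

lemma mconst_diff: "mconst (a - b) = mconst a - mconst b"
  by (simp add: mconst_def single_diff)

lemma mconst_mult: "mconst (a * b) = mconst a * mconst b"
  by (simp add: mconst_def mult_single)

lemma mconst_power: "mconst (a ^ n) = mconst a ^ n"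
  by (induction n) (auto simp: mconst_mult)

lemma mconst_prod: "mconst (prod f A) = (\<Prod>x\<in>A. mconst (f x))"
  by (induction A rule: infinite_finite_induct) (auto simp: mconst_mult)

lemma mconst_of_nat: "mconst (of_nat n) = of_nat n"
  by (induction n) (auto simp: mconst_add)

lemma meval_1 [simp]: "meval P 1 = 1"
  using meval_mconst[of P 1] by (simp del: meval_mconst)

lemma meval_uminus: "meval P (- p) = - meval P p"
  using meval_add[of P p "- p"] by (simp add: eq_neg_iff_add_eq_0 add.commute)

lemma meval_diff: "meval P (p - q) = meval P p - meval P q"
  using meval_add[of P p "- q"] by (simp add: meval_uminus)

lemma meval_power: "meval P (p ^ n) = meval P p ^ n"
  by (induction n) (auto simp: meval_mult)

lemma meval_sum: "meval P (sum f A) = (\<Sum>x\<in>A. meval P (f x))"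
  by (induction A rule: infinite_finite_induct) (auto simp: meval_add)

lemma meval_prod: "meval P (prod f A) = (\<Prod>x\<in>A. meval P (f x))"
  by (induction A rule: infinite_finite_induct) (auto simp: meval_mult)

lemma mpderiv_mconst [simp]: "mpderiv v (mconst c) = 0"
  by (simp add: mconst_def mpderiv_single)

lemma mpderiv_mvar: "mpderiv v (mvar w) = (if v = w then 1 else 0)"
  by (auto simp: mvar_def mpderiv_single lookup_single when_def simp flip: single_one)

lemma mpderiv_1 [simp]: "mpderiv v 1 = 0"
  using mpderiv_mconst[of v 1] by (simp del: mpderiv_mconst)

section \<open>Polynomials in given variables\<close>

definition mpolys :: "'v set \<Rightarrow> ('v, 'k::comm_ring_1) mpoly set" where
  "mpolys V = {p. \<forall>t\<in>Poly_Mapping.keys p. Poly_Mapping.keys t \<subseteq> V}"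

lemma mpolys_add: "p \<in> mpolys V \<Longrightarrow> q \<in> mpolys V \<Longrightarrow> p + q \<in> mpolys V"
  using keys_add[of p q] by (auto simp: mpolys_def subset_iff)

lemma mpolys_single: "Poly_Mapping.keys t \<subseteq> V \<Longrightarrow> Poly_Mapping.single t c \<in> mpolys V"
  by (auto simp: mpolys_def)

lemma mpolys_0 [simp]: "0 \<in> mpolys V"
  by (auto simp: mpolys_def)

lemma mpolys_mconst [simp]: "mconst c \<in> mpolys V"
  by (auto simp: mconst_def mpolys_def)

lemma mpolys_1 [simp]: "1 \<in> mpolys V"
  by (auto simp: mpolys_def)

lemma mpolys_mvar: "v \<in> V \<Longrightarrow> mvar v \<in> mpolys V"
  by (auto simp: mvar_def mpolys_def)

lemma mpolys_mult:
  assumes "p \<in> mpolys V" "q \<in> mpolys V" shows "p * q \<in> mpolys V"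
proof -
  have "Poly_Mapping.keys t \<subseteq> V" if "t \<in> Poly_Mapping.keys (p * q)" for t
  proof -
    from that keys_mult[of p q] obtain a b where "t = a + b" "a \<in> Poly_Mapping.keys p" "b \<in> Poly_Mapping.keys q"
      by blast
    then show ?thesis using assms keys_add[of a b] by (fastforce simp: mpolys_def)
  qed
  then show ?thesis by (auto simp: mpolys_def)
qed

lemma mpolys_uminus: "p \<in> mpolys V \<Longrightarrow> - p \<in> mpolys V"
  using mpolys_mult[of "mconst (-1)" V p] mpolys_mconst[of "-1" V]
  by (simp add: mconst_uminus del: mpolys_mconst)

lemma mpolys_diff: "p \<in> mpolys V \<Longrightarrow> q \<in> mpolys V \<Longrightarrow> p - q \<in> mpolys V"
  using mpolys_add[of p V "- q"] mpolys_uminus[of q V] by simp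

lemma mpolys_power: "p \<in> mpolys V \<Longrightarrow> p ^ n \<in> mpolys V"
  by (induction n) (auto intro: mpolys_mult)

lemma mpolys_sum: "(\<And>x. x \<in> A \<Longrightarrow> f x \<in> mpolys V) \<Longrightarrow> sum f A \<in> mpolys V"
  by (induction A rule: infinite_finite_induct) (auto intro: mpolys_add)

lemma mpolys_prod: "(\<And>x. x \<in> A \<Longrightarrow> f x \<in> mpolys V) \<Longrightarrow> prod f A \<in> mpolys V"
  by (induction A rule: infinite_finite_induct) (auto intro: mpolys_mult)

lemma mpolys_mpderiv:
  assumes "p \<in> mpolys V" shows "mpderiv v p \<in> mpolys V"
  unfolding mpderiv_def
proof (intro mpolys_sum mpolys_single)
  fix t assume "t \<in> Poly_Mapping.keys p"
  moreover have "Poly_Mapping.keys (t - Poly_Mapping.single v 1) \<subseteq> Poly_Mapping.keys t"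
    by (auto simp: in_keys_iff lookup_minus)
  ultimately show "Poly_Mapping.keys (t - Poly_Mapping.single v 1) \<subseteq> V"
    using assms by (auto simp: mpolys_def)
qed

lemmas mpolys_intros = mpolys_add mpolys_mult mpolys_uminus mpolys_diff mpolys_power mpolys_sum
  mpolys_prod mpolys_mvar mpolys_mpderiv mpolys_single

lemma prod_single: "(\<Prod>x\<in>A. Poly_Mapping.single (f x) (g x)) =
    (Poly_Mapping.single (sum f A) (prod g A) :: ('v, 'k::comm_ring_1) mpoly)"
  by (induction A rule: infinite_finite_induct) (auto simp: mult_single)

lemma mvar_power: "mvar v ^ n = (Poly_Mapping.single (Poly_Mapping.single v n) 1 :: ('v, 'k::comm_ring_1) mpoly)"
  by (induction n) (auto simp: mvar_def mult_single simp flip: single_add single_one)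

lemma single_eq_prod_mvar:
  assumes "finite V" "Poly_Mapping.keys t \<subseteq> V"
  shows "(Poly_Mapping.single t 1 :: ('v, 'k::comm_ring_1) mpoly) = (\<Prod>v\<in>V. mvar v ^ Poly_Mapping.lookup t v)"
proof -
  have "(\<Sum>v\<in>V. Poly_Mapping.single v (Poly_Mapping.lookup t v)) = t"
    using assms by (intro poly_mapping_eqI) (auto simp: lookup_sum lookup_single when_def in_keys_iff)
  then show ?thesis by (simp add: mvar_power prod_single)
qed

text \<open>Induction over generators; it later shows that a derivation of the quotient algebra is
  determined by its values on the variables.\<close>

lemma mpolys_induct [consumes 2, case_names const var add mult]:
  assumes "finite V" "p \<in> mpolys V"
    and const: "\<And>c. P (mconst c)" and var: "\<And>v. v \<in> V \<Longrightarrow> P (mvar v)"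
    and add: "\<And>p q. p \<in> mpolys V \<Longrightarrow> q \<in> mpolys V \<Longrightarrow> P p \<Longrightarrow> P q \<Longrightarrow> P (p + q)"
    and mult: "\<And>p q. p \<in> mpolys V \<Longrightarrow> q \<in> mpolys V \<Longrightarrow> P p \<Longrightarrow> P q \<Longrightarrow> P (p * q)"
  shows "P (p :: ('v, 'k::comm_ring_1) mpoly)"
proof -
  have pow: "P (mvar v ^ n)" if "v \<in> V" for v n
    by (induction n) (use that const[of 1] in \<open>auto intro!: mult var mpolys_intros\<close>)
  have prod: "P (\<Prod>v\<in>A. mvar v ^ t v)" if "finite A" "A \<subseteq> V" for A and t :: "'v \<Rightarrow> nat"
    using that by (induction A) (use const[of 1] in \<open>auto intro!: mult pow mpolys_intros\<close>)
  have single: "P (Poly_Mapping.single t c)" if "Poly_Mapping.keys t \<subseteq> V" for t c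
  proof -
    have "P (mconst c * Poly_Mapping.single t 1)"
      unfolding single_eq_prod_mvar[OF \<open>finite V\<close> that]
      by (intro mult const prod) (use \<open>finite V\<close> in \<open>auto intro!: mpolys_intros\<close>)
    then show ?thesis by (simp add: mconst_def mult_single)
  qed
  have "P (\<Sum>t\<in>A. Poly_Mapping.single t (Poly_Mapping.lookup p t))"
    if "finite A" "A \<subseteq> Poly_Mapping.keys p" for A
    using that
  proof (induction A)
    case empty
    then show ?case using const[of 0] by simp
  next
    case (insert t A)
    have t: "Poly_Mapping.keys t' \<subseteq> V" if "t' \<in> insert t A" for t'
      using insert.prems that assms(2) by (auto simp: mpolys_def)
    have "P (Poly_Mapping.single t (Poly_Mapping.lookup p t) + (\<Sum>t\<in>A. Poly_Mapping.single t (Poly_Mapping.lookup p t)))"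
      using insert t by (intro add single mpolys_intros) auto
    then show ?case using insert by simp
  qed
  from this[of "Poly_Mapping.keys p"] show ?thesis by (simp add: mpoly_sum_singles)
qed

section \<open>Derivations with given values on the variables\<close>

text \<open>Lift to the polynomial ring of a derivation of the quotient algebra, given by
  representatives \<open>f v\<close> of its values on the generators. It is a derivation for any
  \<open>f\<close>; whether it descends to the quotient is a separate question.\<close>

definition der :: "'v set \<Rightarrow> ('v \<Rightarrow> ('v, 'k::comm_ring_1) mpoly) \<Rightarrow> ('v, 'k) mpoly \<Rightarrow> ('v, 'k) mpoly" where
  "der V f p = (\<Sum>v\<in>V. f v * mpderiv v p)"

lemma der_add: "der V f (p + q) = der V f p + der V f q"
  by (simp add: der_def mpderiv_add sum.distrib algebra_simps)

lemma der_mult: "der V f (p * q) = der V f p * q + p * der V f q"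
  by (simp add: der_def mpderiv_mult sum.distrib sum_distrib_left algebra_simps)

lemma der_mconst [simp]: "der V f (mconst c) = 0"
  by (simp add: der_def)

lemma der_0 [simp]: "der V f 0 = 0"
  by (simp add: der_def)

lemma der_1 [simp]: "der V f 1 = 0"
  by (simp add: der_def)

lemma der_uminus: "der V f (- p) = - der V f p"
  using der_add[of V f p "- p"] by (simp add: eq_neg_iff_add_eq_0 add.commute)

lemma der_diff: "der V f (p - q) = der V f p - der V f q"
  using der_add[of V f p "- q"] by (simp add: der_uminus)

lemma der_mvar: "finite V \<Longrightarrow> v \<in> V \<Longrightarrow> der V f (mvar v) = f v"
  by (simp add: der_def mpderiv_mvar if_distrib[of "\<lambda>x. _ * x"] cong: if_cong)

lemma mpolys_der: "(\<And>v. v \<in> V \<Longrightarrow> f v \<in> mpolys V) \<Longrightarrow> p \<in> mpolys V \<Longrightarrow> der V f p \<in> mpolys V"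
  unfolding der_def by (intro mpolys_intros) auto

section \<open>Locally nilpotent derivations modulo an ideal\<close>

text \<open>\<open>J\<close> plays the role of an ideal of \<open>P\<close> and \<open>H\<close> that of the homogeneous elements; only
  homogeneous elements are required to form a domain modulo \<open>J\<close>.\<close>

locale graded_lnd =
  fixes P J H :: "'a::comm_ring_1 set" and E :: "'a \<Rightarrow> 'a"
  assumes J0: "0 \<in> J"
    and J_add: "x \<in> J \<Longrightarrow> y \<in> J \<Longrightarrow> x + y \<in> J"
    and J_mult: "x \<in> J \<Longrightarrow> y \<in> P \<Longrightarrow> y * x \<in> J"
    and J_uminus: "x \<in> J \<Longrightarrow> - x \<in> J"
    and J_of_nat: "of_nat n * x \<in> J \<Longrightarrow> n > 0 \<Longrightarrow> x \<in> P \<Longrightarrow> x \<in> J"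
    and H_P: "x \<in> H \<Longrightarrow> x \<in> P"
    and H_1: "1 \<in> H"
    and H_mult: "x \<in> H \<Longrightarrow> y \<in> H \<Longrightarrow> x * y \<in> H"
    and H_E: "x \<in> H \<Longrightarrow> E x \<in> H"
    and P_of_nat: "of_nat n \<in> P"
    and P_mult: "x \<in> P \<Longrightarrow> y \<in> P \<Longrightarrow> x * y \<in> P"
    and H_domain: "x \<in> H \<Longrightarrow> y \<in> H \<Longrightarrow> x * y \<in> J \<Longrightarrow> x \<in> J \<or> y \<in> J"
    and one_notin_J: "1 \<notin> J"
    and E_add: "E (x + y) = E x + E y"
    and E_mult: "E (x * y) = E x * y + x * E y"
    and E_J: "x \<in> J \<Longrightarrow> E x \<in> J"
    and E_nilpotent: "x \<in> H \<Longrightarrow> \<exists>n. (E ^^ n) x \<in> J"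
begin

lemma E_0: "E 0 = 0"
  using E_add[of 0 0] by simp

lemma E_uminus: "E (- x) = - E x"
  using E_add[of x "- x"] by (simp add: E_0 eq_neg_iff_add_eq_0 add.commute)

lemma E_diff: "E (x - y) = E x - E y"
  using E_add[of x "- y"] by (simp add: E_uminus)

lemma E_sum: "E (sum f A) = (\<Sum>a\<in>A. E (f a))"
  by (induction A rule: infinite_finite_induct) (auto simp: E_0 E_add)

lemma E_1: "E 1 = 0"
  using E_mult[of 1 1] by simp

lemma E_of_nat: "E (of_nat n) = 0"
  by (induction n) (auto simp: E_0 E_1 E_add)

lemma J_sum: "(\<And>a. a \<in> A \<Longrightarrow> f a \<in> J) \<Longrightarrow> sum f A \<in> J"
  by (induction A rule: infinite_finite_induct) (auto intro: J0 J_add)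

lemma J_diff: "x \<in> J \<Longrightarrow> y \<in> J \<Longrightarrow> x - y \<in> J"
  using J_add[of x "- y"] J_uminus by simp

lemma Leibniz: "(E ^^ n) (x * y) = (\<Sum>k\<le>n. of_nat (n choose k) * ((E ^^ k) x * (E ^^ (n - k)) y))"
proof (induction n)
  case (Suc n)
  let ?f = "\<lambda>k j. (E ^^ k) x * (E ^^ j) y"
  have "(E ^^ Suc n) (x * y) = (\<Sum>k\<le>n. of_nat (n choose k) * E (?f k (n - k)))"
    by (simp add: Suc E_sum E_mult[of "of_nat _"] E_of_nat)
  also have "\<dots> = (\<Sum>k\<le>n. of_nat (n choose k) * ?f (Suc k) (n - k))
                + (\<Sum>k\<le>n. of_nat (n choose k) * ?f k (Suc n - k))"
    by (simp add: E_mult algebra_simps sum.distrib Suc_diff_le)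
  \<comment> \<open>The added term has the coefficient \<open>n choose Suc n\<close>, which is 0;
    after the index shift both sums merge by Pascal's rule.\<close>
  also have "(\<Sum>k\<le>n. of_nat (n choose k) * ?f k (Suc n - k))
           = (\<Sum>k\<le>Suc n. of_nat (n choose k) * ?f k (Suc n - k))"
    by (simp add: binomial_eq_0)
  also have "\<dots> = ?f 0 (Suc n) + (\<Sum>k\<le>n. of_nat (n choose Suc k) * ?f (Suc k) (n - k))"
    by (subst sum.atMost_Suc_shift) simp
  also have "(\<Sum>k\<le>n. of_nat (n choose k) * ?f (Suc k) (n - k))
      + (?f 0 (Suc n) + (\<Sum>k\<le>n. of_nat (n choose Suc k) * ?f (Suc k) (n - k)))
      = (\<Sum>k\<le>Suc n. of_nat (Suc n choose k) * ?f k (Suc n - k))"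
    by (subst sum.atMost_Suc_shift) (simp add: algebra_simps sum.distrib)
  finally show ?case .
qed simp

lemma E_pow_J: "x \<in> J \<Longrightarrow> (E ^^ n) x \<in> J"
  by (induction n) (auto intro: E_J)

lemma E_pow_H: "x \<in> H \<Longrightarrow> (E ^^ n) x \<in> H"
  by (induction n) (auto intro: H_E)

lemma E_pow_J_mono: "(E ^^ n) x \<in> J \<Longrightarrow> n \<le> m \<Longrightarrow> (E ^^ m) x \<in> J"
  using E_pow_J[of "(E ^^ n) x" "m - n"] funpow_add[of "m - n" n E] by simp

text \<open>The degree function of a locally nilpotent derivation: the last power of
  \<open>E\<close> that does not send \<open>x\<close> into \<open>J\<close>. On \<open>J\<close>
  itself it takes the meaningless value 0, so the rules about products exclude
  \<open>J\<close>.\<close>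

definition nu :: "'a \<Rightarrow> nat" where
  "nu x = (LEAST n. (E ^^ Suc n) x \<in> J)"

lemma E_pow_in_J_iff:
  assumes "x \<in> H" "x \<notin> J" shows "(E ^^ n) x \<in> J \<longleftrightarrow> nu x < n"
proof -
  obtain m where "(E ^^ m) x \<in> J" using E_nilpotent assms by blast
  then have "(E ^^ Suc m) x \<in> J" using E_pow_J_mono[of m x "Suc m"] by simp
  then have *: "(E ^^ Suc (nu x)) x \<in> J" unfolding nu_def by (rule LeastI)
  show ?thesis
  proof
    assume n: "(E ^^ n) x \<in> J"
    then have "n \<noteq> 0" using assms by (cases n) auto
    then obtain k where "n = Suc k" by (cases n) auto
    then show "nu x < n" using n Least_le[of "\<lambda>n. (E ^^ Suc n) x \<in> J" k] by (simp add: nu_def less_Suc_eq_le)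
  qed (use * E_pow_J_mono[of "Suc (nu x)" x n] in auto)
qed

lemma nuI:
  assumes "x \<in> H" "(E ^^ n) x \<notin> J" "(E ^^ Suc n) x \<in> J"
  shows "nu x = n"
proof -
  have "x \<notin> J" using assms(2) E_pow_J by blast
  then show ?thesis using assms E_pow_in_J_iff[of x] by (metis linorder_neqE_nat not_less_eq)
qed

lemma nu_eq_0_iff: "x \<in> H \<Longrightarrow> x \<notin> J \<Longrightarrow> nu x = 0 \<longleftrightarrow> E x \<in> J"
  using E_pow_in_J_iff[of x 1] by simp

text \<open>In the Leibniz formula for the power \<open>nu x + nu y\<close> only the term with
  \<open>k = nu x\<close> can lie outside \<open>J\<close>; its binomial coefficient is cancelled by
  \<open>J_of_nat\<close> and its two factors are separated by \<open>H_domain\<close>. For the next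
  power every term lies in \<open>J\<close>.\<close>

lemma nu_mult:
  assumes x: "x \<in> H" "x \<notin> J" and y: "y \<in> H" "y \<notin> J"
  shows "nu (x * y) = nu x + nu y"
proof (rule nuI)
  show "x * y \<in> H" using x y H_mult by simp
  have term_J: "of_nat c * ((E ^^ k) x * (E ^^ j) y) \<in> J" if "k > nu x \<or> j > nu y" for k j c
    using that
  proof
    assume "k > nu x"
    then have "(E ^^ k) x \<in> J" using E_pow_in_J_iff[OF x] by simp
    then show ?thesis using J_mult[of "(E ^^ k) x" "of_nat c * (E ^^ j) y"] P_of_nat P_mult H_P E_pow_H y
      by (simp add: mult_ac)
  next
    assume "j > nu y"
    then have "(E ^^ j) y \<in> J" using E_pow_in_J_iff[OF y] by simp
    then show ?thesis using J_mult[of "(E ^^ j) y" "of_nat c * (E ^^ k) x"] P_of_nat P_mult H_P E_pow_H x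
      by (simp add: mult_ac)
  qed
  show "(E ^^ Suc (nu x + nu y)) (x * y) \<in> J"
    unfolding Leibniz by (intro J_sum term_J) linarith
  show "(E ^^ (nu x + nu y)) (x * y) \<notin> J"
  proof
    assume *: "(E ^^ (nu x + nu y)) (x * y) \<in> J"
    let ?g = "\<lambda>k. of_nat (nu x + nu y choose k) * ((E ^^ k) x * (E ^^ (nu x + nu y - k)) y)"
    have "(E ^^ (nu x + nu y)) (x * y) = ?g (nu x) + (\<Sum>k\<in>{..nu x + nu y} - {nu x}. ?g k)"
      unfolding Leibniz by (rule sum.remove) auto
    moreover have "?g k \<in> J" if "k \<in> {..nu x + nu y} - {nu x}" for k
    proof (rule term_J)
      show "nu x < k \<or> nu y < nu x + nu y - k" using that by simp linarith
    qed
    then have "(\<Sum>k\<in>{..nu x + nu y} - {nu x}. ?g k) \<in> J"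
      by (rule J_sum)
    ultimately have "?g (nu x) \<in> J"
      using J_diff[OF *, of "\<Sum>k\<in>{..nu x + nu y} - {nu x}. ?g k"] by (simp only: add_diff_cancel_right')
    then have g: "of_nat (nu x + nu y choose nu x) * ((E ^^ nu x) x * (E ^^ nu y) y) \<in> J"
      by simp
    have "(E ^^ nu x) x * (E ^^ nu y) y \<in> P"
      using x y by (intro P_mult H_P E_pow_H)
    then have "(E ^^ nu x) x * (E ^^ nu y) y \<in> J"
      using J_of_nat[OF g] by simp
    then have "(E ^^ nu x) x \<in> J \<or> (E ^^ nu y) y \<in> J"
      using x y by (intro H_domain E_pow_H)
    then show False using E_pow_in_J_iff[OF x, of "nu x"] E_pow_in_J_iff[OF y, of "nu y"] by simp
  qed
qed

lemma notin_J_mult: "x \<in> H \<Longrightarrow> x \<notin> J \<Longrightarrow> y \<in> H \<Longrightarrow> y \<notin> J \<Longrightarrow> x * y \<notin> J"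
  using H_domain by blast

lemma H_power: "x \<in> H \<Longrightarrow> x ^ n \<in> H"
  by (induction n) (auto intro: H_1 H_mult)

lemma H_prod: "(\<And>a. a \<in> A \<Longrightarrow> f a \<in> H) \<Longrightarrow> prod f A \<in> H"
  by (induction A rule: infinite_finite_induct) (auto intro: H_1 H_mult)

lemma notin_J_power: "x \<in> H \<Longrightarrow> x \<notin> J \<Longrightarrow> x ^ n \<notin> J"
proof (induction n)
  case (Suc n)
  then show ?case using notin_J_mult[of x "x ^ n"] H_power[of x n] by simp
qed (simp add: one_notin_J)

lemma notin_J_prod: "(\<And>a. a \<in> A \<Longrightarrow> f a \<in> H \<and> f a \<notin> J) \<Longrightarrow> prod f A \<notin> J"
proof (induction A rule: infinite_finite_induct)
  case (insert a A)
  then show ?case using notin_J_mult[of "f a" "prod f A"] H_prod[of A f] by simp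
qed (auto simp: one_notin_J)

lemma nu_1: "nu 1 = 0"
  using nu_eq_0_iff[of 1] by (simp add: H_1 one_notin_J E_1 J0)

lemma nu_power: "x \<in> H \<Longrightarrow> x \<notin> J \<Longrightarrow> nu (x ^ n) = n * nu x"
  by (induction n) (simp_all add: nu_1 nu_mult H_power notin_J_power)

lemma nu_prod: "(\<And>a. a \<in> A \<Longrightarrow> f a \<in> H \<and> f a \<notin> J) \<Longrightarrow> nu (prod f A) = (\<Sum>a\<in>A. nu (f a))"
  by (induction A rule: infinite_finite_induct) (simp_all add: nu_1 nu_mult H_prod notin_J_prod)

lemma nu_E: "x \<in> H \<Longrightarrow> E x \<notin> J \<Longrightarrow> nu x = Suc (nu (E x))"
proof (rule nuI)
  assume x: "x \<in> H" "E x \<notin> J"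
  note * = E_pow_in_J_iff[of "E x", OF H_E[OF x(1)] x(2)]
  show "(E ^^ Suc (nu (E x))) x \<notin> J" "(E ^^ Suc (Suc (nu (E x)))) x \<in> J"
    using *[of "nu (E x)"] *[of "Suc (nu (E x))"] unfolding funpow_Suc_right comp_def by simp_all
qed

lemma E_pow_diff: "(E ^^ n) (x - y) = (E ^^ n) x - (E ^^ n) y"
  by (induction n) (auto simp: E_diff)

lemma J_cong: "x - y \<in> J \<Longrightarrow> x \<in> J \<longleftrightarrow> y \<in> J"
  using J_add[of "x - y" y] J_diff[of x "x - y"] by auto

lemma nu_cong: assumes "x - y \<in> J" shows "nu x = nu y"
proof -
  have "(E ^^ n) x \<in> J \<longleftrightarrow> (E ^^ n) y \<in> J" for n
    using J_cong[of "(E ^^ n) x" "(E ^^ n) y"] E_pow_J[OF assms, of n] by (simp only: E_pow_diff)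
  then show ?thesis unfolding nu_def by presburger
qed

text \<open>Otherwise \<open>nu (E x) = nu x - 1\<close> would be the degree of a multiple of \<open>x\<close>.\<close>

lemma E_in_J_of_dvd:
  assumes "x \<in> H" "g \<in> H" "E x - x * g \<in> J"
  shows "E x \<in> J"
proof (rule ccontr)
  assume E: "E x \<notin> J"
  then have "x * g \<notin> J" using J_cong assms by blast
  then have "x \<notin> J" "g \<notin> J"
    using J_mult[of x g] J_mult[of g x] assms H_P by (auto simp: mult.commute)
  then have "nu (E x) = nu x + nu g"
    using nu_cong[OF assms(3)] nu_mult assms by simp
  then show False using nu_E[OF assms(1) E] by simp
qed

end

section \<open>The polynomial ring and the trinomial ideal\<close>

lemma mpoly_ring_simps [simp]:
  "carrier (mpoly_ring V) = mpolys V" "\<zero>\<^bsub>mpoly_ring V\<^esub> = 0" "\<one>\<^bsub>mpoly_ring V\<^esub> = 1"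
  "x \<oplus>\<^bsub>mpoly_ring V\<^esub> y = x + y" "x \<otimes>\<^bsub>mpoly_ring V\<^esub> y = x * y"
  by (auto simp: mpoly_ring_def mpolys_def)

lemma cring_mpoly_ring: "cring (mpoly_ring V)"
proof (rule cringI)
  show "abelian_group (mpoly_ring V)"
    by (rule abelian_groupI) (auto simp: mpolys_add algebra_simps intro: exI[of _ "- _"] mpolys_uminus
        intro!: bexI[of _ "- _"])
  show "Group.comm_monoid (mpoly_ring V)"
    by (rule comm_monoidI) (auto simp: mpolys_mult algebra_simps)
qed (auto simp: algebra_simps)

lemma ideal_mpoly_ringI:
  assumes "I \<subseteq> mpolys V" "0 \<in> I" "\<And>x y. x \<in> I \<Longrightarrow> y \<in> I \<Longrightarrow> x + y \<in> I"
    "\<And>x y. x \<in> I \<Longrightarrow> y \<in> mpolys V \<Longrightarrow> y * x \<in> I"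
  shows "ideal I (mpoly_ring V)"
proof -
  interpret cring "mpoly_ring V" by (rule cring_mpoly_ring)
  have inv: "\<ominus>\<^bsub>mpoly_ring V\<^esub> x = - x" if "x \<in> mpolys V" for x
    using that by (intro sum_zero_eq_neg[symmetric]) (auto intro: mpolys_uminus)
  have um: "\<ominus>\<^bsub>mpoly_ring V\<^esub> x \<in> I" if "x \<in> I" for x
    using assms(4)[OF that mpolys_mconst[of "-1"]] inv[of x] assms(1) that by (auto simp: mconst_uminus)
  show ?thesis
  proof (rule idealI[OF local.ring_axioms])
    show "subgroup I (add_monoid (mpoly_ring V))"
      using assms um by (intro add.subgroupI) (auto simp: a_inv_def[symmetric])
  qed (use assms in \<open>auto simp: mult.commute\<close>)
qed

lemma Tpow_in_mpolys: "i \<in> blocks D \<Longrightarrow> Tpow D i \<in> mpolys (tvars D)"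
  unfolding Tpow_def by (intro mpolys_intros) (auto simp: tvars_def T_indices_def)

lemma relations_subset: "relations D \<subseteq> mpolys (tvars D)"
proof (cases "tr_A D")
  case (Type1 a)
  then show ?thesis
    by (auto simp: relations_def iota_def blocks_def intro!: mpolys_intros Tpow_in_mpolys)
next
  case (Type2 a)
  then show ?thesis
    by (auto simp: relations_def iota_def blocks_def det_3 intro!: mpolys_intros Tpow_in_mpolys)
qed

lemma ideal_trinomial_ideal: "ideal (trinomial_ideal D) (mpoly_ring (tvars D))"
proof -
  interpret cring "mpoly_ring (tvars D)" by (rule cring_mpoly_ring)
  show ?thesis unfolding trinomial_ideal_def
    using relations_subset by (intro genideal_ideal) auto
qed

lemma trinomial_ideal_relations: "relations D \<subseteq> trinomial_ideal D"
proof -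
  interpret cring "mpoly_ring (tvars D)" by (rule cring_mpoly_ring)
  show ?thesis unfolding trinomial_ideal_def
    using relations_subset by (intro genideal_self) auto
qed

text \<open>Serves as the induction principle for the ideal: once a property defines an ideal, such
  as vanishing at a point, it need only be checked on the relations.\<close>

lemma trinomial_ideal_minimal:
  assumes "I \<subseteq> mpolys (tvars D)" "0 \<in> I" "\<And>x y. x \<in> I \<Longrightarrow> y \<in> I \<Longrightarrow> x + y \<in> I"
    "\<And>x y. x \<in> I \<Longrightarrow> y \<in> mpolys (tvars D) \<Longrightarrow> y * x \<in> I" "relations D \<subseteq> I"
  shows "trinomial_ideal D \<subseteq> I"
proof -
  interpret cring "mpoly_ring (tvars D)" by (rule cring_mpoly_ring)
  show ?thesis unfolding trinomial_ideal_def
    by (intro genideal_minimal ideal_mpoly_ringI assms)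
qed

lemma finite_tvars: "finite (tvars D)"
proof -
  have "tvars D \<subseteq> (\<lambda>(i, j). T i j) ` Sigma (blocks D) (\<lambda>i. {1..tr_n D i}) \<union> S ` {1..tr_m D}"
    by (force simp: tvars_def T_indices_def)
  moreover have "finite \<dots>" by (auto simp: blocks_def)
  ultimately show ?thesis by (rule finite_subset)
qed

section \<open>Calculation modulo the trinomial ideal\<close>

locale trinomial =
  fixes D :: "'k::{alg_closed_field, field_char_0} trinomial_data"
  assumes data: "trinomial_data D"
begin

abbreviation "V \<equiv> tvars D"
abbreviation "J \<equiv> trinomial_ideal D"
abbreviation "r \<equiv> tr_r D"
abbreviation "n \<equiv> tr_n D"
abbreviation "l \<equiv> tr_l D"
text \<open>Index 0 is included also in type 1, where it stands for an empty block that carries the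
  constants of the relations.\<close>

abbreviation "M \<equiv> {0..r}"

lemma r_pos: "r > 0" and n_pos: "i \<in> blocks D \<Longrightarrow> n i > 0"
  and l_pos: "i \<in> blocks D \<Longrightarrow> 1 \<le> j \<Longrightarrow> j \<le> n i \<Longrightarrow> l i j > 0"
  using data by (auto simp: trinomial_data_def T_indices_def)

lemma T_in_V [simp]: "T i j \<in> V \<longleftrightarrow> i \<in> blocks D \<and> 1 \<le> j \<and> j \<le> n i"
  and S_in_V [simp]: "S k \<in> V \<longleftrightarrow> 1 \<le> k \<and> k \<le> tr_m D"
  by (auto simp: tvars_def T_indices_def)

lemma blocks_subset: "blocks D \<subseteq> M"
  and in_blocks: "i \<in> M \<Longrightarrow> i \<noteq> 0 \<Longrightarrow> i \<in> blocks D"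
  by (auto simp: blocks_def iota_def split: coeffs.splits)

lemma J_subset: "J \<subseteq> mpolys V"
  using ideal.axioms(1)[OF ideal_trinomial_ideal[of D], THEN additive_subgroup.a_subset] by simp

lemma J_0 [simp]: "0 \<in> J"
  using additive_subgroup.zero_closed[OF ideal.axioms(1)[OF ideal_trinomial_ideal[of D]]] by simp

lemma J_add: "x \<in> J \<Longrightarrow> y \<in> J \<Longrightarrow> x + y \<in> J"
  using additive_subgroup.a_closed[OF ideal.axioms(1)[OF ideal_trinomial_ideal[of D]]] by simp

lemma J_mult: "x \<in> J \<Longrightarrow> y \<in> mpolys V \<Longrightarrow> y * x \<in> J"
  using ideal.I_l_closed[OF ideal_trinomial_ideal[of D]] by simp

lemma J_mult_right: "x \<in> J \<Longrightarrow> y \<in> mpolys V \<Longrightarrow> x * y \<in> J"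
  using J_mult by (simp add: mult.commute)

lemma J_uminus: "x \<in> J \<Longrightarrow> - x \<in> J"
  using J_mult[OF _ mpolys_mconst[of "-1"], of x] by (simp add: mconst_uminus)

lemma J_diff: "x \<in> J \<Longrightarrow> y \<in> J \<Longrightarrow> x - y \<in> J"
  using J_add[of x "- y"] J_uminus by simp

lemma J_sum: "(\<And>a. a \<in> A \<Longrightarrow> f a \<in> J) \<Longrightarrow> sum f A \<in> J"
  by (induction A rule: infinite_finite_induct) (auto intro: J_add)

lemma J_mconst_mult: "c \<noteq> 0 \<Longrightarrow> mconst c * x \<in> J \<Longrightarrow> x \<in> J"
  using J_mult[of "mconst c * x" "mconst (1 / c)"] by (simp flip: mult.assoc mconst_mult)

definition cong :: "(tvar, 'k) mpoly \<Rightarrow> (tvar, 'k) mpoly \<Rightarrow> bool" (infix "\<sim>" 50) where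
  "x \<sim> y \<longleftrightarrow> x - y \<in> J"

lemma cong_refl [simp]: "x \<sim> x"
  by (simp add: cong_def)

lemma cong_sym: "x \<sim> y \<Longrightarrow> y \<sim> x"
  using J_uminus[of "x - y"] by (simp add: cong_def)

lemma cong_trans [trans]: "x \<sim> y \<Longrightarrow> y \<sim> z \<Longrightarrow> x \<sim> z"
  using J_add[of "x - y" "y - z"] by (simp add: cong_def)

lemma cong_0_iff: "x \<sim> 0 \<longleftrightarrow> x \<in> J"
  by (simp add: cong_def)

lemma cong_J_iff: "x \<sim> y \<Longrightarrow> x \<in> J \<longleftrightarrow> y \<in> J"
  using J_add[of "x - y" y] J_diff[of x "x - y"] by (auto simp: cong_def)

lemma cong_add: "x \<sim> y \<Longrightarrow> x' \<sim> y' \<Longrightarrow> x + x' \<sim> y + y'"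
  using J_add[of "x - y" "x' - y'"] by (simp add: cong_def algebra_simps)

lemma cong_diff: "x \<sim> y \<Longrightarrow> x' \<sim> y' \<Longrightarrow> x - x' \<sim> y - y'"
  using J_diff[of "x - y" "x' - y'"] by (simp add: cong_def algebra_simps)

lemma cong_mult:
  assumes "x \<sim> y" "x' \<sim> y'" "x' \<in> mpolys V" "y \<in> mpolys V"
  shows "x * x' \<sim> y * y'"
  using J_add[OF J_mult_right[of "x - y" x'] J_mult[of "x' - y'" y]] assms
  by (simp add: cong_def algebra_simps)

lemma cong_mult_left: "x \<sim> y \<Longrightarrow> z \<in> mpolys V \<Longrightarrow> z * x \<sim> z * y"
  using J_mult[of "x - y" z] by (simp add: cong_def algebra_simps)

lemma cong_sum: "(\<And>a. a \<in> A \<Longrightarrow> f a \<sim> g a) \<Longrightarrow> sum f A \<sim> sum g A"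
  by (induction A rule: infinite_finite_induct) (auto intro: cong_add)

section \<open>Degrees\<close>

text \<open>Degrees in \<open>K\<^sub>0\<close> are represented by exponent vectors modulo \<open>deq\<close>; the coarser relation
  \<open>beq\<close> also identifies the degrees of \<open>1\<close> and of the block monomials.\<close>

definition deq :: "(tvar \<Rightarrow> int) \<Rightarrow> (tvar \<Rightarrow> int) \<Rightarrow> bool" where
  "deq e f \<longleftrightarrow> (\<exists>u. \<forall>v\<in>V. e v = f v + (\<Sum>i=1..r. P0 D i v * u i))"

definition beq :: "(tvar \<Rightarrow> int) \<Rightarrow> (tvar \<Rightarrow> int) \<Rightarrow> bool" where
  "beq e f \<longleftrightarrow> (\<exists>w. \<forall>v\<in>V. e v = f v + (case v of T i j \<Rightarrow> int (l i j) * w i | S k \<Rightarrow> 0))"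

lemma deq_refl [simp]: "deq e e"
  unfolding deq_def by (rule exI[of _ "\<lambda>_. 0"]) simp

lemma deq_add:
  assumes "deq e f" "deq e' f'" shows "deq (\<lambda>v. e v + e' v) (\<lambda>v. f v + f' v)"
proof -
  from assms obtain u u' where "\<forall>v\<in>V. e v = f v + (\<Sum>i=1..r. P0 D i v * u i)"
    "\<forall>v\<in>V. e' v = f' v + (\<Sum>i=1..r. P0 D i v * u' i)" unfolding deq_def by blast
  then show ?thesis unfolding deq_def
    by (intro exI[of _ "\<lambda>i. u i + u' i"]) (auto simp: sum.distrib algebra_simps)
qed

lemma deq_minus:
  assumes "deq e f" shows "deq (\<lambda>v. - e v) (\<lambda>v. - f v)"
proof -
  from assms obtain u where "\<forall>v\<in>V. e v = f v + (\<Sum>i=1..r. P0 D i v * u i)"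
    unfolding deq_def by blast
  then show ?thesis unfolding deq_def
    by (intro exI[of _ "\<lambda>i. - u i"]) (auto simp: sum_negf)
qed

lemma deq_diff: "deq e f \<Longrightarrow> deq e' f' \<Longrightarrow> deq (\<lambda>v. e v - e' v) (\<lambda>v. f v - f' v)"
  using deq_add[OF _ deq_minus, of e f e' f'] by simp

lemma deq_trans: "deq e f \<Longrightarrow> deq f g \<Longrightarrow> deq e g"
  using deq_diff[OF deq_add[of e f f g] deq_refl[of f]] by simp

lemma deq_sym: "deq e f \<Longrightarrow> deq f e"
  using deq_diff[OF deq_refl[of "\<lambda>v. e v + f v"], of e f] by simp

lemma beq_sym:
  assumes "beq e f" shows "beq f e"
proof -
  from assms obtain w where "\<forall>v\<in>V. e v = f v + (case v of T i j \<Rightarrow> int (l i j) * w i | S k \<Rightarrow> 0)"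
    unfolding beq_def by blast
  then show ?thesis unfolding beq_def by (intro exI[of _ "\<lambda>i. - w i"]) (auto split: tvar.splits)
qed

lemma beq_trans:
  assumes "beq e f" "beq f g" shows "beq e g"
proof -
  from assms obtain w w' where
    "\<forall>v\<in>V. e v = f v + (case v of T i j \<Rightarrow> int (l i j) * w i | S k \<Rightarrow> 0)"
    "\<forall>v\<in>V. f v = g v + (case v of T i j \<Rightarrow> int (l i j) * w' i | S k \<Rightarrow> 0)"
    unfolding beq_def by blast
  then show ?thesis unfolding beq_def
    by (intro exI[of _ "\<lambda>i. w i + w' i"]) (auto simp: algebra_simps split: tvar.splits)
qed

text \<open>An element of the image of the transpose of \<open>P0\<close> is an integer multiple of
  the exponent vector on each block. The multipliers are free on the blocks from 1 on; that of block
  0, which exists only in type 2, makes their sum zero. Dropping this last condition turns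
  \<open>deq\<close> into \<open>beq\<close>.\<close>

lemma sum_P0_T:
  assumes "k \<in> M"
  shows "(\<Sum>i=1..r. P0 D i (T k j) * u i) = int (l k j) * (if k = 0 then - (\<Sum>i=1..r. u i) else u k)"
proof (cases "k = 0")
  case False
  then have "(\<Sum>i=1..r. P0 D i (T k j) * u i) = (\<Sum>i=1..r. if i = k then int (l k j) * u k else 0)"
    by (intro sum.cong) auto
  then show ?thesis using assms False by simp
qed (simp add: sum_distrib_left sum_negf)

lemma deq_imp_beq: assumes "deq e f" shows "beq e f"
proof -
  from assms obtain u where u: "\<forall>v\<in>V. e v = f v + (\<Sum>i=1..r. P0 D i v * u i)"
    unfolding deq_def by blast
  have "e v = f v + (case v of T i j \<Rightarrow> int (l i j) * (if i = 0 then - (\<Sum>i=1..r. u i) else u i) | S k \<Rightarrow> 0)"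
    if "v \<in> V" for v
  proof (cases v)
    case (T i j)
    then show ?thesis using u that sum_P0_T[of i j u] blocks_subset by auto
  next
    case (S k)
    then show ?thesis using u that by auto
  qed
  then show ?thesis unfolding beq_def by (intro exI) auto
qed

definition dg :: "(tvar \<Rightarrow>\<^sub>0 nat) \<Rightarrow> tvar \<Rightarrow> int" where
  "dg t v = int (Poly_Mapping.lookup t v)"

lemma dg_add: "dg (s + t) = (\<lambda>v. dg s v + dg t v)"
  by (auto simp: dg_def lookup_add)

lemma dg_0: "dg 0 = (\<lambda>_. 0)"
  by (auto simp: dg_def)

definition hom :: "(tvar \<Rightarrow> int) \<Rightarrow> (tvar, 'k) mpoly \<Rightarrow> bool" where
  "hom e p \<longleftrightarrow> p \<in> mpolys V \<and> (\<forall>t\<in>Poly_Mapping.keys p. deq (dg t) e)"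

lemma hom_mpolys: "hom e p \<Longrightarrow> p \<in> mpolys V"
  by (simp add: hom_def)

lemma hom_cong: "hom e p \<Longrightarrow> deq e f \<Longrightarrow> hom f p"
  by (auto simp: hom_def intro: deq_trans)

lemma hom_0 [simp]: "hom e 0"
  by (simp add: hom_def)

lemma hom_add: "hom e p \<Longrightarrow> hom e q \<Longrightarrow> hom e (p + q)"
  using keys_add[of p q] by (auto simp: hom_def mpolys_add)

lemma hom_uminus: "hom e p \<Longrightarrow> hom e (- p)"
  by (auto simp: hom_def mpolys_uminus in_keys_iff)

lemma hom_diff: "hom e p \<Longrightarrow> hom e q \<Longrightarrow> hom e (p - q)"
  using hom_add[of e p "- q"] hom_uminus by simp

lemma hom_sum: "(\<And>a. a \<in> A \<Longrightarrow> hom e (f a)) \<Longrightarrow> hom e (sum f A)"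
  by (induction A rule: infinite_finite_induct) (auto intro: hom_add)

lemma hom_mult:
  assumes "hom e p" "hom f q" shows "hom (\<lambda>v. e v + f v) (p * q)"
proof -
  have "deq (dg t) (\<lambda>v. e v + f v)" if "t \<in> Poly_Mapping.keys (p * q)" for t
  proof -
    from that keys_mult[of p q] obtain a b where "t = a + b" "a \<in> Poly_Mapping.keys p" "b \<in> Poly_Mapping.keys q"
      by blast
    then show ?thesis using assms by (auto simp: hom_def dg_add intro!: deq_add)
  qed
  then show ?thesis using assms by (auto simp: hom_def mpolys_mult)
qed

lemma hom_single: "Poly_Mapping.keys t \<subseteq> V \<Longrightarrow> deq (dg t) e \<Longrightarrow> hom e (Poly_Mapping.single t c)"
  by (auto simp: hom_def mpolys_single)

lemma hom_mconst: "hom (\<lambda>_. 0) (mconst c)"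
  unfolding mconst_def by (rule hom_single) (auto simp: dg_0)

lemma hom_1: "hom (\<lambda>_. 0) 1"
  using hom_mconst[of 1] by simp

lemma hom_mconst_mult: "hom e p \<Longrightarrow> hom e (mconst c * p)"
  using hom_mult[OF hom_mconst[of c], of e p] by simp

definition unit :: "tvar \<Rightarrow> tvar \<Rightarrow> int" where
  "unit v w = (if v = w then 1 else 0)"

lemma dg_single_1: "dg (Poly_Mapping.single v 1) = unit v"
  by (auto simp: dg_def unit_def lookup_single when_def)

lemma hom_mvar: "v \<in> V \<Longrightarrow> hom (unit v) (mvar v)"
  unfolding mvar_def by (rule hom_single) (auto simp: dg_single_1[simplified])

lemma hom_mpderiv:
  assumes "hom e p" shows "hom (\<lambda>w. e w - unit v w) (mpderiv v p)"
  unfolding mpderiv_def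
proof (rule hom_sum)
  fix t assume t: "t \<in> Poly_Mapping.keys p"
  show "hom (\<lambda>w. e w - unit v w) (Poly_Mapping.single (t - Poly_Mapping.single v 1)
     (of_nat (Poly_Mapping.lookup t v) * Poly_Mapping.lookup p t))"
  proof (cases "Poly_Mapping.lookup t v = 0")
    case False
    then have *: "dg (t - Poly_Mapping.single v 1) = (\<lambda>w. dg t w - unit v w)"
      by (intro ext) (auto simp: dg_def unit_def lookup_minus lookup_single when_def)
    have "Poly_Mapping.keys (t - Poly_Mapping.single v 1) \<subseteq> Poly_Mapping.keys t"
      by (auto simp: in_keys_iff lookup_minus)
    then have k: "Poly_Mapping.keys (t - Poly_Mapping.single v 1) \<subseteq> V"
      using assms t by (auto simp: hom_def mpolys_def)
    have "deq (dg (t - Poly_Mapping.single v 1)) (\<lambda>w. e w - unit v w)"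
      unfolding * using assms t by (intro deq_diff) (auto simp: hom_def)
    with k show ?thesis by (rule hom_single)
  qed simp
qed


section \<open>The linear relations between the block monomials\<close>

text \<open>Type 1 is treated as type 2 with an additional empty block \<open>0\<close>, whose monomial is \<open>1\<close> and
  whose column is \<open>(0, 1)\<close>; the column of a block \<open>i \<ge> 1\<close> is then \<open>(1, - a i)\<close>.\<close>

definition Y :: "nat \<Rightarrow> (tvar, 'k) mpoly" where
  "Y i = (if i \<in> blocks D then Tpow D i else 1)"

definition col :: "nat \<Rightarrow> 'k \<times> 'k" where
  "col i = (case tr_A D of Type1 a \<Rightarrow> if i = 0 then (0, 1) else (1, - a i)
                         | Type2 a \<Rightarrow> (a i $ 1, a i $ 2))"

definition dt :: "nat \<Rightarrow> nat \<Rightarrow> 'k" where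
  "dt i j = fst (col i) * snd (col j) - snd (col i) * fst (col j)"

text \<open>The two reference blocks. In type 1 the second one is the empty block, so that a binary
  form in their monomials becomes a polynomial in the first.\<close>

definition pb :: nat where "pb = (case tr_A D of Type1 _ \<Rightarrow> 1 | Type2 _ \<Rightarrow> block_p D)"
definition qb :: nat where "qb = (case tr_A D of Type1 _ \<Rightarrow> 0 | Type2 _ \<Rightarrow> block_q D)"

text \<open>With \<open>lam i\<close>, the coordinates of \<open>col i\<close> in the basis
  \<open>col pb\<close>, \<open>col qb\<close>, by Cramer's rule.\<close>

definition kap :: "nat \<Rightarrow> 'k" where "kap i = dt i qb / dt pb qb"
definition lam :: "nat \<Rightarrow> 'k" where "lam i = dt pb i / dt pb qb"

lemma pb_in_M: "pb \<in> M" and qb_in_M: "qb \<in> M" and pb_neq_qb: "pb \<noteq> qb"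
  using r_pos by (auto simp: pb_def qb_def block_p_def block_q_def blocks_def iota_def split: coeffs.splits)

lemma dt_nonzero: assumes "i \<in> M" "j \<in> M" "i \<noteq> j" shows "dt i j \<noteq> 0"
proof (cases "tr_A D")
  case (Type1 a)
  then have "inj_on a {1..r}" using data by (auto simp: trinomial_data_def blocks_def iota_def)
  then have "a j \<noteq> a i" if "i \<noteq> 0" "j \<noteq> 0"
    using inj_onD[of a "{1..r}" i j] assms that by auto
  then show ?thesis using assms(3) Type1 by (simp add: dt_def col_def)
next
  case (Type2 a)
  then have "a i \<noteq> a j \<and> vec.independent {a i, a j}"
    using data assms by (auto simp: trinomial_data_def blocks_def iota_def)
  then have ind: "a j \<noteq> 0" "a i \<notin> vec.span {a j}"
    using vec.dependent_zero[of "{a i, a j}"] vec.independent_insert[of "a i" "{a j}"] by auto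
  show ?thesis
  proof
    assume "dt i j = 0"
    then have d: "a i $ 1 * a j $ 2 = a i $ 2 * a j $ 1" using Type2 by (simp add: dt_def col_def)
    have "\<exists>c. a i = c *s a j"
    proof (cases "a j $ 1 = 0")
      case True
      then have "a j $ 2 \<noteq> 0" using ind(1) by (auto simp: vec_eq_iff forall_2)
      then show ?thesis using True d
        by (intro exI[of _ "a i $ 2 / a j $ 2"]) (auto simp: vec_eq_iff forall_2)
    next
      case False
      then show ?thesis using d
        by (intro exI[of _ "a i $ 1 / a j $ 1"]) (auto simp: vec_eq_iff forall_2 field_simps)
    qed
    then show False using ind(2) by (auto simp: vec.span_singleton)
  qed
qed

lemma kap_pb [simp]: "kap pb = 1" and lam_pb [simp]: "lam pb = 0"
  and kap_qb [simp]: "kap qb = 0" and lam_qb [simp]: "lam qb = 1"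
  using dt_nonzero[OF pb_in_M qb_in_M pb_neq_qb] by (simp_all add: kap_def lam_def, simp_all add: dt_def)

text \<open>Passing to coordinates divides every determinant of two columns by
  \<open>dt pb qb\<close>.\<close>

lemma kap_lam_det:
  assumes "i \<in> M" "j \<in> M" "i \<noteq> j" shows "kap i * lam j - lam i * kap j \<noteq> 0"
proof -
  have "(kap i * lam j - lam i * kap j) * dt pb qb * dt pb qb = dt i j * dt pb qb"
    using dt_nonzero[OF pb_in_M qb_in_M pb_neq_qb]
    by (simp add: kap_def lam_def field_simps) (simp add: dt_def algebra_simps)
  then show ?thesis using dt_nonzero[OF assms] dt_nonzero[OF pb_in_M qb_in_M pb_neq_qb] by auto
qed

lemma kap_lam_nonzero: assumes "i \<in> M" shows "kap i \<noteq> 0 \<or> lam i \<noteq> 0"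
proof (cases "i = pb")
  case False
  then show ?thesis using kap_lam_det[OF assms pb_in_M] by auto
qed simp

lemma Y_in_mpolys: "Y i \<in> mpolys V"
  by (auto simp: Y_def intro: Tpow_in_mpolys)

text \<open>The relations link only neighbouring blocks. This turns them into a global statement:
  modulo the ideal the block monomials form a vector in the row space of the matrix of columns,
  \<open>u1\<close> and \<open>u2\<close> being the coefficients of its rows.\<close>

lemma Y_in_span:
  obtains u1 u2 where "u1 \<in> mpolys V" "u2 \<in> mpolys V"
    "\<And>i. i \<in> M \<Longrightarrow> Y i \<sim> mconst (fst (col i)) * u1 + mconst (snd (col i)) * u2"
proof (cases "tr_A D")
  case (Type1 a)
  \<comment> \<open>Modulo the ideal \<open>Y i + a i\<close> is the same for all blocks; this is
    its value at block 1.\<close>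
  let ?u = "Y 1 + mconst (a 1)"
  have rel: "Y i - Y (i + 1) - mconst (a (i + 1) - a i) \<in> J" if "1 \<le> i" "i + 1 \<le> r" for i
    using subsetD[OF trinomial_ideal_relations[of D], of "Y i - Y (i + 1) - mconst (a (i + 1) - a i)"] that Type1
    by (force simp: relations_def Y_def blocks_def iota_def)
  have pos: "i \<le> r \<longrightarrow> Y i \<sim> ?u - mconst (a i)" if "1 \<le> i" for i
    using that
  proof (induction i rule: dec_induct)
    case (step i)
    show ?case
    proof
      assume "Suc i \<le> r"
      then have "Y i - (?u - mconst (a i)) \<in> J" "Y i - Y (i + 1) - mconst (a (i + 1) - a i) \<in> J"
        using step rel[of i] by (auto simp: cong_def)
      from J_diff[OF this] show "Y (Suc i) \<sim> ?u - mconst (a (Suc i))"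
        by (simp add: cong_def mconst_diff algebra_simps)
    qed
  qed simp
  show ?thesis
  proof (rule that[of ?u 1])
    fix i assume "i \<in> M"
    then show "Y i \<sim> mconst (fst (col i)) * ?u + mconst (snd (col i)) * 1"
      using pos[of i] Type1 by (cases "i = 0") (auto simp: col_def mconst_uminus Y_def blocks_def iota_def)
  qed (auto intro: mpolys_intros Y_in_mpolys)
next
  case (Type2 a)
  \<comment> \<open>Cramer's rule for the equations of blocks 0 and 1, solved for the row
    coefficients \<open>u1\<close> and \<open>u2\<close>.\<close>
  define d :: "(tvar, 'k) mpoly" where "d = mconst (1 / dt 0 1)"
  define u1 where "u1 = d * (mconst (snd (col 1)) * Y 0 - mconst (snd (col 0)) * Y 1)"
  define u2 where "u2 = d * (mconst (fst (col 0)) * Y 1 - mconst (fst (col 1)) * Y 0)"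
  have "dt 0 1 \<noteq> 0" using dt_nonzero[of 0 1] r_pos by auto
  then have "d * mconst (dt 0 1) = 1" by (simp add: d_def flip: mconst_mult)
  then have d: "d * (mconst (fst (col 0)) * mconst (snd (col 1)) - mconst (snd (col 0)) * mconst (fst (col 1))) = 1"
    by (simp add: dt_def mconst_mult mconst_diff)
  let ?L = "\<lambda>i. mconst (fst (col i)) * u1 + mconst (snd (col i)) * u2"
  have "?L 0 = d * (mconst (fst (col 0)) * mconst (snd (col 1)) - mconst (snd (col 0)) * mconst (fst (col 1))) * Y 0"
    "?L 1 = d * (mconst (fst (col 0)) * mconst (snd (col 1)) - mconst (snd (col 0)) * mconst (fst (col 1))) * Y 1"
    by (simp_all add: u1_def u2_def algebra_simps)
  then have "?L 0 = Y 0" "?L 1 = Y 1" unfolding d by simp_all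
  then have base: "Y 0 \<sim> ?L 0" "Y 1 \<sim> ?L 1" by simp_all
  have rel: "mconst (dt (i + 1) (i + 2)) * Y i - mconst (dt i (i + 2)) * Y (i + 1)
      + mconst (dt i (i + 1)) * Y (i + 2) \<in> J" if "i + 2 \<le> r" for i
  proof -
    have "det (vector [vector [Tpow D i, Tpow D (i + 1), Tpow D (i + 2)],
                          vector [mconst (a i $ 1), mconst (a (i + 1) $ 1), mconst (a (i + 2) $ 1)],
                          vector [mconst (a i $ 2), mconst (a (i + 1) $ 2), mconst (a (i + 2) $ 2)]]
                        :: (tvar, 'k) mpoly ^ 3 ^ 3) \<in> J" (is "?det \<in> J")
      using trinomial_ideal_relations[of D] that Type2 by (auto simp: relations_def)
    also have "?det = mconst (dt (i + 1) (i + 2)) * Y i - mconst (dt i (i + 2)) * Y (i + 1)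
      + mconst (dt i (i + 1)) * Y (i + 2)"
      using that Type2 by (simp add: det_3 dt_def col_def Y_def blocks_def iota_def mconst_mult mconst_diff algebra_simps)
    finally show ?thesis .
  qed
  have "i \<le> r \<longrightarrow> Y i \<sim> ?L i" for i
  proof (induction i rule: less_induct)
    case (less i)
    show ?case
    proof
      assume i: "i \<le> r"
      consider "i = 0" | "i = 1" | k where "i = k + 2" by (metis One_nat_def add_2_eq_Suc' not0_implies_Suc)
      then show "Y i \<sim> ?L i"
      proof cases
        case (3 k)
        let ?a = "mconst (dt (k + 1) (k + 2)) :: (tvar, 'k) mpoly"
        let ?b = "mconst (dt k (k + 2)) :: (tvar, 'k) mpoly"
        let ?c = "mconst (dt k (k + 1)) :: (tvar, 'k) mpoly"
        have "?a * (Y k - ?L k) \<in> J" "?b * (Y (k + 1) - ?L (k + 1)) \<in> J"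
          using less[of k] less[of "k + 1"] 3 i by (auto intro!: J_mult simp: cong_def)
        then have "(?a * Y k - ?b * Y (k + 1) + ?c * Y (k + 2))
            - (?a * (Y k - ?L k) - ?b * (Y (k + 1) - ?L (k + 1))) \<in> J"
          using rel[of k] 3 i by (intro J_diff) auto
        \<comment> \<open>The expressions \<open>?L\<close> satisfy the three-term relation
          identically, by the linear dependence of three vectors in the plane. Subtracting leaves
          \<open>Y (k + 2) - ?L (k + 2)\<close> times a nonzero constant.\<close>
        also have "?a * ?L k - ?b * ?L (k + 1) + ?c * ?L (k + 2) = 0"
          by (simp add: dt_def mconst_diff mconst_mult algebra_simps)
        then have "(?a * Y k - ?b * Y (k + 1) + ?c * Y (k + 2))
            - (?a * (Y k - ?L k) - ?b * (Y (k + 1) - ?L (k + 1))) = ?c * (Y (k + 2) - ?L (k + 2))"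
          by (simp only: right_diff_distrib) (simp add: algebra_simps)
        finally have "?c * (Y (k + 2) - ?L (k + 2)) \<in> J" .
        then show ?thesis using J_mconst_mult dt_nonzero[of k "k + 1"] 3 i by (auto simp: cong_def)
      qed (use base in auto)
    qed
  qed
  then show ?thesis
    by (intro that[of u1 u2]) (auto simp: u1_def u2_def d_def intro!: mpolys_intros Y_in_mpolys)
qed

text \<open>Eliminates \<open>u1\<close> and \<open>u2\<close> by the three-term identity for the
  columns \<open>i\<close>, \<open>pb\<close> and \<open>qb\<close>.\<close>

lemma Y_cong:
  assumes "i \<in> M" shows "Y i \<sim> mconst (kap i) * Y pb + mconst (lam i) * Y qb"
proof -
  obtain u1 u2 where u: "\<And>i. i \<in> M \<Longrightarrow> Y i \<sim> mconst (fst (col i)) * u1 + mconst (snd (col i)) * u2"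
    using Y_in_span by metis
  let ?L = "\<lambda>i. mconst (fst (col i)) * u1 + mconst (snd (col i)) * u2"
  have eq: "mconst (dt pb qb) * ?L i - (mconst (dt i qb) * ?L pb + mconst (dt pb i) * ?L qb) = 0"
    by (simp add: dt_def mconst_diff mconst_mult algebra_simps)
  have "mconst (dt pb qb) * Y i - (mconst (dt i qb) * Y pb + mconst (dt pb i) * Y qb)
     \<sim> mconst (dt pb qb) * ?L i - (mconst (dt i qb) * ?L pb + mconst (dt pb i) * ?L qb)"
    by (intro cong_diff cong_add cong_mult_left u assms pb_in_M qb_in_M mpolys_mconst)
  then have *: "mconst (dt pb qb) * Y i - (mconst (dt i qb) * Y pb + mconst (dt pb i) * Y qb) \<in> J"
    unfolding eq by (simp add: cong_0_iff)
  have nz: "dt pb qb \<noteq> 0" by (rule dt_nonzero[OF pb_in_M qb_in_M pb_neq_qb])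
  then have "dt i qb = dt pb qb * kap i" "dt pb i = dt pb qb * lam i"
    by (simp_all add: kap_def lam_def)
  then have "mconst (dt pb qb) * Y i - (mconst (dt i qb) * Y pb + mconst (dt pb i) * Y qb)
    = mconst (dt pb qb) * (Y i - (mconst (kap i) * Y pb + mconst (lam i) * Y qb))"
    by (simp add: mconst_mult algebra_simps)
  with * show ?thesis using J_mconst_mult[OF nz] by (simp add: cong_def)
qed

section \<open>A curve of points of the variety\<close>

text \<open>Only the first variable of each block varies: it is a root chosen to give
  \<open>Y i\<close> the value \<open>kap i * c + lam i\<close>. In particular \<open>Y pb\<close>
  becomes \<open>c\<close> and \<open>Y qb\<close> becomes 1.\<close>

definition pt :: "'k \<Rightarrow> tvar \<Rightarrow> 'k" where
  "pt c v = (case v of T i j \<Rightarrow> if j = 1 then (SOME z. z ^ l i 1 = kap i * c + lam i) else 1 | S k \<Rightarrow> 1)"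

lemma pt_T1: "i \<in> blocks D \<Longrightarrow> pt c (T i 1) ^ l i 1 = kap i * c + lam i"
  using nth_root_exists[of "l i 1" "kap i * c + lam i"] l_pos[of i 1] n_pos[of i]
  by (auto simp: pt_def intro: someI_ex)

lemma meval_Y: assumes "i \<in> M" shows "meval (pt c) (Y i) = kap i * c + lam i"
proof (cases "i \<in> blocks D")
  case True
  have "meval (pt c) (Y i) = (\<Prod>j=1..n i. pt c (T i j) ^ l i j)"
    using True by (simp add: Y_def Tpow_def meval_prod meval_power)
  also have "\<dots> = pt c (T i 1) ^ l i 1 * (\<Prod>j\<in>{1..n i} - {1}. pt c (T i j) ^ l i j)"
    using n_pos[OF True] by (intro prod.remove) auto
  also have "(\<Prod>j\<in>{1..n i} - {1}. pt c (T i j) ^ l i j) = 1"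
    by (intro prod.neutral) (auto simp: pt_def)
  finally show ?thesis using pt_T1[OF True] by simp
next
  case False
  \<comment> \<open>The only index without a block is 0 in type 1, and there both sides are
    1.\<close>
  then have "i = qb" using assms by (auto simp: qb_def blocks_def iota_def split: coeffs.splits)
  then show ?thesis using False by (simp add: Y_def)
qed

text \<open>Three vectors in the plane are dependent with their minors as coefficients; this is the
  dependence in each coordinate.\<close>

lemma col_det:
  "dt j k * kap i - dt i k * kap j + dt i j * kap k = 0"
  "dt j k * lam i - dt i k * lam j + dt i j * lam k = 0"
  unfolding kap_def lam_def by (simp_all add: field_simps flip: add_divide_distrib diff_divide_distrib, simp_all add: dt_def algebra_simps)

text \<open>In type 1 the constant of a relation is the coefficient of the empty block \<open>0\<close>.\<close>

lemma relation_cases: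
  assumes "x \<in> relations D"
  obtains i j k a b c where "i \<in> M" "j \<in> M" "k \<in> M"
    "x = mconst a * Y i + mconst b * Y j + mconst c * Y k"
    "a * kap i + b * kap j + c * kap k = 0" "a * lam i + b * lam j + c * lam k = 0"
proof (cases "tr_A D")
  case (Type1 a)
  have eq: "kap i = (if i = 0 then 0 else 1)" "lam i = (if i = 0 then 1 else a 1 - a i)" for i
    using Type1 by (auto simp: kap_def lam_def dt_def col_def pb_def qb_def)
  obtain i where i: "1 \<le> i" "i + 1 \<le> r" and x: "x = Tpow D i - Tpow D (i + 1) - mconst (a (i + 1) - a i)"
    using assms Type1 by (auto simp: relations_def)
  show ?thesis
    by (rule that[of i "i + 1" 0 1 "-1" "- (a (i + 1) - a i)"])
      (use i Type1 x in \<open>auto simp: eq Y_def blocks_def iota_def mconst_uminus mconst_diff\<close>)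
next
  case (Type2 a)
  obtain i where i: "i + 2 \<le> r" and x: "x = det (vector [vector [Tpow D i, Tpow D (i + 1), Tpow D (i + 2)],
                        vector [mconst (a i $ 1), mconst (a (i + 1) $ 1), mconst (a (i + 2) $ 1)],
                        vector [mconst (a i $ 2), mconst (a (i + 1) $ 2), mconst (a (i + 2) $ 2)]]
                      :: (tvar, 'k) mpoly ^ 3 ^ 3)"
    using assms Type2 by (auto simp: relations_def)
  have "x = mconst (dt (i + 1) (i + 2)) * Y i + mconst (- dt i (i + 2)) * Y (i + 1)
      + mconst (dt i (i + 1)) * Y (i + 2)"
    using i Type2 unfolding x
    by (simp add: det_3 dt_def col_def Y_def blocks_def iota_def mconst_mult mconst_diff mconst_uminus algebra_simps)
  then show ?thesis
    by (rule that[of i "i + 1" "i + 2", rotated 3]) (use i col_det[of "i + 1" "i + 2" i] in auto)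
qed

text \<open>Each relation is a linear relation between block monomials that \<open>kap\<close> and
  \<open>lam\<close> satisfy as well, so it holds for the values
  \<open>kap i * c + lam i\<close>.\<close>

lemma meval_J: assumes "p \<in> J" shows "meval (pt c) p = 0"
proof -
  have "relations D \<subseteq> {p. meval (pt c) p = 0}"
  proof
    fix x assume "x \<in> relations D"
    then obtain i j k a b e where x: "i \<in> M" "j \<in> M" "k \<in> M"
      "x = mconst a * Y i + mconst b * Y j + mconst e * Y k"
      "a * kap i + b * kap j + e * kap k = 0" "a * lam i + b * lam j + e * lam k = 0"
      by (rule relation_cases)
    have "meval (pt c) x = (a * kap i + b * kap j + e * kap k) * c + (a * lam i + b * lam j + e * lam k)"
      using x(1-3) by (simp add: x(4) meval_add meval_mult meval_Y algebra_simps)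
    then show "x \<in> {p. meval (pt c) p = 0}" unfolding x(5,6) by simp
  qed
  then have "J \<subseteq> {p \<in> mpolys V. meval (pt c) p = 0}"
    using relations_subset by (intro trinomial_ideal_minimal) (auto simp: meval_add meval_mult mpolys_add mpolys_mult)
  then show ?thesis using assms by auto
qed

lemma finite_affine_zeros: "\<alpha> \<noteq> 0 \<or> \<beta> \<noteq> 0 \<Longrightarrow> finite {c::'k. \<alpha> * c + \<beta> = 0}"
  using poly_roots_finite[of "[:\<beta>, \<alpha>:]"] by (auto simp: algebra_simps)

lemma finite_pt_zeros: assumes "v \<in> V" shows "finite {c. pt c v = 0}"
proof (cases v)
  case (T i j)
  have "{c. pt c v = 0} \<subseteq> {c. kap i * c + lam i = 0}"
  proof
    fix c assume "c \<in> {c. pt c v = 0}"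
    then show "c \<in> {c. kap i * c + lam i = 0}"
      using pt_T1[of i c] l_pos[of i 1] n_pos[of i] assms T
      by (cases "j = 1") (auto simp: power_0_left, auto simp: pt_def)
  qed
  moreover have "finite \<dots>" using kap_lam_nonzero[of i] assms T blocks_subset by (intro finite_affine_zeros) auto
  ultimately show ?thesis by (rule finite_subset)
qed (simp add: pt_def)

lemma finite_mon_zeros: assumes "Poly_Mapping.keys t \<subseteq> V" shows "finite {c. mon_eval (pt c) t = 0}"
proof -
  have "{c. mon_eval (pt c) t = 0} \<subseteq> (\<Union>v\<in>Poly_Mapping.keys t. {c. pt c v = 0})"
    by (auto simp: mon_eval_def)
  moreover have "finite \<dots>" using assms finite_pt_zeros by auto
  ultimately show ?thesis by (rule finite_subset)
qed


section \<open>Block monomials and reduced monomials\<close>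

definition yb :: "nat \<Rightarrow> tvar \<Rightarrow>\<^sub>0 nat" where
  "yb i = (if i \<in> blocks D then \<Sum>j=1..n i. Poly_Mapping.single (T i j) (l i j) else 0)"

lemma Y_eq_single: "Y i = Poly_Mapping.single (yb i) 1"
  by (simp add: Y_def yb_def Tpow_def mvar_power prod_single)

lemma lookup_yb_T: "Poly_Mapping.lookup (yb i) (T k j) =
    (if k = i \<and> i \<in> blocks D \<and> 1 \<le> j \<and> j \<le> n i then l i j else 0)"
  by (auto simp: yb_def lookup_sum lookup_single when_def)

lemma lookup_yb_S [simp]: "Poly_Mapping.lookup (yb i) (S k) = 0"
  by (auto simp: yb_def lookup_sum lookup_single when_def)

lemma mpderiv_Y_0: "(\<And>j. T i j \<in> V \<Longrightarrow> v \<noteq> T i j) \<Longrightarrow> v \<in> V \<Longrightarrow> mpderiv v (Y i) = 0"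
  by (cases v) (auto simp: Y_eq_single mpderiv_single lookup_yb_T)

lemma keys_yb: "Poly_Mapping.keys (yb i) \<subseteq> V"
proof
  fix v assume "v \<in> Poly_Mapping.keys (yb i)"
  then show "v \<in> V" by (cases v) (auto simp: in_keys_iff lookup_yb_T split: if_splits)
qed

lemma deq_yb: assumes "i \<in> M" "k \<in> M" shows "deq (dg (yb i)) (dg (yb k))"
proof -
  \<comment> \<open>The difference of two unit vectors. If \<open>i\<close> or \<open>k\<close> is 0
    its entry lies outside the range of summation, and the sum \<open>su\<close> supplies the
    multiplier of block 0.\<close>
  define u where "u = (\<lambda>m::nat. of_bool (m = i) - of_bool (m = k) :: int)"
  have su: "(\<Sum>m=1..r. u m) = of_bool (i \<noteq> 0) - of_bool (k \<noteq> 0)"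
    using assms by (auto simp: u_def sum_subtractf of_bool_def)
  have "dg (yb i) v = dg (yb k) v + (\<Sum>m=1..r. P0 D m v * u m)" if v: "v \<in> V" for v
  proof (cases v)
    case (T b j)
    then have "b \<in> M" using v blocks_subset by auto
    show ?thesis using v T sum_P0_T[OF \<open>b \<in> M\<close>, of j u] su
      by (auto simp: dg_def lookup_yb_T u_def of_bool_def)
  qed (simp add: dg_def)
  then show ?thesis unfolding deq_def by blast
qed

text \<open>The common degree of all block monomials; with \<open>qb\<close> as representative it is
  the zero vector in type 1.\<close>

definition ud :: "tvar \<Rightarrow> int" where "ud = dg (yb qb)"

lemma hom_Y: "i \<in> M \<Longrightarrow> hom ud (Y i)"
  unfolding Y_eq_single ud_def by (intro hom_single keys_yb deq_yb qb_in_M)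

lemma beq_ud: "beq (\<lambda>v. e v + c * ud v) e"
  unfolding beq_def
  by (intro exI[of _ "\<lambda>i. if i = qb then c else 0"])
    (auto simp: ud_def dg_def lookup_yb_T split: tvar.splits)

text \<open>The assumption on \<open>qb\<close> singles out type 2, where the class of
  \<open>ud\<close> has infinite order: a multiple of \<open>ud\<close> has its only multiplier at
  block \<open>qb\<close>, whereas the multipliers of an element of the image sum to zero.\<close>

lemma deq_ud_multiples:
  assumes "deq (\<lambda>v. e v + a * ud v) (\<lambda>v. e v + b * ud v)" "qb \<in> blocks D"
  shows "a = b"
proof -
  from assms(1) obtain u where u: "\<And>v. v \<in> V \<Longrightarrow> e v + a * ud v = e v + b * ud v + (\<Sum>i=1..r. P0 D i v * u i)"
    unfolding deq_def by blast
  have *: "(a - b) * ud (T k 1) = int (l k 1) * (if k = 0 then - (\<Sum>i=1..r. u i) else u k)" if "k \<in> blocks D" for k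
  proof -
    have "k \<in> M" using that blocks_subset by auto
    then show ?thesis using u[of "T k 1"] sum_P0_T[of k 1 u] n_pos[OF that] that
      by (simp add: algebra_simps)
  qed
  have ud1: "ud (T k 1) = (if k = qb then int (l k 1) else 0)" if "k \<in> blocks D" for k
    using n_pos[OF that] that by (auto simp: ud_def dg_def lookup_yb_T Suc_le_eq)
  have l1: "l k 1 > 0" if "k \<in> blocks D" for k using l_pos[OF that, of 1] n_pos[OF that] by simp
  have pos: "u k = (if k = qb then a - b else 0)" if "k \<in> blocks D" "k \<noteq> 0" for k
    using *[OF that(1)] ud1[OF that(1)] l1[OF that(1)] that(2) by (auto split: if_splits)
  have "0 \<in> blocks D" using assms(2) by (auto simp: qb_def blocks_def iota_def block_q_def split: coeffs.splits if_splits)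
  then have z: "(if 0 = qb then a - b else 0) = - (\<Sum>i=1..r. u i)"
  proof (cases "qb = 0")
    case True
    then have "int (l 0 1) * (a - b) = int (l 0 1) * - (\<Sum>i=1..r. u i)"
      using *[of 0] ud1[of 0] \<open>0 \<in> blocks D\<close> by (simp add: mult.commute)
    then show ?thesis using l1[OF \<open>0 \<in> blocks D\<close>] True by (simp only: mult_cancel_left) auto
  next
    case False
    then show ?thesis using *[of 0] ud1[of 0] l1[of 0] \<open>0 \<in> blocks D\<close> by auto
  qed
  have "(\<Sum>i=1..r. u i) = (\<Sum>i=1..r. if i = qb then a - b else 0)"
    by (intro sum.cong) (auto simp: pos in_blocks)
  also have "\<dots> = (if qb = 0 then 0 else a - b)" using qb_in_M by auto
  finally show ?thesis using z by (auto split: if_splits)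
qed

text \<open>Divisibility by a block monomial is excluded: \<open>t\<close> is irreducible under
  rewriting a block monomial as a linear form in \<open>Y pb\<close> and
  \<open>Y qb\<close>.\<close>

definition red :: "(tvar \<Rightarrow>\<^sub>0 nat) \<Rightarrow> bool" where
  "red t \<longleftrightarrow> Poly_Mapping.keys t \<subseteq> V \<and>
     (\<forall>i\<in>blocks D. \<exists>j. 1 \<le> j \<and> j \<le> n i \<and> Poly_Mapping.lookup t (T i j) < l i j)"

lemma red_keys: "red t \<Longrightarrow> Poly_Mapping.keys t \<subseteq> V"
  by (simp add: red_def)

text \<open>A positive multiplier \<open>w i\<close> would make \<open>s\<close> divisible by
  \<open>Y i\<close>, a negative one \<open>t\<close>.\<close>

lemma red_unique:
  assumes "red s" "red t" "beq (dg s) (dg t)" shows "s = t"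
proof (rule poly_mapping_eqI)
  fix v
  from assms(3) obtain w where
    w: "\<And>v. v \<in> V \<Longrightarrow> dg s v = dg t v + (case v of T i j \<Rightarrow> int (l i j) * w i | S k \<Rightarrow> 0)"
    unfolding beq_def by blast
  have w0: "w i = 0" if i: "i \<in> blocks D" for i
  proof -
    obtain j k where j: "1 \<le> j" "j \<le> n i" "Poly_Mapping.lookup s (T i j) < l i j"
      and k: "1 \<le> k" "k \<le> n i" "Poly_Mapping.lookup t (T i k) < l i k"
      using assms i unfolding red_def by blast
    have "dg s (T i j) = dg t (T i j) + int (l i j) * w i" "dg s (T i k) = dg t (T i k) + int (l i k) * w i"
      using w[of "T i j"] w[of "T i k"] i j k by auto
    moreover have "dg s (T i j) < int (l i j)" "dg t (T i k) < int (l i k)" "dg t (T i j) \<ge> 0" "dg s (T i k) \<ge> 0"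
      using j k by (auto simp: dg_def)
    ultimately have "int (l i j) * w i < int (l i j) * 1" "int (l i k) * (-1) < int (l i k) * w i"
      by linarith+
    then show ?thesis by (simp only: mult_less_cancel_left) auto
  qed
  show "Poly_Mapping.lookup s v = Poly_Mapping.lookup t v"
  proof (cases "v \<in> V")
    case True
    then show ?thesis using w[of v] w0 by (cases v) (auto simp: dg_def)
  next
    case False
    then have "v \<notin> Poly_Mapping.keys s" "v \<notin> Poly_Mapping.keys t" using assms red_keys by blast+
    then show ?thesis by (simp add: in_keys_iff)
  qed
qed

section \<open>Binary forms in the block monomials\<close>

text \<open>Storing the form as a univariate polynomial gives access to roots and degrees; along the
  curve of points, where \<open>Y qb\<close> is 1, the form takes the values of
  \<open>F\<close>.\<close>

definition bf :: "nat \<Rightarrow> 'k poly \<Rightarrow> (tvar, 'k) mpoly" where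
  "bf N F = subst_binary_form N (coeff F) (Y pb) (Y qb)"

lemma bf_altdef: "bf N F = (\<Sum>e\<le>N. mconst (coeff F e) * Y pb ^ e * Y qb ^ (N - e))"
  by (simp add: bf_def subst_binary_form_def)

lemma bf_add: "bf N (F + G) = bf N F + bf N G"
  by (simp add: bf_altdef mconst_add algebra_simps sum.distrib)

lemma bf_smult: "bf N (smult c F) = mconst c * bf N F"
  by (simp add: bf_altdef mconst_mult algebra_simps sum_distrib_left)

lemma bf_0 [simp]: "bf N 0 = 0"
  by (simp add: bf_altdef)

lemma bf_Suc: "degree F \<le> N \<Longrightarrow> bf (Suc N) F = Y qb * bf N F"
  by (auto simp: bf_altdef sum_distrib_left Suc_diff_le coeff_eq_0 algebra_simps intro!: sum.cong)

lemma bf_pCons: "bf (Suc N) (pCons 0 F) = Y pb * bf N F"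
  unfolding bf_altdef
  by (subst sum.atMost_Suc_shift) (simp add: sum_distrib_left algebra_simps)

lemma bf_const_0: "bf 0 F = mconst (coeff F 0)"
  by (simp add: bf_altdef)

lemma bf_linear_mult:
  assumes "degree F \<le> N"
  shows "bf (Suc N) ([:b, a:] * F) = (mconst a * Y pb + mconst b * Y qb) * bf N F"
proof -
  have "[:b, a:] * F = smult b F + pCons 0 (smult a F)" by (simp add: algebra_simps)
  then show ?thesis using assms by (simp add: bf_add bf_smult bf_Suc bf_pCons algebra_simps)
qed

lemma meval_bf: "degree F \<le> N \<Longrightarrow> meval (pt c) (bf N F) = poly F c"
proof -
  assume "degree F \<le> N"
  then have "poly F c = (\<Sum>i\<le>N. coeff F i * c ^ i)"
    unfolding poly_altdef by (intro sum.mono_neutral_left) (auto simp: coeff_eq_0)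
  then show ?thesis
    using pb_in_M qb_in_M by (simp add: bf_altdef meval_sum meval_mult meval_power meval_Y)
qed

lemma hom_power: "hom e p \<Longrightarrow> hom (\<lambda>v. int k * e v) (p ^ k)"
proof (induction k)
  case (Suc k)
  from hom_mult[OF Suc.prems Suc.IH[OF Suc.prems]] show ?case by (simp add: algebra_simps)
qed (simp add: hom_1)

lemma hom_bf: "hom (\<lambda>v. int N * ud v) (bf N F)"
  unfolding bf_altdef
proof (rule hom_sum)
  fix e assume "e \<in> {..N}"
  then have eq: "(\<lambda>v. (0 + int e * ud v) + int (N - e) * ud v) = (\<lambda>v. int N * ud v)"
    by (auto simp: of_nat_diff algebra_simps)
  have "hom (\<lambda>v. (0 + int e * ud v) + int (N - e) * ud v) (mconst (coeff F e) * Y pb ^ e * Y qb ^ (N - e))"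
    by (intro hom_mult hom_power hom_Y hom_mconst pb_in_M qb_in_M)
  then show "hom (\<lambda>v. int N * ud v) (mconst (coeff F e) * Y pb ^ e * Y qb ^ (N - e))"
    unfolding eq .
qed

lemma hom_single_bf:
  "Poly_Mapping.keys t \<subseteq> V \<Longrightarrow> hom (\<lambda>v. dg t v + int N * ud v) (Poly_Mapping.single t 1 * bf N F)"
  by (intro hom_mult hom_bf hom_single deq_refl)

text \<open>\<open>F\<close> is the form dehomogenized at \<open>Y qb = 1\<close>, so that a drop of its degree means a factor \<open>Y qb\<close>.\<close>

lemma bf_factor:
  assumes "degree F \<le> Suc N" "F \<noteq> 0"
  obtains a b G where "(a, b) \<noteq> (0, 0)" "degree G \<le> N" "G \<noteq> 0" "F = [:b, a:] * G"
    "bf (Suc N) F = (mconst a * Y pb + mconst b * Y qb) * bf N G"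
proof (cases "degree F \<le> N")
  case True
  then show ?thesis using that[of 0 1 F] assms by (simp add: bf_Suc)
next
  case False
  then obtain c where "poly F c = 0" using alg_closed_imp_poly_has_root[of F] by auto
  then obtain G where G: "F = [:-c, 1:] * G" by (metis poly_eq_0_iff_dvd dvdE)
  then have "G \<noteq> 0" using assms by auto
  then have "degree F = Suc (degree G)" unfolding G by (subst degree_mult_eq) auto
  then have "degree G \<le> N" using assms by simp
  then show ?thesis using that[of 1 "-c" G] G \<open>G \<noteq> 0\<close> bf_linear_mult[of G N "-c" 1] by simp
qed

section \<open>Normal forms of homogeneous elements\<close>

text \<open>The assumption on \<open>qb\<close> means type 1, where \<open>Y qb\<close> is 1 and
  homogenization has no effect.\<close>

lemma bf_raise: assumes "qb \<notin> blocks D" "degree F \<le> N" "N \<le> N'" shows "bf N' F = bf N F"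
  using assms(3)
proof (induction N' rule: dec_induct)
  case (step k)
  then show ?case using bf_Suc[of F k] assms by (simp add: Y_def)
qed simp

text \<open>The ideal is a separate alternative so that \<open>F\<close> is nonzero otherwise and
  has finitely many roots.\<close>

definition nf :: "(tvar \<Rightarrow> int) \<Rightarrow> (tvar, 'k) mpoly \<Rightarrow> bool" where
  "nf e p \<longleftrightarrow> p \<in> J \<or> (\<exists>t N F. red t \<and> F \<noteq> 0 \<and> degree F \<le> N \<and>
     p \<sim> Poly_Mapping.single t 1 * bf N F \<and> deq e (\<lambda>v. dg t v + int N * ud v))"

text \<open>In type 1 the exponent \<open>N\<close> is not determined by the degree, but may be enlarged.\<close>

lemma common_normal_form:
  assumes "red s" "red t" "deq e (\<lambda>v. dg s v + int N * ud v)" "deq e (\<lambda>v. dg t v + int N' * ud v)"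
    "degree F \<le> N" "degree G \<le> N'"
  obtains N'' where "s = t" "deq e (\<lambda>v. dg s v + int N'' * ud v)"
    "degree F \<le> N''" "degree G \<le> N''" "bf N F = bf N'' F" "bf N' G = bf N'' G"
proof -
  have d: "deq (\<lambda>v. dg s v + int N * ud v) (\<lambda>v. dg t v + int N' * ud v)"
    using assms deq_sym deq_trans by blast
  \<comment> \<open>\<open>beq\<close> ignores multiples of \<open>ud\<close>, so the unknown
    exponents \<open>N\<close> and \<open>N'\<close> drop out of the comparison.\<close>
  have "beq (dg s) (dg t)"
    using beq_trans[OF beq_trans[OF beq_sym[OF beq_ud] deq_imp_beq[OF d]] beq_ud] .
  then have st: "s = t" using red_unique assms by blast
  show ?thesis
  proof (cases "qb \<in> blocks D")
    case True
    then have NN: "N = N'" using deq_ud_multiples[of "dg s" "int N" "int N'"] d st by simp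
    show ?thesis
    proof (rule that[of N])
      show "degree G \<le> N" "bf N' G = bf N G" using assms(6) NN by auto
    qed (rule st assms(3) assms(5) refl)+
  next
    case False
    show ?thesis
    proof (cases "N \<le> N'")
      case True
      show ?thesis
      proof (rule that[of N'])
        show "degree F \<le> N'" "bf N F = bf N' F" using bf_raise[OF False assms(5) True] assms(5) True by simp_all
        show "deq e (\<lambda>v. dg s v + int N' * ud v)" using assms(4) unfolding st .
      qed (rule st assms(6) refl)+
    next
      case F: False
      show ?thesis
      proof (rule that[of N])
        have "N' \<le> N" using F by simp
        then show "degree G \<le> N" "bf N' G = bf N G" using bf_raise[OF False assms(6), of N] assms(6) by simp_all
      qed (rule st assms(3) assms(5) refl)+
    qed
  qed
qed

lemma nf_add: assumes "nf e p" "nf e q" shows "nf e (p + q)"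
proof -
  have J: "nf e (p + q)" if "p \<in> J" and q: "nf e q" for p q
  proof -
    have eq: "p + q \<sim> q" using that by (simp add: cong_def)
    show ?thesis
    proof (cases "q \<in> J")
      case True
      then show ?thesis using that by (simp add: nf_def J_add)
    next
      case False
      then obtain t N F where "red t" "F \<noteq> 0" "degree F \<le> N"
        "q \<sim> Poly_Mapping.single t 1 * bf N F" "deq e (\<lambda>v. dg t v + int N * ud v)"
        using q unfolding nf_def by blast
      then show ?thesis using cong_trans[OF eq] unfolding nf_def by blast
    qed
  qed
  show ?thesis
  proof (cases "p \<in> J \<or> q \<in> J")
    case True
    then show ?thesis using J[of p q] J[of q p] assms by (auto simp: add.commute)
  next
    case False
    then obtain s N F t N' G where s: "red s" "degree F \<le> N" "p \<sim> Poly_Mapping.single s 1 * bf N F"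
        "deq e (\<lambda>v. dg s v + int N * ud v)"
      and t: "red t" "degree G \<le> N'" "q \<sim> Poly_Mapping.single t 1 * bf N' G"
        "deq e (\<lambda>v. dg t v + int N' * ud v)"
      using assms unfolding nf_def by blast
    obtain N'' where N: "s = t" "deq e (\<lambda>v. dg s v + int N'' * ud v)"
      "degree F \<le> N''" "degree G \<le> N''" "bf N F = bf N'' F" "bf N' G = bf N'' G"
      by (rule common_normal_form[OF s(1) t(1) s(4) t(4) s(2) t(2)])
    have eq: "p + q \<sim> Poly_Mapping.single s 1 * bf N'' (F + G)"
      using cong_add[OF s(3) t(3)] N by (simp add: bf_add algebra_simps)
    show ?thesis
    proof (cases "F + G = 0")
      case True
      then show ?thesis using eq by (simp add: cong_0_iff nf_def)
    next
      case False
      moreover have "degree (F + G) \<le> N''" using degree_add_le N by blast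
      ultimately show ?thesis unfolding nf_def
        by (intro disjI2 exI[of _ s] exI[of _ N''] exI[of _ "F + G"] conjI s(1) eq N(2))
    qed
  qed
qed

text \<open>As long as some \<open>Y i\<close> divides \<open>t\<close>, it is traded for its
  nonzero linear form. The total degree of the monomial drops, while \<open>N\<close> grows by
  one.\<close>

lemma monomial_normal_form:
  assumes "Poly_Mapping.keys t \<subseteq> V"
  shows "\<exists>s N F. red s \<and> F \<noteq> 0 \<and> degree F \<le> N \<and>
     (Poly_Mapping.single t 1 \<sim> Poly_Mapping.single s 1 * bf N F) \<and> deq (dg t) (\<lambda>v. dg s v + int N * ud v)"
  using assms
proof (induction "\<Sum>v\<in>V. Poly_Mapping.lookup t v" arbitrary: t rule: less_induct)
  case less
  show ?case
  proof (cases "red t")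
    case True
    then show ?thesis
      by (intro exI[of _ t] exI[of _ "0::nat"] exI[of _ "1::'k poly"]) (auto simp: bf_const_0)
  next
    case False
    then obtain i where i: "i \<in> blocks D" and ge: "\<And>j. 1 \<le> j \<Longrightarrow> j \<le> n i \<Longrightarrow> l i j \<le> Poly_Mapping.lookup t (T i j)"
      using less.prems unfolding red_def by (meson not_le)
    define t' where "t' = t - yb i"
    have t: "t = t' + yb i"
    proof (rule poly_mapping_eqI)
      fix v show "Poly_Mapping.lookup t v = Poly_Mapping.lookup (t' + yb i) v"
        using ge by (cases v) (auto simp: t'_def lookup_add lookup_minus lookup_yb_T)
    qed
    have keys: "Poly_Mapping.keys t' \<subseteq> V"
      using less.prems by (auto simp: t'_def in_keys_iff lookup_minus subset_iff)
    have "Poly_Mapping.lookup t' (T i 1) < Poly_Mapping.lookup t (T i 1)"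
      using l_pos[OF i, of 1] n_pos[OF i] i by (simp add: t lookup_add lookup_yb_T)
    then have "(\<Sum>v\<in>V. Poly_Mapping.lookup t' v) < (\<Sum>v\<in>V. Poly_Mapping.lookup t v)"
      using i n_pos[OF i] finite_tvars
      by (intro sum_strict_mono_ex1) (auto simp: t lookup_add intro!: bexI[of _ "T i 1"])
    from less.hyps[OF this keys] obtain s N F where s: "red s" "F \<noteq> 0" "degree F \<le> N"
      "Poly_Mapping.single t' 1 \<sim> Poly_Mapping.single s 1 * bf N F" "deq (dg t') (\<lambda>v. dg s v + int N * ud v)"
      by blast
    have iM: "i \<in> M" using i blocks_subset by auto
    let ?L = "mconst (kap i) * Y pb + mconst (lam i) * Y qb"
    let ?G = "[:lam i, kap i:] * F"
    have "Poly_Mapping.single t 1 = Poly_Mapping.single t' 1 * Y i"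
      by (simp add: t Y_eq_single mult_single)
    also have "\<dots> \<sim> Poly_Mapping.single s 1 * bf N F * ?L"
      by (intro cong_mult s Y_cong iM Y_in_mpolys mpolys_mult hom_mpolys[OF hom_bf] mpolys_single red_keys)
    also have "\<dots> = Poly_Mapping.single s 1 * bf (Suc N) ?G"
      unfolding bf_linear_mult[OF s(3)] by (simp only: mult_ac)
    finally have 1: "Poly_Mapping.single t 1 \<sim> Poly_Mapping.single s 1 * bf (Suc N) ?G" .
    have G: "?G \<noteq> 0" using kap_lam_nonzero[OF iM] s(2) by (auto simp del: mult_pCons_left)
    have dG: "degree ?G \<le> Suc N"
      using s(3) degree_mult_le[of "[:lam i, kap i:]" F] by (auto simp del: mult_pCons_left split: if_splits)
    have "deq (\<lambda>v. dg t' v + dg (yb i) v) (\<lambda>v. (dg s v + int N * ud v) + ud v)"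
      unfolding ud_def using s(5) deq_yb[OF iM qb_in_M] by (intro deq_add) (auto simp: ud_def)
    then have "deq (dg t) (\<lambda>v. dg s v + int (Suc N) * ud v)"
      by (simp add: t dg_add algebra_simps)
    then show ?thesis using s(1) 1 G dG by blast
  qed
qed

lemma hom_imp_nf: assumes "hom e p" shows "nf e p"
proof -
  have single: "nf e (Poly_Mapping.single t c)" if t: "t \<in> Poly_Mapping.keys p" and "c \<noteq> 0" for t c
  proof -
    have tV: "Poly_Mapping.keys t \<subseteq> V" "deq e (dg t)"
      using assms t deq_sym[of "dg t" e] by (auto simp: hom_def mpolys_def)
    from monomial_normal_form[OF tV(1)] obtain s N F where s: "red s" "F \<noteq> 0" "degree F \<le> N"
      "Poly_Mapping.single t 1 \<sim> Poly_Mapping.single s 1 * bf N F" "deq (dg t) (\<lambda>v. dg s v + int N * ud v)"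
      by (elim exE conjE)
    have "mconst c * Poly_Mapping.single t 1 \<sim> mconst c * (Poly_Mapping.single s 1 * bf N F)"
      using s by (intro cong_mult_left) auto
    then have "Poly_Mapping.single t c \<sim> Poly_Mapping.single s 1 * bf N (smult c F)"
      by (simp add: mconst_def mult_single bf_smult algebra_simps)
    moreover have "smult c F \<noteq> 0" "degree (smult c F) \<le> N" using s \<open>c \<noteq> 0\<close> by auto
    ultimately show ?thesis unfolding nf_def using s(1) deq_trans[OF tV(2) s(5)] by blast
  qed
  have "nf e (\<Sum>t\<in>A. Poly_Mapping.single t (Poly_Mapping.lookup p t))" if "finite A" "A \<subseteq> Poly_Mapping.keys p" for A
    using that
  proof (induction A)
    case empty
    then show ?case by (simp add: nf_def)
  next
    case (insert t A)
    then show ?case by (auto simp: in_keys_iff intro!: nf_add single)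
  qed
  from this[of "Poly_Mapping.keys p"] show ?thesis by (simp add: mpoly_sum_singles)
qed

text \<open>Along the curve \<open>p\<close> becomes a monomial value times \<open>poly F c\<close>,
  and both factors have finitely many zeros.\<close>

lemma finite_zeros:
  assumes "hom e p" "p \<notin> J" shows "finite {c. meval (pt c) p = 0}"
proof -
  obtain t N F where t: "red t" "F \<noteq> 0" "degree F \<le> N" "p \<sim> Poly_Mapping.single t 1 * bf N F"
    using hom_imp_nf[OF assms(1)] assms(2) unfolding nf_def by blast
  have "meval (pt c) p = mon_eval (pt c) t * poly F c" for c
    using meval_J[of "p - Poly_Mapping.single t 1 * bf N F" c] t
    by (simp add: cong_def meval_diff meval_mult meval_single meval_bf)
  then have "{c. meval (pt c) p = 0} = {c. mon_eval (pt c) t = 0} \<union> {c. poly F c = 0}" by auto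
  then show ?thesis using finite_mon_zeros[OF red_keys[OF t(1)]] poly_roots_finite[OF t(2)] by simp
qed

text \<open>A product in the ideal vanishes on the whole curve, and the infinite field is not a
  union of two finite sets.\<close>

lemma hom_domain:
  assumes "hom e p" "hom f q" "p * q \<in> J" shows "p \<in> J \<or> q \<in> J"
proof (rule ccontr)
  assume "\<not> (p \<in> J \<or> q \<in> J)"
  then have "finite ({c. meval (pt c) p = 0} \<union> {c. meval (pt c) q = 0})"
    using finite_zeros assms by blast
  moreover have "meval (pt c) p * meval (pt c) q = 0" for c
    using meval_J[OF assms(3), of c] by (simp add: meval_mult)
  then have "{c. meval (pt c) p = 0} \<union> {c. meval (pt c) q = 0} = UNIV" by auto
  ultimately show False using infinite_UNIV_char_0[where 'a = 'k] by simp
qed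

lemma one_notin_J: "1 \<notin> J"
  using meval_J[of 1 0] by auto

lemma single_notin_J: assumes "Poly_Mapping.keys t \<subseteq> V" shows "Poly_Mapping.single t 1 \<notin> J"
proof
  assume "Poly_Mapping.single t 1 \<in> J"
  then have "mon_eval (pt c) t = 0" for c using meval_J[of "Poly_Mapping.single t 1" c] by (simp add: meval_single)
  then have "finite (UNIV :: 'k set)" using finite_mon_zeros[OF assms] by simp
  then show False using infinite_UNIV_char_0[where 'a = 'k] by simp
qed

lemma bf_notin_J: assumes "F \<noteq> 0" "degree F \<le> N" shows "bf N F \<notin> J"
proof
  assume "bf N F \<in> J"
  then have "poly F c = 0" for c using meval_J[of "bf N F" c] assms by (simp add: meval_bf)
  then have "F = 0" using poly_all_0_iff_0 by blast
  then show False using assms by simp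
qed

end

section \<open>Homogeneous locally nilpotent derivations\<close>

text \<open>\<open>f\<close> gives homogeneous representatives of the values on the variables, and
  \<open>d\<close> represents the degree of the derivation by an integer vector that may have
  negative entries.\<close>

locale trinomial_lnd = trinomial D for D :: "'k::{alg_closed_field, field_char_0} trinomial_data" +
  fixes f :: "tvar \<Rightarrow> (tvar, 'k) mpoly" and d :: "tvar \<Rightarrow> int"
  assumes f_hom: "v \<in> V \<Longrightarrow> hom (\<lambda>w. unit v w + d w) (f v)"
    and der_J: "p \<in> J \<Longrightarrow> der V f p \<in> J"
    and der_nilpotent: "p \<in> mpolys V \<Longrightarrow> \<exists>n. (der V f ^^ n) p \<in> J"
begin

abbreviation "E \<equiv> der V f"

lemma hom_E: assumes "hom e p" shows "hom (\<lambda>w. e w + d w) (E p)"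
  unfolding der_def
proof (rule hom_sum)
  fix v assume "v \<in> V"
  from hom_mult[OF f_hom[OF this] hom_mpderiv[OF assms, of v]]
  show "hom (\<lambda>w. e w + d w) (f v * mpderiv v p)" by (simp add: algebra_simps)
qed

lemma E_mvar: "v \<in> V \<Longrightarrow> E (mvar v) = f v"
  by (simp add: der_mvar finite_tvars)

sublocale lnd: graded_lnd "mpolys V" J "{p. \<exists>e. hom e p}" E
proof
  fix n :: nat and x assume "of_nat n * x \<in> J" "n > 0"
  then show "x \<in> J" using J_mconst_mult[of "of_nat n" x] by (simp add: mconst_of_nat)
next
  fix x assume "x \<in> {p. \<exists>e. hom e p}"
  then show "\<exists>n. (E ^^ n) x \<in> J" using der_nilpotent hom_mpolys by blast
next
  fix n :: nat show "of_nat n \<in> mpolys V" using mpolys_mconst[of "of_nat n"] by (simp add: mconst_of_nat)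
qed (auto simp: one_notin_J der_add der_mult intro: J_add J_mult J_uminus hom_mpolys hom_1 hom_mult hom_E
      mpolys_mult der_J dest: hom_domain)

abbreviation "nu \<equiv> lnd.nu"

lemma E_cong: "x \<sim> y \<Longrightarrow> E x \<sim> E y"
  using der_J[of "x - y"] by (simp add: cong_def der_diff)

lemma E_mconst_mult: "E (mconst c * x) = mconst c * E x"
  by (simp add: der_mult)

lemma mvar_notin_J: "v \<in> V \<Longrightarrow> mvar v \<notin> J"
  unfolding mvar_def by (intro single_notin_J) auto

lemma in_homs: "hom e p \<Longrightarrow> p \<in> {p. \<exists>e. hom e p}" by blast

text \<open>The last property is the essential one: a variable occurring in the monomial of its own
  image would divide that image, which forces the image into the ideal.\<close>

lemma f_normal_form:
  assumes "v \<in> V" "f v \<notin> J"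
  obtains t N F where "red t" "F \<noteq> 0" "degree F \<le> N" "f v \<sim> Poly_Mapping.single t 1 * bf N F"
    "deq (\<lambda>w. unit v w + d w) (\<lambda>w. dg t w + int N * ud w)" "Poly_Mapping.lookup t v = 0"
proof -
  from hom_imp_nf[OF f_hom[OF assms(1)]] assms(2)
  obtain t N F where t: "red t" "F \<noteq> 0" "degree F \<le> N" "f v \<sim> Poly_Mapping.single t 1 * bf N F"
    "deq (\<lambda>w. unit v w + d w) (\<lambda>w. dg t w + int N * ud w)"
    unfolding nf_def by (elim disjE exE conjE) auto
  have "Poly_Mapping.lookup t v = 0"
  proof (rule ccontr)
    assume pos: "Poly_Mapping.lookup t v \<noteq> 0"
    define t' where "t' = t - Poly_Mapping.single v 1"
    have tt: "t = Poly_Mapping.single v 1 + t'"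
      using pos by (intro poly_mapping_eqI) (auto simp: t'_def lookup_add lookup_minus lookup_single when_def)
    have keys: "Poly_Mapping.keys t' \<subseteq> V"
      using red_keys[OF t(1)] by (auto simp: t'_def in_keys_iff lookup_minus subset_iff)
    have "Poly_Mapping.single t 1 * bf N F = mvar v * (Poly_Mapping.single t' 1 * bf N F)"
      by (simp add: tt mvar_def mult_single flip: mult.assoc)
    then have "E (mvar v) - mvar v * (Poly_Mapping.single t' 1 * bf N F) \<in> J"
      using t(4) assms(1) by (simp add: E_mvar cong_def)
    then have "E (mvar v) \<in> J"
      by (rule lnd.E_in_J_of_dvd[OF in_homs[OF hom_mvar[OF assms(1)]] in_homs[OF hom_single_bf[OF keys]]])
    then show False using assms by (simp add: E_mvar)
  qed
  then show ?thesis using that t by blast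
qed

text \<open>The columns of \<open>P0\<close> belonging to the \<open>S k\<close> are zero, so these
  exponents are integer invariants of a degree.\<close>

lemma deq_S: assumes "deq e e'" "S k \<in> V" shows "e (S k) = e' (S k)"
proof -
  obtain u where "\<forall>v\<in>V. e v = e' v + (\<Sum>i=1..r. P0 D i v * u i)" using assms(1) unfolding deq_def by blast
  then show ?thesis using assms(2) by auto
qed

lemma ud_S [simp]: "ud (S k) = 0"
  by (simp add: ud_def dg_def)

lemma d_S_of_f_S: assumes "S k \<in> V" "f (S k) \<notin> J" shows "d (S k) = -1"
proof -
  obtain t N F where "deq (\<lambda>w. unit (S k) w + d w) (\<lambda>w. dg t w + int N * ud w)" "Poly_Mapping.lookup t (S k) = 0"
    using f_normal_form[OF assms] by metis
  from deq_S[OF this(1) assms(1)] this(2) show ?thesis by (simp add: unit_def dg_def)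
qed

text \<open>Since \<open>d (S k)\<close> is -1, a nonzero value on any other variable would contain
  \<open>S k\<close> to a negative power.\<close>

lemma only_one_S:
  assumes "S k \<in> V" "f (S k) \<notin> J" "v \<in> V" "f v \<notin> J" shows "v = S k"
proof (rule ccontr)
  assume ne: "v \<noteq> S k"
  obtain t N F where "deq (\<lambda>w. unit v w + d w) (\<lambda>w. dg t w + int N * ud w)"
    using f_normal_form[OF assms(3,4)] by metis
  from deq_S[OF this assms(1)] have "d (S k) \<ge> 0" using ne by (simp add: unit_def dg_def)
  then show False using d_S_of_f_S[OF assms(1,2)] by simp
qed

lemma deg_S_case:
  assumes "S k \<in> V" "f (S k) \<notin> J"
  obtains t N F where "Poly_Mapping.keys t \<subseteq> V" "degree F \<le> N" "f (S k) \<sim> Poly_Mapping.single t 1 * bf N F"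
    "Poly_Mapping.lookup t (S k) = 0" "\<And>v. v \<in> V \<Longrightarrow> v \<noteq> S k \<Longrightarrow> f v \<in> J"
  using f_normal_form[OF assms] only_one_S[OF assms] red_keys by metis

section \<open>The values on the block variables\<close>

text \<open>For a variable of the block, the exponent vector of \<open>Y i / T i j\<close>.\<close>

definition yq :: "nat \<Rightarrow> nat \<Rightarrow> tvar \<Rightarrow>\<^sub>0 nat" where
  "yq i j = yb i - Poly_Mapping.single (T i j) 1"

lemma lookup_yq_T: "Poly_Mapping.lookup (yq i j) (T k j') =
    (if k = i \<and> i \<in> blocks D \<and> 1 \<le> j' \<and> j' \<le> n i then l i j' - (if j' = j then 1 else 0) else 0)"
  by (auto simp: yq_def lookup_minus lookup_yb_T lookup_single when_def)

lemma lookup_yq_S [simp]: "Poly_Mapping.lookup (yq i j) (S k) = 0"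
  by (simp add: yq_def lookup_minus)

lemma keys_yq: "Poly_Mapping.keys (yq i j) \<subseteq> V"
  using keys_yb[of i] by (auto simp: yq_def in_keys_iff lookup_minus subset_iff)

lemma yb_eq: assumes "T i j \<in> V" shows "yb i = Poly_Mapping.single (T i j) 1 + yq i j"
proof (rule poly_mapping_eqI)
  fix v
  show "Poly_Mapping.lookup (yb i) v = Poly_Mapping.lookup (Poly_Mapping.single (T i j) 1 + yq i j) v"
    using assms l_pos[of i j]
    by (cases v) (auto simp: lookup_add lookup_single when_def lookup_yb_T lookup_yq_T)
qed

lemma Y_eq_mvar_mult: "T i j \<in> V \<Longrightarrow> Y i = mvar (T i j) * Poly_Mapping.single (yq i j) 1"
  by (subst Y_eq_single, subst yb_eq[of i j]) (simp_all add: mvar_def mult_single)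

lemma mpderiv_Y: "T i j \<in> V \<Longrightarrow> mpderiv (T i j) (Y i) = mconst (of_nat (l i j)) * Poly_Mapping.single (yq i j) 1"
  by (simp add: Y_eq_single mpderiv_single lookup_yb_T mconst_def mult_single yq_def del: single_of_nat)

lemma hom_yq: "hom (dg (yq i j)) (Poly_Mapping.single (yq i j) 1)"
  by (intro hom_single keys_yq deq_refl)

lemma E_Y_cong:
  assumes "T i c \<in> V" "\<And>j. T i j \<in> V \<Longrightarrow> j \<noteq> c \<Longrightarrow> f (T i j) \<in> J"
  shows "E (Y i) \<sim> mconst (of_nat (l i c)) * Poly_Mapping.single (yq i c) 1 * f (T i c)"
proof -
  have "E (Y i) = f (T i c) * mpderiv (T i c) (Y i) + (\<Sum>v\<in>V - {T i c}. f v * mpderiv v (Y i))"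
    unfolding der_def by (intro sum.remove finite_tvars assms)
  moreover have "(\<Sum>v\<in>V - {T i c}. f v * mpderiv v (Y i)) \<in> J"
  proof (rule J_sum)
    fix v assume v: "v \<in> V - {T i c}"
    show "f v * mpderiv v (Y i) \<in> J"
    proof (cases "\<exists>j. v = T i j")
      case True
      then obtain j where j: "v = T i j" by blast
      then have "f v \<in> J" using v assms(2)[of j] by auto
      then show ?thesis by (intro J_mult_right mpolys_mpderiv Y_in_mpolys)
    next
      case False
      then show ?thesis using mpderiv_Y_0[of i v] v by auto
    qed
  qed
  ultimately show ?thesis using assms(1) by (simp add: cong_def mpderiv_Y algebra_simps)
qed

text \<open>The kernel is factorially closed: \<open>nu\<close> is additive, so
  \<open>nu (Y i) = 0\<close> forces degree 0 on every variable dividing \<open>Y i\<close>. The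
  converse is the product rule.\<close>

lemma E_Y_in_J_iff:
  assumes i: "i \<in> blocks D" shows "E (Y i) \<in> J \<longleftrightarrow> (\<forall>j. T i j \<in> V \<longrightarrow> f (T i j) \<in> J)"
proof (intro iffI allI impI)
  fix j assume E: "E (Y i) \<in> J" and T: "T i j \<in> V"
  have iM: "i \<in> M" using i blocks_subset by auto
  have "Y i \<notin> J" using single_notin_J[OF keys_yb, of i] by (simp add: Y_eq_single)
  then have "nu (Y i) = 0" using lnd.nu_eq_0_iff[OF in_homs[OF hom_Y[OF iM]]] E by simp
  then have "nu (mvar (T i j)) = 0"
    using lnd.nu_mult[OF in_homs[OF hom_mvar[OF T]] mvar_notin_J[OF T] in_homs[OF hom_yq] single_notin_J[OF keys_yq], of i j]
      Y_eq_mvar_mult[OF T] by simp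
  then show "f (T i j) \<in> J"
    using lnd.nu_eq_0_iff[OF in_homs[OF hom_mvar[OF T]] mvar_notin_J[OF T]] T by (simp add: E_mvar)
next
  assume all: "\<forall>j. T i j \<in> V \<longrightarrow> f (T i j) \<in> J"
  have T: "T i 1 \<in> V" using i n_pos[OF i] by simp
  then have "f (T i 1) \<in> J" using all by blast
  then have "mconst (of_nat (l i 1)) * Poly_Mapping.single (yq i 1) 1 * f (T i 1) \<in> J"
    by (intro J_mult mpolys_mult mpolys_single keys_yq) auto
  then show "E (Y i) \<in> J" using cong_J_iff[OF E_Y_cong[OF T]] all by blast
qed

text \<open>Multiplying the reduced monomial of \<open>f (T i j)\<close> by \<open>Y i / T i j\<close> gives the reduced monomial of
  the degree of \<open>E (Y i)\<close>, which does not depend on \<open>i\<close> and \<open>j\<close>.\<close>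

lemma reduced_monomial_of_value:
  assumes T: "T i j \<in> V" and notJ: "f (T i j) \<notin> J"
  obtains t N where "red (t + yq i j)" "Poly_Mapping.lookup t (T i j) = 0"
    "deq (\<lambda>w. d w + ud w) (\<lambda>w. dg (t + yq i j) w + int N * ud w)"
proof -
  obtain t N F where t: "red t" "deq (\<lambda>w. unit (T i j) w + d w) (\<lambda>w. dg t w + int N * ud w)"
    "Poly_Mapping.lookup t (T i j) = 0"
    by (rule f_normal_form[OF T notJ]) (rule that)
  have i: "i \<in> blocks D" "1 \<le> j" "j \<le> n i" and iM: "i \<in> M" using T blocks_subset by auto
  have "Poly_Mapping.keys (t + yq i j) \<subseteq> V"
    using keys_add[of t "yq i j"] keys_yq[of i j] red_keys[OF t(1)] by blast
  moreover have "\<exists>j'. 1 \<le> j' \<and> j' \<le> n k \<and> Poly_Mapping.lookup (t + yq i j) (T k j') < l k j'"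
    if k: "k \<in> blocks D" for k
  proof (cases "k = i")
    case True
    \<comment> \<open>In block \<open>i\<close> the variable \<open>T i j\<close> itself is the
      witness: its exponent is 0 in \<open>t\<close> and \<open>l i j - 1\<close> in
      \<open>yq i j\<close>.\<close>
    then show ?thesis using t(3) i l_pos[OF i] by (intro exI[of _ j]) (simp add: lookup_add lookup_yq_T)
  next
    case False
    then show ?thesis using t(1) k unfolding red_def by (simp add: lookup_add lookup_yq_T)
  qed
  ultimately have red: "red (t + yq i j)" by (simp add: red_def)
  have "dg (yb i) = (\<lambda>w. unit (T i j) w + dg (yq i j) w)"
    unfolding yb_eq[OF T] dg_add dg_single_1 by simp
  moreover have "deq ud (dg (yb i))" unfolding ud_def by (intro deq_yb qb_in_M iM)
  ultimately have "deq (\<lambda>w. ud w + ((unit (T i j) w + d w) - unit (T i j) w))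
      (\<lambda>w. (unit (T i j) w + dg (yq i j) w) + ((dg t w + int N * ud w) - unit (T i j) w))"
    by (intro deq_add deq_diff t(2) deq_refl) simp
  then have "deq (\<lambda>w. d w + ud w) (\<lambda>w. dg (t + yq i j) w + int N * ud w)"
    by (simp add: dg_add algebra_simps)
  with red t(3) show ?thesis by (intro that)
qed

lemma nu_single:
  assumes "Poly_Mapping.keys t \<subseteq> V"
  shows "nu (Poly_Mapping.single t 1) = (\<Sum>v\<in>V. Poly_Mapping.lookup t v * nu (mvar v))"
proof -
  have h: "mvar v \<in> {p. \<exists>e. hom e p}" "mvar v \<notin> J" if "v \<in> V" for v
    using that hom_mvar mvar_notin_J by blast+
  have "nu (\<Prod>v\<in>V. mvar v ^ Poly_Mapping.lookup t v) = (\<Sum>v\<in>V. nu (mvar v ^ Poly_Mapping.lookup t v))"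
    by (intro lnd.nu_prod conjI lnd.H_power lnd.notin_J_power h)
  also have "\<dots> = (\<Sum>v\<in>V. Poly_Mapping.lookup t v * nu (mvar v))"
    by (intro sum.cong refl lnd.nu_power h)
  finally show ?thesis unfolding single_eq_prod_mvar[OF finite_tvars assms] .
qed

text \<open>A degree admits only one reduced monomial, so \<open>t0\<close> serves every element of
  degree \<open>e\<close>; this makes the images of different blocks comparable.\<close>

lemma deg_normal_form:
  assumes "hom e p" "red t0" "deq e (\<lambda>w. dg t0 w + int N0 * ud w)"
  obtains N F where "degree F \<le> N" "p \<sim> Poly_Mapping.single t0 1 * bf N F" "deq e (\<lambda>w. dg t0 w + int N * ud w)"
proof (cases "p \<in> J")
  case True
  then show ?thesis using that[of 0 N0] assms(3) by (simp add: cong_0_iff)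
next
  case False
  then obtain t N F where t: "red t" "degree F \<le> N" "p \<sim> Poly_Mapping.single t 1 * bf N F"
    "deq e (\<lambda>w. dg t w + int N * ud w)"
    using hom_imp_nf[OF assms(1)] unfolding nf_def by (elim disjE exE conjE) auto
  have "t = t0"
    by (rule common_normal_form[OF t(1) assms(2) t(4) assms(3) t(2), of 0]) auto
  then show ?thesis using that t by blast
qed

lemma linear_form_cong: "E (mconst a * Y pb + mconst b * Y qb) = mconst a * E (Y pb) + mconst b * E (Y qb)"
  by (simp add: der_add E_mconst_mult)

lemma E_Y_linear: "i \<in> M \<Longrightarrow> E (Y i) \<sim> mconst (kap i) * E (Y pb) + mconst (lam i) * E (Y qb)"
  using E_cong[OF Y_cong] by (simp add: linear_form_cong)

lemma hom_linear: "hom ud (mconst a * Y pb + mconst b * Y qb)"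
  by (intro hom_add hom_mconst_mult hom_Y pb_in_M qb_in_M)

lemma linear_eq_bf: "mconst a * Y pb + mconst b * Y qb = bf 1 [:b, a:]"
  by (simp add: bf_altdef add.commute)

lemma linear_notin_J: "(a, b) \<noteq> (0, 0) \<Longrightarrow> mconst a * Y pb + mconst b * Y qb \<notin> J"
  unfolding linear_eq_bf by (intro bf_notin_J) auto

lemma E_in_J_if_linear_dvd:
  assumes "E (mconst a * Y pb + mconst b * Y qb) \<sim> Poly_Mapping.single t 1 * bf (Suc N) P"
    and "bf (Suc N) P = (mconst a * Y pb + mconst b * Y qb) * bf N G" and t: "Poly_Mapping.keys t \<subseteq> V"
  shows "E (mconst a * Y pb + mconst b * Y qb) \<in> J"
proof -
  have "E (mconst a * Y pb + mconst b * Y qb) - (mconst a * Y pb + mconst b * Y qb) * (Poly_Mapping.single t 1 * bf N G) \<in> J"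
    using assms(1) unfolding cong_def assms(2) by (simp only: mult_ac)
  then show ?thesis
    by (rule lnd.E_in_J_of_dvd[OF in_homs[OF hom_linear] in_homs[OF hom_single_bf[OF t]]])
qed


lemma hom_E_Y: assumes "i \<in> M" shows "hom (\<lambda>w. d w + ud w) (E (Y i))"
  using hom_E[OF hom_Y[OF assms]] by (simp add: add.commute)

text \<open>A linear factor of the form \<open>Y qb * E (Y pb) - Y pb * E (Y qb)\<close> divides its own image under \<open>E\<close>,
  hence is annihilated by \<open>E\<close>.\<close>

lemma kernel_linear_form:
  assumes notJ: "\<not> (E (Y pb) \<in> J \<and> E (Y qb) \<in> J)"
    and t0: "red t0" "deq (\<lambda>w. d w + ud w) (\<lambda>w. dg t0 w + int N0 * ud w)"
  obtains \<beta>\<^sub>p \<beta>\<^sub>q N H where "degree H \<le> N" "H \<noteq> 0"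
    "E (Y pb) \<sim> mconst \<beta>\<^sub>p * (Poly_Mapping.single t0 1 * bf N H)"
    "E (Y qb) \<sim> mconst \<beta>\<^sub>q * (Poly_Mapping.single t0 1 * bf N H)"
    "(\<beta>\<^sub>p, \<beta>\<^sub>q) \<noteq> (0, 0)" "deq (\<lambda>w. d w + ud w) (\<lambda>w. dg t0 w + int N * ud w)"
proof -
  obtain N1 Gp where 1: "degree Gp \<le> N1" "E (Y pb) \<sim> Poly_Mapping.single t0 1 * bf N1 Gp"
    "deq (\<lambda>w. d w + ud w) (\<lambda>w. dg t0 w + int N1 * ud w)"
    by (rule deg_normal_form[OF hom_E_Y[OF pb_in_M] t0])
  obtain N2 Gq where 2: "degree Gq \<le> N2" "E (Y qb) \<sim> Poly_Mapping.single t0 1 * bf N2 Gq"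
    "deq (\<lambda>w. d w + ud w) (\<lambda>w. dg t0 w + int N2 * ud w)"
    by (rule deg_normal_form[OF hom_E_Y[OF qb_in_M] t0])
  obtain N where N: "deq (\<lambda>w. d w + ud w) (\<lambda>w. dg t0 w + int N * ud w)"
    "degree Gp \<le> N" "degree Gq \<le> N" "bf N1 Gp = bf N Gp" "bf N2 Gq = bf N Gq"
    by (rule common_normal_form[OF t0(1) t0(1) 1(3) 2(3) 1(1) 2(1)])
  let ?t = "Poly_Mapping.single t0 1 :: (tvar, 'k) mpoly"
  have t0V: "Poly_Mapping.keys t0 \<subseteq> V" by (rule red_keys[OF t0(1)])
  have Ep: "E (Y pb) \<sim> ?t * bf N Gp" and Eq: "E (Y qb) \<sim> ?t * bf N Gq"
    using 1(2) 2(2) N(4,5) by simp_all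
  \<comment> \<open>The dehomogenized form that remains of the image of
    \<open>a * Y pb + b * Y qb\<close> after splitting off \<open>t0\<close>.\<close>
  define P where "P = (\<lambda>a b. smult a Gp + smult b Gq)"
  have EP: "E (mconst a * Y pb + mconst b * Y qb) \<sim> ?t * bf N (P a b)" for a b
  proof -
    have "mconst a * E (Y pb) + mconst b * E (Y qb) \<sim> mconst a * (?t * bf N Gp) + mconst b * (?t * bf N Gq)"
      by (intro cong_add cong_mult_left Ep Eq mpolys_mconst)
    then show ?thesis by (simp add: linear_form_cong P_def bf_add bf_smult algebra_simps)
  qed
  have "\<exists>a b. (a, b) \<noteq> (0, 0) \<and> E (mconst a * Y pb + mconst b * Y qb) \<in> J"
  proof (cases "Gq = 0")
    case True
    then have "E (mconst 0 * Y pb + mconst 1 * Y qb) \<in> J" using Eq by (simp add: cong_0_iff)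
    then show ?thesis by (intro exI[of _ 0] exI[of _ 1]) auto
  next
    case Gq: False
    \<comment> \<open>The dehomogenization of \<open>Y qb * E (Y pb) - Y pb * E (Y qb)\<close>
      without \<open>t0\<close>, a form of degree \<open>Suc N\<close>.\<close>
    define W where "W = Gp - pCons 0 Gq"
    have dW: "degree W \<le> Suc N" unfolding W_def
      using N by (intro degree_diff_le) (auto simp: degree_pCons_le order.trans[OF degree_pCons_le])
    show ?thesis
    proof (cases "W = 0")
      case True
      \<comment> \<open>If the form vanishes identically, \<open>Y pb\<close> divides its own
        image.\<close>
      then have G: "Gp = pCons 0 Gq" by (simp add: W_def)
      then have "Suc (degree Gq) \<le> N" using N Gq by simp
      then obtain K where K: "N = Suc K" "degree Gq \<le> K" by (cases N) auto
      have "E (mconst 1 * Y pb + mconst 0 * Y qb) \<in> J"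
        by (rule E_in_J_if_linear_dvd[of 1 0 t0 K "P 1 0" Gq])
          (use EP[of 1 0] K G t0V in \<open>auto simp: P_def bf_pCons\<close>)
      then show ?thesis by (intro exI[of _ 1] exI[of _ 0]) auto
    next
      case False
      obtain a b G where ab: "(a, b) \<noteq> (0, 0)" "degree G \<le> N" "W = [:b, a:] * G"
        by (rule bf_factor[OF dW False])
      show ?thesis
      proof (cases "a = 0")
        case True
        \<comment> \<open>The root at infinity: the drop in the degree of \<open>W\<close> passes on
          to \<open>Gq\<close>, so \<open>Y qb\<close> divides its own image.\<close>
        then have "degree W \<le> N" using ab degree_smult_le[of b G] by simp
        then have "coeff W (Suc N) = 0" by (simp add: coeff_eq_0)
        then have "coeff Gq N = 0" using N by (simp add: W_def coeff_eq_0)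
        then have "degree Gq < N"
          using N(3) Gq by (metis leading_coeff_0_iff le_neq_implies_less)
        then obtain K where K: "N = Suc K" "degree Gq \<le> K" by (cases N) auto
        have "E (mconst 0 * Y pb + mconst 1 * Y qb) \<in> J"
          by (rule E_in_J_if_linear_dvd[of 0 1 t0 K "P 0 1" Gq])
            (use EP[of 0 1] K t0V in \<open>auto simp: P_def bf_Suc\<close>)
        then show ?thesis by (intro exI[of _ 0] exI[of _ 1]) auto
      next
        case a: False
        \<comment> \<open>The zero of the linear factor. There \<open>W = 0\<close> reads
          \<open>Gp = c * Gq\<close>, so \<open>a * Gp + b * Gq\<close> vanishes as well.\<close>
        define c where "c = - b / a"
        have "poly W c = 0" using a by (simp add: ab(3) c_def)
        then have "poly Gp c = c * poly Gq c" by (simp add: W_def)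
        then have root: "poly (P a b) c = 0" using a by (simp add: P_def c_def field_simps)
        have "E (mconst a * Y pb + mconst b * Y qb) \<in> J"
        proof (cases "P a b = 0")
          case True
          then show ?thesis using EP[of a b] by (simp add: cong_0_iff)
        next
          case False
          obtain G' where G': "P a b = [:-c, 1:] * G'" using root by (metis poly_eq_0_iff_dvd dvdE)
          have eq: "P a b = [:b, a:] * smult (1 / a) G'"
            using a unfolding G' by (simp add: c_def smult_add_right)
          have "G' \<noteq> 0" using False G' by auto
          then have "degree (P a b) = Suc (degree G')" unfolding G' by (subst degree_mult_eq) auto
          moreover have "degree (P a b) \<le> N" unfolding P_def
            using N by (intro degree_add_le order.trans[OF degree_smult_le])
          ultimately obtain K where K: "N = Suc K" "degree (smult (1 / a) G') \<le> K" using a by (cases N) auto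
          have E1: "E (mconst a * Y pb + mconst b * Y qb) \<sim> ?t * bf (Suc K) (P a b)" using EP[of a b] K by simp
          show ?thesis
            by (rule E_in_J_if_linear_dvd[OF E1 _ t0V]) (unfold eq, rule bf_linear_mult[OF K(2)])
        qed
        then show ?thesis using ab(1) by blast
      qed
    qed
  qed
  then obtain a b where ab: "(a, b) \<noteq> (0, 0)" and EJ: "E (mconst a * Y pb + mconst b * Y qb) \<in> J" by blast
  have "?t * bf N (P a b) \<in> J" using cong_J_iff[OF EP] EJ by blast
  then have "bf N (P a b) \<in> J"
    using hom_domain[OF hom_single[OF t0V deq_refl] hom_bf] single_notin_J[OF t0V] by blast
  moreover have "degree (P a b) \<le> N" unfolding P_def
    using N by (intro degree_add_le order.trans[OF degree_smult_le])
  ultimately have P0: "smult a Gp + smult b Gq = 0" using bf_notin_J unfolding P_def by blast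
  \<comment> \<open>The annihilated linear form makes \<open>Gp\<close> and \<open>Gq\<close>
    proportional; \<open>H\<close> is their common part, with the scalars \<open>- b\<close> and
    \<open>a\<close>.\<close>
  obtain H where H: "Gp = smult (- b) H" "Gq = smult a H" "degree H \<le> N"
  proof (cases "a = 0")
    case True
    then have "b \<noteq> 0" "Gq = 0" using P0 ab by auto
    then show ?thesis using that[of "smult (- 1 / b) Gp"] True N(2) by simp
  next
    case False
    have "smult a Gp = smult (- b) Gq"
      using P0 by (simp only: smult_minus_left eq_neg_iff_add_eq_0)
    then have "smult (1 / a) (smult a Gp) = smult (1 / a) (smult (- b) Gq)" by (rule arg_cong)
    then have "Gp = smult (- b) (smult (1 / a) Gq)" using False by (simp add: mult.commute)
    then show ?thesis using that[of "smult (1 / a) Gq"] False N(3) by simp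
  qed
  have "H \<noteq> 0"
  proof
    assume "H = 0"
    then show False using notJ Ep Eq H by (simp add: cong_0_iff)
  qed
  moreover have "E (Y pb) \<sim> mconst (- b) * (?t * bf N H)" "E (Y qb) \<sim> mconst a * (?t * bf N H)"
    using Ep Eq unfolding H(1,2) bf_smult by (simp_all only: mult_ac)
  ultimately show ?thesis using that[of H N "- b" a] H(3) N(1) ab by auto
qed

text \<open>\<open>E\<close> sends the linear form to a nonzero multiple of \<open>W\<close> and
  lowers the degree by one.\<close>

lemma nu_linear_form:
  assumes W: "hom e W" "W \<notin> J" "E (Y pb) \<sim> mconst \<beta>\<^sub>p * W" "E (Y qb) \<sim> mconst \<beta>\<^sub>q * W"
    and nz: "a * \<beta>\<^sub>p + b * \<beta>\<^sub>q \<noteq> 0"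
  shows "nu (mconst a * Y pb + mconst b * Y qb) = Suc (nu W)"
proof -
  let ?L = "mconst a * Y pb + mconst b * Y qb" and ?c = "a * \<beta>\<^sub>p + b * \<beta>\<^sub>q"
  have "mconst a * E (Y pb) + mconst b * E (Y qb) \<sim> mconst a * (mconst \<beta>\<^sub>p * W) + mconst b * (mconst \<beta>\<^sub>q * W)"
    by (intro cong_add cong_mult_left W mpolys_mconst)
  then have EL: "E ?L \<sim> mconst ?c * W"
    by (simp add: linear_form_cong mconst_add mconst_mult algebra_simps)
  have "mconst ?c * W \<notin> J" using W(2) J_mconst_mult[OF nz] by blast
  then have notJ: "E ?L \<notin> J" using cong_J_iff[OF EL] by blast
  have c: "mconst ?c \<notin> J" using J_mconst_mult[OF nz, of 1] one_notin_J by auto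
  have "nu (mconst ?c) = 0"
    using lnd.nu_eq_0_iff[OF in_homs[OF hom_mconst] c] by simp
  then have "nu (mconst ?c * W) = nu W"
    using lnd.nu_mult[OF in_homs[OF hom_mconst] c in_homs[OF W(1)] W(2)] by simp
  moreover have "nu (E ?L) = nu (mconst ?c * W)"
    using EL by (intro lnd.nu_cong) (simp add: cong_def)
  ultimately show ?thesis using lnd.nu_E[OF in_homs[OF hom_linear] notJ] by simp
qed

text \<open>A linear factor outside the kernel would have \<open>nu\<close>-degree \<open>Suc (nu W)\<close>.\<close>

lemma form_eq_power:
  assumes W: "hom e W" "W \<notin> J" "E (Y pb) \<sim> mconst \<beta>\<^sub>p * W" "E (Y qb) \<sim> mconst \<beta>\<^sub>q * W"
    and \<beta>: "(\<beta>\<^sub>p, \<beta>\<^sub>q) \<noteq> (0, 0)"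
  shows "degree F \<le> K \<Longrightarrow> F \<noteq> 0 \<Longrightarrow> nu (bf K F) \<le> nu W \<Longrightarrow>
    \<exists>\<alpha>. \<alpha> \<noteq> 0 \<and> bf K F = mconst \<alpha> * (mconst \<beta>\<^sub>q * Y pb - mconst \<beta>\<^sub>p * Y qb) ^ K"
proof (induction K arbitrary: F)
  case 0
  then have "coeff F 0 \<noteq> 0" using leading_coeff_0_iff[of F] by simp
  then show ?case by (auto simp: bf_const_0)
next
  case (Suc K)
  obtain a b G where ab: "(a, b) \<noteq> (0, 0)" "degree G \<le> K" "G \<noteq> 0"
    "bf (Suc K) F = (mconst a * Y pb + mconst b * Y qb) * bf K G"
    by (rule bf_factor[OF Suc.prems(1,2)])
  let ?L = "mconst a * Y pb + mconst b * Y qb"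
  have nu: "nu (bf (Suc K) F) = nu ?L + nu (bf K G)"
    unfolding ab(4) by (intro lnd.nu_mult in_homs[OF hom_linear] in_homs[OF hom_bf] linear_notin_J bf_notin_J ab)
  \<comment> \<open>As a factor, \<open>?L\<close> has at most the degree of the whole form, hence
    at most \<open>nu W\<close>.\<close>
  have "nu ?L \<noteq> Suc (nu W)" using nu Suc.prems by simp
  then have z: "a * \<beta>\<^sub>p + b * \<beta>\<^sub>q = 0" using nu_linear_form[OF W] by blast
  \<comment> \<open>Being orthogonal to \<open>(\<beta>\<^sub>p, \<beta>\<^sub>q)\<close>, the pair
    \<open>(a, b)\<close> is a multiple of
    \<open>(\<beta>\<^sub>q, - \<beta>\<^sub>p)\<close>.\<close>
  obtain \<mu> where \<mu>: "\<mu> \<noteq> 0" "a = \<mu> * \<beta>\<^sub>q" "b = - \<mu> * \<beta>\<^sub>p"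
  proof (cases "\<beta>\<^sub>q = 0")
    case True
    then have "\<beta>\<^sub>p \<noteq> 0" "a = 0" "b \<noteq> 0" using \<beta> z ab(1) by auto
    then show ?thesis using that[of "- b / \<beta>\<^sub>p"] True by simp
  next
    case False
    then have b: "b = - (a / \<beta>\<^sub>q) * \<beta>\<^sub>p" using z by (simp add: field_simps eq_neg_iff_add_eq_0)
    then have "a \<noteq> 0" using ab(1) by auto
    then show ?thesis using that[of "a / \<beta>\<^sub>q"] b False by simp
  qed
  obtain \<alpha> where \<alpha>: "\<alpha> \<noteq> 0" "bf K G = mconst \<alpha> * (mconst \<beta>\<^sub>q * Y pb - mconst \<beta>\<^sub>p * Y qb) ^ K"
    using Suc.IH[OF ab(2,3)] nu Suc.prems(3) by auto
  have "bf (Suc K) F = mconst (\<mu> * \<alpha>) * (mconst \<beta>\<^sub>q * Y pb - mconst \<beta>\<^sub>p * Y qb) ^ Suc K"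
    unfolding ab(4) \<alpha>(2) \<mu> by (simp add: mconst_mult mconst_uminus algebra_simps)
  then show ?case using \<mu>(1) \<alpha>(1) by (intro exI[of _ "\<mu> * \<alpha>"]) simp
qed

text \<open>\<open>\<beta> i\<close> is the scalar in the image of \<open>Y i\<close>,
  \<open>c i\<close> selects the variable with nonzero image in each block with
  \<open>\<beta> i \<noteq> 0\<close>, and \<open>t\<close> is what remains of the common reduced
  monomial after removing \<open>Y i / T i (c i)\<close> for all these blocks. Since
  \<open>t\<close> avoids the selected variables, it is a monomial in kernel variables.\<close>

lemma delta_case:
  assumes "T i0 j0 \<in> V" "f (T i0 j0) \<notin> J"
  obtains \<beta> c \<alpha> N t where
    "\<And>i. i \<in> M \<Longrightarrow> \<beta> i = kap i * \<beta> pb + lam i * \<beta> qb" "(\<beta> pb, \<beta> qb) \<noteq> (0, 0)"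
    "{i\<in>M. \<beta> i \<noteq> 0} \<subseteq> blocks D" "\<And>i. i \<in> blocks D \<Longrightarrow> 1 \<le> c i \<and> c i \<le> n i"
    "linear_but_one D {i\<in>M. \<beta> i \<noteq> 0} c"
    "Poly_Mapping.keys t \<subseteq> V" "\<And>i. i \<in> M \<Longrightarrow> \<beta> i \<noteq> 0 \<Longrightarrow> Poly_Mapping.lookup t (T i (c i)) = 0"
    "\<And>v. v \<in> V \<Longrightarrow> f v \<sim> mconst \<alpha> * (mconst (\<beta> qb) * Y pb - mconst (\<beta> pb) * Y qb) ^ N
       * Poly_Mapping.single t 1 * delta_values D {i\<in>M. \<beta> i \<noteq> 0} c \<beta> v"
proof -
  have i0: "i0 \<in> blocks D" "i0 \<in> M" using assms blocks_subset by auto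
  obtain s0 N0 where s0: "red (s0 + yq i0 j0)" "deq (\<lambda>w. d w + ud w) (\<lambda>w. dg (s0 + yq i0 j0) w + int N0 * ud w)"
    by (rule reduced_monomial_of_value[OF assms])
  define t0 where "t0 = s0 + yq i0 j0"
  have t0: "red t0" "deq (\<lambda>w. d w + ud w) (\<lambda>w. dg t0 w + int N0 * ud w)"
    using s0 unfolding t0_def by blast+
  have t0V: "Poly_Mapping.keys t0 \<subseteq> V" by (rule red_keys[OF t0(1)])
  \<comment> \<open>Every variable with nonzero image leads to the degree \<open>d + ud\<close>,
    hence to the same reduced monomial \<open>t0\<close>.\<close>
  have lift: "\<exists>t. t0 = t + yq i j \<and> Poly_Mapping.lookup t (T i j) = 0" if ij: "T i j \<in> V" "f (T i j) \<notin> J" for i j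
  proof -
    obtain t N where t: "red (t + yq i j)" "Poly_Mapping.lookup t (T i j) = 0"
      "deq (\<lambda>w. d w + ud w) (\<lambda>w. dg (t + yq i j) w + int N * ud w)"
      by (rule reduced_monomial_of_value[OF ij])
    have "t + yq i j = t0"
      by (rule common_normal_form[OF t(1) t0(1) t(3) t0(2), of 0 0]) auto
    then show ?thesis using t(2) by blast
  qed
  have exps: "Poly_Mapping.lookup t0 (T i j) = l i j - 1"
    "\<And>j'. T i j' \<in> V \<Longrightarrow> j' \<noteq> j \<Longrightarrow> l i j' \<le> Poly_Mapping.lookup t0 (T i j')"
    if ij: "T i j \<in> V" "f (T i j) \<notin> J" for i j
    using lift[OF ij] ij(1) by (auto simp: lookup_add lookup_yq_T)
  \<comment> \<open>Two such variables in one block would require the exponent of one of them in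
    \<open>t0\<close> to be both \<open>l i j - 1\<close> and at least \<open>l i j\<close>.\<close>
  have unique: "f (T i j') \<in> J" if "T i j \<in> V" "f (T i j) \<notin> J" "T i j' \<in> V" "j' \<noteq> j" for i j j'
  proof (rule ccontr)
    assume "f (T i j') \<notin> J"
    then have "l i j \<le> l i j - 1" using exps(1)[OF that(1,2)] exps(2)[of i j' j] that by simp
    then show False using l_pos[of i j] that(1) by simp
  qed
  have notJ: "\<not> (E (Y pb) \<in> J \<and> E (Y qb) \<in> J)"
  proof
    assume "E (Y pb) \<in> J \<and> E (Y qb) \<in> J"
    then have "mconst (kap i0) * E (Y pb) + mconst (lam i0) * E (Y qb) \<in> J"
      by (intro J_add J_mult) auto
    then have "E (Y i0) \<in> J" using cong_J_iff[OF E_Y_linear[OF i0(2)]] by blast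
    then show False using E_Y_in_J_iff[OF i0(1)] assms by blast
  qed
  obtain \<beta>\<^sub>p \<beta>\<^sub>q N H where H: "degree H \<le> N" "H \<noteq> 0"
    "E (Y pb) \<sim> mconst \<beta>\<^sub>p * (Poly_Mapping.single t0 1 * bf N H)"
    "E (Y qb) \<sim> mconst \<beta>\<^sub>q * (Poly_Mapping.single t0 1 * bf N H)"
    "(\<beta>\<^sub>p, \<beta>\<^sub>q) \<noteq> (0, 0)" "deq (\<lambda>w. d w + ud w) (\<lambda>w. dg t0 w + int N * ud w)"
    by (rule kernel_linear_form[OF notJ t0])
  define W where "W = Poly_Mapping.single t0 1 * bf N H"
  have W: "hom (\<lambda>v. dg t0 v + int N * ud v) W" "W \<notin> J"
    "E (Y pb) \<sim> mconst \<beta>\<^sub>p * W" "E (Y qb) \<sim> mconst \<beta>\<^sub>q * W"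
    unfolding W_def using H single_notin_J[OF t0V] bf_notin_J[OF H(2,1)]
      hom_domain[OF hom_single[OF t0V deq_refl] hom_bf[of N H], of 1]
    by (auto intro: hom_single_bf[OF t0V])
  have h0: "Poly_Mapping.single t0 1 \<in> {p. \<exists>e. hom e p}" "Poly_Mapping.single t0 1 \<notin> J"
    using hom_single[OF t0V deq_refl] single_notin_J[OF t0V] by blast+
  have nuW: "nu W = nu (Poly_Mapping.single t0 1) + nu (bf N H)"
    unfolding W_def by (rule lnd.nu_mult[OF h0 in_homs[OF hom_bf] bf_notin_J[OF H(2,1)]])
  define L where "L = mconst \<beta>\<^sub>q * Y pb - mconst \<beta>\<^sub>p * Y qb"
  have L_mpolys: "L \<in> mpolys V" unfolding L_def by (intro mpolys_intros Y_in_mpolys mpolys_mconst)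
  obtain \<alpha> where \<alpha>: "\<alpha> \<noteq> 0" "bf N H = mconst \<alpha> * L ^ N"
    using form_eq_power[OF W H(5) H(1,2)] nuW unfolding L_def by auto
  define \<beta> where "\<beta> = (\<lambda>i. kap i * \<beta>\<^sub>p + lam i * \<beta>\<^sub>q)"
  have \<beta>pq: "\<beta> pb = \<beta>\<^sub>p" "\<beta> qb = \<beta>\<^sub>q" by (simp_all add: \<beta>_def)
  define B where "B = {i\<in>M. \<beta> i \<noteq> 0}"
  have EY: "E (Y i) \<sim> mconst (\<beta> i) * W" if "i \<in> M" for i
  proof -
    have "mconst (kap i) * E (Y pb) + mconst (lam i) * E (Y qb) \<sim>
       mconst (kap i) * (mconst \<beta>\<^sub>p * W) + mconst (lam i) * (mconst \<beta>\<^sub>q * W)"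
      by (intro cong_add cong_mult_left W mpolys_mconst)
    with E_Y_linear[OF that] have "E (Y i) \<sim> mconst (kap i) * (mconst \<beta>\<^sub>p * W) + mconst (lam i) * (mconst \<beta>\<^sub>q * W)"
      by (rule cong_trans)
    then show ?thesis by (simp add: \<beta>_def mconst_add mconst_mult algebra_simps)
  qed
  have EY_notJ: "E (Y i) \<notin> J \<longleftrightarrow> \<beta> i \<noteq> 0" if "i \<in> M" for i
    using cong_J_iff[OF EY[OF that]] J_mconst_mult[of "\<beta> i" W] W(2) by auto
  \<comment> \<open>This concerns index 0 in type 1: its monomial is 1, so its image and therefore
    \<open>\<beta> 0\<close> vanish.\<close>
  have B_blocks: "B \<subseteq> blocks D"
  proof
    fix i assume i: "i \<in> B"
    show "i \<in> blocks D"
    proof (rule ccontr)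
      assume "i \<notin> blocks D"
      then have "E (Y i) = 0" by (simp add: Y_def)
      then show False using EY_notJ[of i] i by (auto simp: B_def)
    qed
  qed
  \<comment> \<open>Outside \<open>B\<close> any index of the block will do as a default.\<close>
  have "\<exists>j. T i j \<in> V \<and> (i \<in> B \<longrightarrow> f (T i j) \<notin> J)" if "i \<in> blocks D" for i
  proof (cases "i \<in> B")
    case True
    then show ?thesis using E_Y_in_J_iff[OF that] EY_notJ[of i] by (auto simp: B_def)
  next
    case False
    then show ?thesis using n_pos[OF that] that by (intro exI[of _ 1]) auto
  qed
  then obtain c where c: "\<And>i. i \<in> blocks D \<Longrightarrow> T i (c i) \<in> V" "\<And>i. i \<in> B \<Longrightarrow> f (T i (c i)) \<notin> J"
    using B_blocks by (metis subsetD)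
  have cV: "T i (c i) \<in> V" if "i \<in> B" for i using c(1) B_blocks that by blast
  have f_J: "f (T i j) \<in> J" if "T i j \<in> V" "\<not> (i \<in> B \<and> j = c i)" for i j
  proof (cases "i \<in> B")
    case True
    then show ?thesis using unique[OF cV[OF True] c(2)[OF True], of j] that by auto
  next
    case False
    have "i \<in> blocks D" "i \<in> M" using that(1) blocks_subset by auto
    then show ?thesis using E_Y_in_J_iff[of i] EY_notJ[of i] False that(1) by (auto simp: B_def)
  qed
  have f_S: "f (S k) \<in> J" if "S k \<in> V" for k
    using only_one_S[OF that _ assms] by blast
  have finB: "finite B" by (simp add: B_def)

  \<comment> \<open>The other variables of the block lie in the kernel, so \<open>T i (c i)\<close>
    carries the whole degree of \<open>Y i\<close>; modulo the ideal, \<open>Y i\<close> is also a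
    linear form outside the kernel.\<close>
  have nuY: "nu (Y i) = l i (c i) * nu (mvar (T i (c i)))" "nu (Y i) = Suc (nu W)" if i: "i \<in> B" for i
  proof -
    have "nu (mvar v) = 0" if "v \<in> V" "f v \<in> J" for v
      using lnd.nu_eq_0_iff[OF in_homs[OF hom_mvar[OF that(1)]] mvar_notin_J[OF that(1)]] that
      by (simp add: E_mvar)
    then have z: "Poly_Mapping.lookup (yb i) v * nu (mvar v) = 0" if "v \<in> V" "v \<noteq> T i (c i)" for v
      using that f_J f_S by (cases v) (auto simp: lookup_yb_T)
    have "nu (Y i) = (\<Sum>v\<in>V. Poly_Mapping.lookup (yb i) v * nu (mvar v))"
      unfolding Y_eq_single by (rule nu_single[OF keys_yb])
    also have "\<dots> = Poly_Mapping.lookup (yb i) (T i (c i)) * nu (mvar (T i (c i)))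
        + (\<Sum>v\<in>V - {T i (c i)}. Poly_Mapping.lookup (yb i) v * nu (mvar v))"
      by (rule sum.remove[OF finite_tvars cV[OF i]])
    also have "(\<Sum>v\<in>V - {T i (c i)}. Poly_Mapping.lookup (yb i) v * nu (mvar v)) = 0"
      by (intro sum.neutral ballI z) auto
    also have "Poly_Mapping.lookup (yb i) (T i (c i)) = l i (c i)" using cV[OF i] by (simp add: lookup_yb_T)
    finally show "nu (Y i) = l i (c i) * nu (mvar (T i (c i)))" by simp
    have iM: "i \<in> M" using i by (simp add: B_def)
    have "nu (Y i) = nu (mconst (kap i) * Y pb + mconst (lam i) * Y qb)"
      using Y_cong[OF iM] by (intro lnd.nu_cong) (simp add: cong_def)
    also have "\<dots> = Suc (nu W)"
      using i by (intro nu_linear_form[OF W]) (simp add: B_def \<beta>_def)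
    finally show "nu (Y i) = Suc (nu W)" .
  qed

  have linear: "linear_but_one D B c"
    unfolding linear_but_one_def
  proof (subst One_nat_def, subst card_le_Suc0_iff_eq, simp add: finB, intro ballI, rule ccontr)
    fix i k assume i: "i \<in> {i \<in> B. l i (c i) \<noteq> 1}" and k: "k \<in> {i \<in> B. l i (c i) \<noteq> 1}" and ne: "i \<noteq> k"
    let ?x = "\<lambda>i. nu (mvar (T i (c i)))"
    have "(\<Sum>v\<in>{T i (c i), T k (c k)}. Poly_Mapping.lookup t0 v * nu (mvar v))
        \<le> (\<Sum>v\<in>V. Poly_Mapping.lookup t0 v * nu (mvar v))"
      using cV i k finite_tvars by (intro sum_mono2) auto
    then have le: "(l i (c i) - 1) * ?x i + (l k (c k) - 1) * ?x k \<le> nu W"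
      using ne nuW exps(1)[OF cV c(2)] i k by (simp add: nu_single[OF t0V])
    \<comment> \<open>From \<open>l \<ge> 2\<close> follows \<open>2 * (l - 1) \<ge> l\<close>, so
      each such block uses at least half of \<open>Suc (nu W)\<close>, and two of them exceed
      \<open>nu W\<close>.\<close>
    have "2 * ((l i (c i) - 1) * ?x i) \<ge> Suc (nu W)" if "i \<in> {i \<in> B. l i (c i) \<noteq> 1}" for i
    proof -
      have "l i (c i) \<noteq> 0" using l_pos[of i "c i"] cV[of i] that by auto
      then have "2 * (l i (c i) - 1) \<ge> l i (c i)" using that by auto
      then have "2 * (l i (c i) - 1) * ?x i \<ge> l i (c i) * ?x i" by (rule mult_le_mono1)
      then show ?thesis using nuY[of i] that by simp
    qed
    from this[OF i] this[OF k] le show False by linarith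
  qed

  define t where "t = t0 - (\<Sum>k\<in>B. yq k (c k))"
  have lookup_sum_yq: "Poly_Mapping.lookup (\<Sum>k\<in>B. yq k (c k)) v \<le> Poly_Mapping.lookup t0 v" for v
  proof (cases v)
    case (T i j)
    have "Poly_Mapping.lookup (\<Sum>k\<in>B. yq k (c k)) v = (\<Sum>k\<in>B. if k = i then Poly_Mapping.lookup (yq i (c i)) v else 0)"
      unfolding lookup_sum T by (intro sum.cong) (auto simp: lookup_yq_T)
    also have "\<dots> \<le> Poly_Mapping.lookup t0 v"
    proof (cases "i \<in> B \<and> T i j \<in> V")
      case True
      then show ?thesis using exps[of i "c i"] cV[of i] c(2)[of i] T finB by (cases "j = c i") (auto simp: lookup_yq_T)
    next
      case False
      then show ?thesis using finB T by (auto simp: lookup_yq_T)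
    qed
    finally show ?thesis .
  qed (simp add: lookup_sum)
  have t: "t0 = t + (\<Sum>k\<in>B. yq k (c k))"
    by (rule poly_mapping_eqI) (simp add: t_def lookup_add lookup_minus lookup_sum_yq)
  have tV: "Poly_Mapping.keys t \<subseteq> V"
    using t0V by (auto simp: t_def in_keys_iff lookup_minus subset_iff)
  have t_c: "Poly_Mapping.lookup t (T i (c i)) = 0" if i: "i \<in> B" for i
  proof -
    have "Poly_Mapping.lookup (\<Sum>k\<in>B. yq k (c k)) (T i (c i)) = (\<Sum>k\<in>B. if k = i then l i (c i) - 1 else 0)"
      unfolding lookup_sum using cV[OF i] by (intro sum.cong) (auto simp: lookup_yq_T)
    then show ?thesis using exps(1)[OF cV[OF i] c(2)[OF i]] finB i by (simp add: t_def lookup_minus)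
  qed

  \<comment> \<open>In \<open>delta_values\<close> the derivatives contribute the factors
    \<open>l k (c k)\<close> for \<open>k \<noteq> i\<close>, and \<open>E (Y i)\<close> contributes
    the missing one. Dividing by the full product makes the scalar independent of
    \<open>i\<close>.\<close>
  define P where "P = (\<Prod>k\<in>B. of_nat (l k (c k)) :: 'k)"
  have l_nz: "(of_nat (l k (c k)) :: 'k) \<noteq> 0" if "k \<in> B" for k
    using l_pos[of k "c k"] cV[OF that] by simp
  have f_T: "f (T i (c i)) \<sim> mconst (\<alpha> / P) * L ^ N * Poly_Mapping.single t 1 * delta_values D B c \<beta> (T i (c i))"
    if i: "i \<in> B" for i
  proof -
    let ?l = "\<lambda>k. of_nat (l k (c k)) :: 'k"
    let ?s = "t + (\<Sum>k\<in>B - {i}. yq k (c k))"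
    have iM: "i \<in> M" using i by (simp add: B_def)
    have t0s: "t0 = yq i (c i) + ?s"
      using t sum.remove[OF finB i, of "\<lambda>k. yq k (c k)"] by (simp add: add_ac)
    have sV: "Poly_Mapping.keys ?s \<subseteq> V"
      using t0V unfolding t0s by (auto simp: in_keys_iff lookup_add subset_iff)
    have st0: "(Poly_Mapping.single t0 1 :: (tvar, 'k) mpoly)
        = Poly_Mapping.single (yq i (c i)) 1 * Poly_Mapping.single ?s 1"
      by (simp add: t0s mult_single)
    \<comment> \<open>The two expressions for the image of \<open>Y i\<close> differ by
      \<open>R\<close> times the monomial of \<open>yq i (c i)\<close>; as \<open>R\<close> is
      homogeneous, the monomial can be cancelled.\<close>
    define R where "R = mconst (?l i) * f (T i (c i)) - mconst (\<beta> i) * (Poly_Mapping.single ?s 1 * bf N H)"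
    have yqV: "Poly_Mapping.single (yq i (c i)) 1 \<in> mpolys V" by (intro mpolys_single keys_yq)
    have "mconst (?l i) * Poly_Mapping.single (yq i (c i)) 1 * f (T i (c i)) \<sim> mconst (\<beta> i) * W"
      using cong_trans[OF cong_sym[OF E_Y_cong[OF cV[OF i]]] EY[OF iM]] f_J by blast
    then have "Poly_Mapping.single (yq i (c i)) 1 * R \<in> J"
      unfolding R_def cong_def W_def st0 by (simp add: algebra_simps)
    moreover have "hom (\<lambda>w. unit (T i (c i)) w + d w) R"
      unfolding R_def
    proof (intro hom_diff hom_mconst_mult f_hom cV i)
      have "dg (yb i) = (\<lambda>w. unit (T i (c i)) w + dg (yq i (c i)) w)"
        unfolding yb_eq[OF cV[OF i]] dg_add dg_single_1 by simp
      have "deq (dg (yb i)) ud" unfolding ud_def by (intro deq_yb qb_in_M iM)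
      have "deq (\<lambda>w. (dg t0 w + int N * ud w) + (unit (T i (c i)) w - dg (yb i) w))
         (\<lambda>w. (d w + ud w) + (unit (T i (c i)) w - ud w))"
        by (intro deq_add deq_diff deq_sym[OF H(6)] deq_refl \<open>deq (dg (yb i)) ud\<close>)
      then have "deq (\<lambda>w. dg ?s w + int N * ud w) (\<lambda>w. unit (T i (c i)) w + d w)"
        unfolding \<open>dg (yb i) = _\<close> t0s by (simp add: dg_add algebra_simps)
      with hom_single_bf[OF sV]
      show "hom (\<lambda>w. unit (T i (c i)) w + d w) (Poly_Mapping.single ?s 1 * bf N H)"
        by (rule hom_cong)
    qed
    ultimately have "R \<in> J"
      using hom_domain[OF hom_yq] single_notin_J[OF keys_yq] by blast
    then have "mconst (1 / ?l i) * (mconst (?l i) * f (T i (c i))) \<sim>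
        mconst (1 / ?l i) * (mconst (\<beta> i) * (Poly_Mapping.single ?s 1 * bf N H))"
      by (intro cong_mult_left) (simp_all add: R_def cong_def)
    moreover have "mconst (1 / ?l i) * (mconst (?l i) * f (T i (c i))) = f (T i (c i))"
      using l_nz[OF i] by (simp flip: mult.assoc mconst_mult)
    ultimately have 1: "f (T i (c i)) \<sim> mconst (1 / ?l i) * (mconst (\<beta> i) * (Poly_Mapping.single ?s 1 * bf N H))"
      by simp
    have Tp: "mpderiv (T k (c k)) (Tpow D k) = mconst (?l k) * Poly_Mapping.single (yq k (c k)) 1" if "k \<in> B" for k
      using mpderiv_Y[OF cV[OF that]] B_blocks that by (simp add: Y_def subset_iff)
    have "delta_values D B c \<beta> (T i (c i)) = mconst (\<beta> i) * (\<Prod>k\<in>B - {i}. mconst (?l k) * Poly_Mapping.single (yq k (c k)) 1)"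
      using Tp by simp
    also have "\<dots> = mconst (\<beta> i) * mconst (\<Prod>k\<in>B - {i}. ?l k) * Poly_Mapping.single (\<Sum>k\<in>B - {i}. yq k (c k)) 1"
      by (simp add: prod.distrib mconst_prod prod_single mult.assoc)
    finally have dv: "delta_values D B c \<beta> (T i (c i)) =
      mconst (\<beta> i) * mconst (\<Prod>k\<in>B - {i}. ?l k) * Poly_Mapping.single (\<Sum>k\<in>B - {i}. yq k (c k)) 1" .
    have P: "P = ?l i * (\<Prod>k\<in>B - {i}. ?l k)" unfolding P_def by (rule prod.remove[OF finB i])
    have "(\<Prod>k\<in>B - {i}. ?l k) \<noteq> 0" using l_nz finB by (simp add: prod_zero_iff)
    then have c1: "\<alpha> / P * (\<Prod>k\<in>B - {i}. ?l k) = 1 / ?l i * \<alpha>" by (simp add: P)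
    have "mconst (\<alpha> / P) * L ^ N * Poly_Mapping.single t 1 * delta_values D B c \<beta> (T i (c i))
      = mconst (\<alpha> / P * (\<Prod>k\<in>B - {i}. ?l k)) * mconst (\<beta> i) * L ^ N
        * (Poly_Mapping.single t 1 * Poly_Mapping.single (\<Sum>k\<in>B - {i}. yq k (c k)) 1)"
      unfolding dv mconst_mult by (simp only: mult_ac)
    also have "\<dots> = mconst (1 / ?l i) * (mconst (\<beta> i) * (Poly_Mapping.single ?s 1 * bf N H))"
      unfolding c1 \<alpha>(2) mconst_mult mult_single by (simp add: mult_ac)
    finally show ?thesis using 1 by simp
  qed
  have dv_mpolys: "mconst (\<alpha> / P) * L ^ N * Poly_Mapping.single t 1 \<in> mpolys V"
    by (intro mpolys_intros L_mpolys mpolys_mconst tV)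
  show ?thesis
  proof (rule that[of \<beta> c t "\<alpha> / P" N])
    fix v assume v: "v \<in> V"
    have "f v \<sim> mconst (\<alpha> / P) * L ^ N * Poly_Mapping.single t 1 * delta_values D B c \<beta> v"
    proof (cases v)
      case (T i j)
      show ?thesis
      proof (cases "i \<in> B \<and> j = c i")
        case True
        then show ?thesis using f_T T by blast
      next
        case False
        have "i \<in> M" using v T blocks_subset by auto
        then have "delta_values D B c \<beta> v = 0" using False T by (auto simp: B_def)
        then show ?thesis using f_J[of i j] v T False by (simp add: cong_0_iff)
      qed
    next
      case (S k)
      then show ?thesis using f_S[of k] v by (simp add: cong_0_iff)
    qed
    then show "f v \<sim> mconst (\<alpha> / P) * (mconst (\<beta> qb) * Y pb - mconst (\<beta> pb) * Y qb) ^ N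
       * Poly_Mapping.single t 1 * delta_values D {i\<in>M. \<beta> i \<noteq> 0} c \<beta> v"
      by (simp add: L_def \<beta>pq B_def)
  qed (use linear B_blocks H(5) c(1) tV t_c in \<open>auto simp: \<beta>pq B_def, auto simp: \<beta>_def\<close>)
qed

end

section \<open>The quotient algebra\<close>

context trinomial
begin

abbreviation "R \<equiv> trinomial_algebra D"

lemma cls_eq_image: "cls D p = (\<lambda>j. j + p) ` J"
  by (auto simp: cls_def a_r_coset_def')

lemma cls_eq_iff: "cls D p = cls D q \<longleftrightarrow> p \<sim> q"
proof
  assume "cls D p = cls D q"
  moreover have "p \<in> cls D p" unfolding cls_eq_image using image_eqI[of p "\<lambda>j. j + p" 0 J] by simp
  ultimately obtain j where "j \<in> J" "p = j + q" by (auto simp: cls_eq_image)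
  then show "p \<sim> q" by (simp add: cong_def)
next
  have *: "cls D p \<subseteq> cls D q" if "p \<sim> q" for p q
  proof
    fix x assume "x \<in> cls D p"
    then obtain j where "j \<in> J" "x = j + p" by (auto simp: cls_eq_image)
    then show "x \<in> cls D q" unfolding cls_eq_image
      using J_add[of j "p - q"] that by (intro image_eqI[of _ _ "j + (p - q)"]) (auto simp: cong_def)
  qed
  assume "p \<sim> q"
  then show "cls D p = cls D q" using *[of p q] *[of q p] cong_sym by blast
qed

lemma cls_ring_hom: "cls D \<in> ring_hom (mpoly_ring V) R"
  using ideal.rcos_ring_hom[OF ideal_trinomial_ideal[of D]]
  unfolding trinomial_algebra_def cls_def[abs_def] .

lemma carrier_R: "carrier R = cls D ` mpolys V"
  by (auto simp: trinomial_algebra_def FactRing_def A_RCOSETS_def' cls_def)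

lemma zero_R: "\<zero>\<^bsub>R\<^esub> = cls D 0"
  by (simp add: trinomial_algebra_def FactRing_def cls_eq_image)

lemma cls_add: "p \<in> mpolys V \<Longrightarrow> q \<in> mpolys V \<Longrightarrow> cls D p \<oplus>\<^bsub>R\<^esub> cls D q = cls D (p + q)"
  and cls_mult: "p \<in> mpolys V \<Longrightarrow> q \<in> mpolys V \<Longrightarrow> cls D p \<otimes>\<^bsub>R\<^esub> cls D q = cls D (p * q)"
  using ring_hom_memE(2,3)[OF cls_ring_hom] by simp_all

lemma cls_in_R: "p \<in> mpolys V \<Longrightarrow> cls D p \<in> carrier R"
  by (simp add: carrier_R)

lemma cls_eq_0_iff: "cls D p = \<zero>\<^bsub>R\<^esub> \<longleftrightarrow> p \<in> J"
  by (simp add: zero_R cls_eq_iff cong_0_iff)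

section \<open>Derivations of the quotient algebra and of the polynomial ring\<close>

text \<open>A polynomial derivation sending the relations into the ideal preserves the ideal, so its
  value on a class can be computed from any representative.\<close>

lemma derivation_of_der:
  assumes g: "\<And>v. v \<in> V \<Longrightarrow> g v \<in> mpolys V" and rel: "\<And>x. x \<in> relations D \<Longrightarrow> der V g x \<in> J"
  obtains \<delta> where "derivation_with_values D g \<delta>" "\<And>p. p \<in> mpolys V \<Longrightarrow> \<delta> (cls D p) = cls D (der V g p)"
proof -
  have g_der: "der V g p \<in> mpolys V" if "p \<in> mpolys V" for p
    using that by (intro mpolys_der g)
  have "J \<subseteq> {p \<in> J. der V g p \<in> J}"
  proof (rule trinomial_ideal_minimal)
    fix x y :: "(tvar, 'k) mpoly" assume "x \<in> {p \<in> J. der V g p \<in> J}" "y \<in> mpolys V"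
    then show "y * x \<in> {p \<in> J. der V g p \<in> J}"
      using g_der[of y] by (auto simp: der_mult intro: J_add J_mult)
  next
    show "relations D \<subseteq> {p \<in> J. der V g p \<in> J}"
      using rel trinomial_ideal_relations[of D] by blast
  qed (use J_subset in \<open>auto simp: der_add intro: J_add\<close>)
  then have der_cong: "der V g p \<sim> der V g q" if "p \<sim> q" for p q
    using that by (simp add: cong_def flip: der_diff) blast
  define \<delta> where "\<delta> = (\<lambda>x. cls D (der V g (SOME p. p \<in> mpolys V \<and> cls D p = x)))"
  have \<delta>: "\<delta> (cls D p) = cls D (der V g p)" if "p \<in> mpolys V" for p
  proof -
    have "(SOME q. q \<in> mpolys V \<and> cls D q = cls D p) \<in> mpolys V \<and> cls D (SOME q. q \<in> mpolys V \<and> cls D q = cls D p) = cls D p"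
      by (rule someI[of _ p]) (use that in auto)
    then show ?thesis unfolding \<delta>_def by (simp only: cls_eq_iff der_cong)
  qed
  have "derivation_with_values D g \<delta>"
    unfolding derivation_with_values_def derivation_def
  proof (intro conjI ballI allI)
    show "\<delta> \<in> carrier R \<rightarrow> carrier R" using \<delta> g_der by (auto simp: carrier_R)
  next
    fix x y assume "x \<in> carrier R" "y \<in> carrier R"
    then obtain p q where pq: "p \<in> mpolys V" "q \<in> mpolys V" "x = cls D p" "y = cls D q" by (auto simp: carrier_R)
    show "\<delta> (x \<oplus>\<^bsub>R\<^esub> y) = \<delta> x \<oplus>\<^bsub>R\<^esub> \<delta> y"
      using pq g_der by (simp add: \<delta> cls_add mpolys_add der_add)
    show "\<delta> (x \<otimes>\<^bsub>R\<^esub> y) = (\<delta> x \<otimes>\<^bsub>R\<^esub> y) \<oplus>\<^bsub>R\<^esub> (x \<otimes>\<^bsub>R\<^esub> \<delta> y)"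
      using pq g_der by (simp add: \<delta> cls_add cls_mult mpolys_mult der_mult)
  next
    fix c x assume "x \<in> carrier R"
    then obtain p where p: "p \<in> mpolys V" "x = cls D p" by (auto simp: carrier_R)
    then show "\<delta> (cls D (mconst c) \<otimes>\<^bsub>R\<^esub> x) = cls D (mconst c) \<otimes>\<^bsub>R\<^esub> \<delta> x"
      using g_der by (simp add: \<delta> cls_mult mpolys_mult der_mult)
  next
    fix v assume "v \<in> V"
    then show "\<delta> (cls D (mvar v)) = cls D (g v)"
      by (simp add: \<delta> mpolys_mvar der_mvar finite_tvars)
  qed
  then show ?thesis using \<delta> that by blast
qed

lemma derivation_eq_der:
  assumes \<delta>: "algebra_derivation D \<delta>" and f: "\<And>v. v \<in> V \<Longrightarrow> f v \<in> mpolys V"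
    and val: "\<And>v. v \<in> V \<Longrightarrow> \<delta> (cls D (mvar v)) = cls D (f v)"
    and p: "p \<in> mpolys V"
  shows "\<delta> (cls D p) = cls D (der V f p)"
proof -
  have d_add: "\<delta> (cls D p \<oplus>\<^bsub>R\<^esub> cls D q) = \<delta> (cls D p) \<oplus>\<^bsub>R\<^esub> \<delta> (cls D q)"
    and d_mult: "\<delta> (cls D p \<otimes>\<^bsub>R\<^esub> cls D q) = (\<delta> (cls D p) \<otimes>\<^bsub>R\<^esub> cls D q) \<oplus>\<^bsub>R\<^esub> (cls D p \<otimes>\<^bsub>R\<^esub> \<delta> (cls D q))"
    and d_const: "\<delta> (cls D (mconst c) \<otimes>\<^bsub>R\<^esub> cls D p) = cls D (mconst c) \<otimes>\<^bsub>R\<^esub> \<delta> (cls D p)"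
    and closed: "\<delta> (cls D p) \<in> carrier R"
    if "p \<in> mpolys V" "q \<in> mpolys V" for p q c
    using \<delta> that unfolding derivation_def by (auto simp: cls_in_R)
  have f_der: "der V f p \<in> mpolys V" if "p \<in> mpolys V" for p
    using that by (intro mpolys_der f)
  obtain q where q: "q \<in> mpolys V" "\<delta> (cls D 1) = cls D q"
    using closed[of 1 1] by (auto simp: carrier_R)
  \<comment> \<open>The product rule for 1 times 1; it kills 1, and linearity then kills all
    constants.\<close>
  have "q \<sim> q + q"
    using d_mult[of 1 1] q by (simp add: cls_mult cls_add cls_eq_iff)
  then have "q \<in> J" using J_uminus[of "- q"] by (simp add: cong_def)
  then have one: "\<delta> (cls D 1) = cls D 0" using q by (simp add: cls_eq_iff cong_0_iff)
  show ?thesis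
    using finite_tvars[of D] p
  proof (induction rule: mpolys_induct)
    case (const c)
    have "\<delta> (cls D (mconst c)) = cls D (mconst c) \<otimes>\<^bsub>R\<^esub> \<delta> (cls D 1)"
      using d_const[of 1 1 c] by (simp add: cls_mult)
    then show ?case by (simp add: one cls_mult)
  next
    case (var v)
    then show ?case by (simp add: val der_mvar finite_tvars)
  next
    case (add p q)
    then show ?case using d_add[of p q] f_der by (simp add: cls_add der_add)
  next
    case (mult p q)
    then show ?case using d_mult[of p q] f_der by (simp add: cls_add cls_mult mpolys_mult der_mult)
  qed
qed

section \<open>The grading group\<close>

lemma lookup_im_P0T:
  "Poly_Mapping.lookup (\<Sum>v\<in>V. Poly_Mapping.single v (g v)) w = (if w \<in> V then g w else (0::int))"
  by (simp add: lookup_sum lookup_single when_def finite_tvars)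

lemma im_P0T_iff:
  "w \<in> im_P0T D \<longleftrightarrow> Poly_Mapping.keys w \<subseteq> V \<and> deq (Poly_Mapping.lookup w) (\<lambda>_. 0)"
proof
  assume "w \<in> im_P0T D"
  then obtain u where w: "w = (\<Sum>v\<in>V. Poly_Mapping.single v (\<Sum>i=1..r. P0 D i v * u i))"
    by (auto simp: im_P0T_def)
  show "Poly_Mapping.keys w \<subseteq> V \<and> deq (Poly_Mapping.lookup w) (\<lambda>_. 0)"
    unfolding deq_def by (auto simp: in_keys_iff w lookup_im_P0T split: if_splits)
next
  assume w: "Poly_Mapping.keys w \<subseteq> V \<and> deq (Poly_Mapping.lookup w) (\<lambda>_. 0)"
  then obtain u where u: "\<And>v. v \<in> V \<Longrightarrow> Poly_Mapping.lookup w v = (\<Sum>i=1..r. P0 D i v * u i)"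
    unfolding deq_def by auto
  have "w = (\<Sum>v\<in>V. Poly_Mapping.single v (\<Sum>i=1..r. P0 D i v * u i))"
  proof (rule poly_mapping_eqI)
    fix v show "Poly_Mapping.lookup w v = Poly_Mapping.lookup (\<Sum>v\<in>V. Poly_Mapping.single v (\<Sum>i=1..r. P0 D i v * u i)) v"
      using u w by (auto simp: lookup_im_P0T in_keys_iff subset_iff)
  qed
  then show "w \<in> im_P0T D" by (auto simp: im_P0T_def)
qed

lemma im_P0T_add: assumes "x \<in> im_P0T D" "y \<in> im_P0T D" shows "x + y \<in> im_P0T D"
proof -
  have "deq (\<lambda>v. Poly_Mapping.lookup x v + Poly_Mapping.lookup y v) (\<lambda>_. 0 + 0)"
    using assms by (intro deq_add) (auto simp: im_P0T_iff)
  moreover have "Poly_Mapping.lookup (x + y) = (\<lambda>v. Poly_Mapping.lookup x v + Poly_Mapping.lookup y v)"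
    by (simp add: fun_eq_iff lookup_add)
  ultimately show ?thesis using assms keys_add[of x y] by (auto simp: im_P0T_iff)
qed

lemma im_P0T_uminus: assumes "x \<in> im_P0T D" shows "- x \<in> im_P0T D"
proof -
  have "deq (\<lambda>v. - Poly_Mapping.lookup x v) (\<lambda>_. - 0)"
    using assms by (intro deq_minus) (auto simp: im_P0T_iff)
  moreover have "Poly_Mapping.lookup (- x) = (\<lambda>v. - Poly_Mapping.lookup x v)"
    by (simp add: fun_eq_iff)
  ultimately show ?thesis using assms by (auto simp: im_P0T_iff)
qed

lemma zero_in_im_P0T: "0 \<in> im_P0T D"
  using deq_refl[of "\<lambda>_. 0"] by (simp add: im_P0T_iff lookup_zero[abs_def])

lemma normal_im_P0T: "normal (im_P0T D) (free_Abelian_group V)"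
proof (rule comm_group.subgroup_imp_normal[OF abelian_free_Abelian_group])
  show "subgroup (im_P0T D) (free_Abelian_group V)"
  proof (rule group.subgroupI[OF group_free_Abelian_group])
    show "im_P0T D \<noteq> {}" using zero_in_im_P0T by blast
  qed (use im_P0T_add im_P0T_uminus in \<open>auto simp: im_P0T_iff\<close>)
qed

lemma Q_eq_image: "Q D w = (\<lambda>h. h + w) ` im_P0T D"
  by (auto simp: Q_def r_coset_def)

lemma Q_eq_iff:
  assumes "Poly_Mapping.keys w \<subseteq> V" "Poly_Mapping.keys w' \<subseteq> V"
  shows "Q D w = Q D w' \<longleftrightarrow> deq (Poly_Mapping.lookup w) (Poly_Mapping.lookup w')"
proof -
  have "deq (Poly_Mapping.lookup (w - w')) (\<lambda>_. 0) \<longleftrightarrow> deq (Poly_Mapping.lookup w) (Poly_Mapping.lookup w')"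
    by (auto simp: deq_def lookup_minus algebra_simps)
  moreover have "Poly_Mapping.keys (w - w') \<subseteq> V"
    using assms by (auto simp: in_keys_iff lookup_minus subset_iff) (metis)
  ultimately have "w - w' \<in> im_P0T D \<longleftrightarrow> deq (Poly_Mapping.lookup w) (Poly_Mapping.lookup w')"
    by (simp add: im_P0T_iff)
  moreover have "Q D w = Q D w' \<longleftrightarrow> w - w' \<in> im_P0T D"
  proof
    assume eq: "Q D w = Q D w'"
    have "w \<in> Q D w" unfolding Q_eq_image using zero_in_im_P0T by (intro image_eqI[of _ _ 0]) auto
    then show "w - w' \<in> im_P0T D" unfolding eq by (auto simp: Q_eq_image)
  next
    assume "w - w' \<in> im_P0T D"
    moreover have "Q D w \<subseteq> Q D w'" if "w - w' \<in> im_P0T D" for w w'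
    proof
      fix x assume "x \<in> Q D w"
      then obtain h where "h \<in> im_P0T D" "x = h + w" by (auto simp: Q_eq_image)
      then show "x \<in> Q D w'" unfolding Q_eq_image
        using im_P0T_add[of h "w - w'"] that by (intro image_eqI[of _ _ "h + (w - w')"]) auto
    qed
    ultimately show "Q D w = Q D w'" using im_P0T_uminus[of "w - w'"] by (metis minus_diff_eq subset_antisym)
  qed
  ultimately show ?thesis by simp
qed

definition ivec :: "(tvar \<Rightarrow>\<^sub>0 nat) \<Rightarrow> tvar \<Rightarrow>\<^sub>0 int" where
  "ivec t = (\<Sum>v\<in>Poly_Mapping.keys t. Poly_Mapping.single v (int (Poly_Mapping.lookup t v)))"

lemma lookup_ivec: "Poly_Mapping.lookup (ivec t) = dg t"
  by (auto simp: fun_eq_iff ivec_def dg_def lookup_sum lookup_single when_def in_keys_iff)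

lemma keys_ivec: "Poly_Mapping.keys (ivec t) = Poly_Mapping.keys t"
  by (auto simp: in_keys_iff lookup_ivec dg_def)

text \<open>Translates the grading by cosets into the predicate \<open>hom\<close> on
  representatives.\<close>

lemma K0_component_eq:
  assumes "Poly_Mapping.keys w \<subseteq> V"
  shows "K0_component D (Q D w) = cls D ` {p. hom (Poly_Mapping.lookup w) p}"
proof -
  have "monomial_degree D t = Q D w \<longleftrightarrow> deq (dg t) (Poly_Mapping.lookup w)" if "Poly_Mapping.keys t \<subseteq> V" for t
    using Q_eq_iff[of "ivec t" w] assms that
    by (simp add: monomial_degree_def keys_ivec lookup_ivec flip: ivec_def)
  then have "{p \<in> mpolys V. \<forall>t\<in>Poly_Mapping.keys p. monomial_degree D t = Q D w} = {p. hom (Poly_Mapping.lookup w) p}"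
    unfolding hom_def mpolys_def by blast
  then show ?thesis by (simp add: K0_component_def)
qed

text \<open>\<open>d\<close> is an integer vector representing the degree of the derivation; every
  class in a component has a homogeneous representative, which is chosen as
  \<open>f v\<close>.\<close>

lemma homogeneous_values:
  assumes "homogeneous_map (K0 D) (K0_component D) \<delta>"
  obtains f d where "\<And>v. v \<in> V \<Longrightarrow> hom (\<lambda>w. unit v w + d w) (f v)"
    "\<And>v. v \<in> V \<Longrightarrow> \<delta> (cls D (mvar v)) = cls D (f v)"
proof -
  obtain x where x: "x \<in> carrier (K0 D)"
    and h: "\<And>g. g \<in> carrier (K0 D) \<Longrightarrow> \<delta> ` K0_component D g \<subseteq> K0_component D (g \<otimes>\<^bsub>K0 D\<^esub> x)"
    using assms unfolding homogeneous_map_def by blast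
  have carrier_K0: "carrier (K0 D) = Q D ` {w. Poly_Mapping.keys w \<subseteq> V}"
    unfolding K0_def carrier_FactGroup Q_def[abs_def] by (auto simp: free_Abelian_group_def)
  then obtain w where w: "Poly_Mapping.keys w \<subseteq> V" "x = Q D w" using x by auto
  have "\<exists>q. hom (\<lambda>u. unit v u + Poly_Mapping.lookup w u) q \<and> \<delta> (cls D (mvar v)) = cls D q" if v: "v \<in> V" for v
  proof -
    let ?e = "Poly_Mapping.single v (1 :: int)"
    have e: "Poly_Mapping.keys ?e \<subseteq> V" "Poly_Mapping.lookup ?e = unit v"
      using v by (auto simp: fun_eq_iff unit_def lookup_single when_def)
    have ew: "Poly_Mapping.keys (?e + w) \<subseteq> V" "Poly_Mapping.lookup (?e + w) = (\<lambda>u. unit v u + Poly_Mapping.lookup w u)"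
      using e w keys_add[of ?e w] by (auto simp: fun_eq_iff lookup_add)
    have "Q D ?e \<otimes>\<^bsub>K0 D\<^esub> x = Q D (?e + w)"
      using normal.rcos_sum[OF normal_im_P0T, of ?e w] e w by (simp add: K0_def FactGroup_def Q_def)
    moreover have "Q D ?e \<in> carrier (K0 D)" using e carrier_K0 by auto
    ultimately have "\<delta> ` (cls D ` {p. hom (unit v) p}) \<subseteq> cls D ` {p. hom (\<lambda>u. unit v u + Poly_Mapping.lookup w u) p}"
      using h[of "Q D ?e"] K0_component_eq[OF e(1)] K0_component_eq[OF ew(1)] e(2) ew(2) by simp
    then show ?thesis using hom_mvar[OF v] by blast
  qed
  then show ?thesis using that[of "Poly_Mapping.lookup w"] by metis
qed

lemma trinomial_lnd_of_derivation:
  assumes \<delta>: "algebra_derivation D \<delta>" and nil: "locally_nilpotent R \<delta>"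
    and f: "\<And>v. v \<in> V \<Longrightarrow> hom (\<lambda>w. unit v w + d w) (f v)"
    and val: "\<And>v. v \<in> V \<Longrightarrow> \<delta> (cls D (mvar v)) = cls D (f v)"
  shows "trinomial_lnd D f d"
proof
  have fV: "f v \<in> mpolys V" if "v \<in> V" for v using f[OF that] hom_mpolys by blast
  have eq: "\<delta> (cls D p) = cls D (der V f p)" if "p \<in> mpolys V" for p
    using \<delta> fV val that by (rule derivation_eq_der)
  show "der V f p \<in> J" if "p \<in> J" for p
  proof -
    have pV: "p \<in> mpolys V" using that J_subset by blast
    have "cls D p = cls D 0" using that by (simp add: cls_eq_iff cong_0_iff)
    then have "cls D (der V f p) = cls D 0" using eq[OF pV] eq[of 0] by simp
    then show ?thesis by (simp add: cls_eq_iff cong_0_iff)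
  qed
  show "\<exists>n. (der V f ^^ n) p \<in> J" if p: "p \<in> mpolys V" for p
  proof -
    have "(der V f ^^ n) p \<in> mpolys V \<and> (\<delta> ^^ n) (cls D p) = cls D ((der V f ^^ n) p)" for n
      by (induction n) (auto simp: p eq mpolys_der fV)
    moreover obtain n where "(\<delta> ^^ n) (cls D p) = \<zero>\<^bsub>R\<^esub>"
      using nil cls_in_R[OF p] unfolding locally_nilpotent_def by blast
    ultimately show ?thesis using cls_eq_0_iff by auto
  qed
qed (rule f)


section \<open>The basic derivations\<close>

lemma delta_values_mpolys:
  assumes "B \<subseteq> blocks D" shows "delta_values D B c \<beta> v \<in> mpolys V"
proof (cases v)
  case (T i j)
  then show ?thesis using assms by (auto intro!: mpolys_intros Tpow_in_mpolys)
qed simp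

text \<open>The derivative of the own block completes the product in the value at
  \<open>T i (c i)\<close> to the product over all of \<open>B\<close>, so the images differ only by
  the scalars \<open>\<beta> i\<close>.\<close>

lemma der_delta_values_Y:
  assumes \<beta>: "{i\<in>M. \<beta> i \<noteq> 0} \<subseteq> blocks D" and c: "\<And>i. i \<in> blocks D \<Longrightarrow> 1 \<le> c i \<and> c i \<le> n i"
    and B: "B = {i\<in>M. \<beta> i \<noteq> 0}" and i: "i \<in> M"
  shows "der V (delta_values D B c \<beta>) (Y i) = mconst (\<beta> i) * (\<Prod>k\<in>B. mpderiv (T k (c k)) (Tpow D k))"
proof (cases "i \<in> blocks D")
  case False
  then show ?thesis using \<beta> i by (auto simp: Y_def)
next
  case True
  let ?g = "delta_values D B c \<beta>" and ?v = "T i (c i)"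
  have v: "?v \<in> V" using c[OF True] True by simp
  have "der V ?g (Y i) = ?g ?v * mpderiv ?v (Y i) + (\<Sum>v\<in>V - {?v}. ?g v * mpderiv v (Y i))"
    unfolding der_def by (rule sum.remove[OF finite_tvars v])
  also have "(\<Sum>v\<in>V - {?v}. ?g v * mpderiv v (Y i)) = 0"
  proof (rule sum.neutral, rule ballI)
    fix v assume v: "v \<in> V - {?v}"
    show "?g v * mpderiv v (Y i) = 0"
    proof (cases "\<exists>j. v = T i j")
      case True
      then obtain j where "v = T i j" "j \<noteq> c i" using v by blast
      then show ?thesis by simp
    next
      case False
      then show ?thesis using mpderiv_Y_0[of i v] v by auto
    qed
  qed
  finally have eq: "der V ?g (Y i) = ?g ?v * mpderiv ?v (Tpow D i)" using True by (simp add: Y_def)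
  show ?thesis
  proof (cases "i \<in> B")
    case True
    have "finite B" by (simp add: B)
    then show ?thesis unfolding eq using prod.remove[OF _ True, of "\<lambda>k. mpderiv (T k (c k)) (Tpow D k)"]
      by (simp add: mult_ac)
  next
    case False
    then have "\<beta> i = 0" using i B by simp
    then show ?thesis by (simp add: eq)
  qed
qed

text \<open>As a combination of \<open>kap\<close> and \<open>lam\<close>, \<open>\<beta>\<close>
  satisfies the linear relations of the block monomials, so the images of the relations
  cancel.\<close>

lemma delta_derivation:
  assumes \<beta>: "\<And>i. i \<in> M \<Longrightarrow> \<beta> i = kap i * \<beta> pb + lam i * \<beta> qb" "{i\<in>M. \<beta> i \<noteq> 0} \<subseteq> blocks D"
    and c: "\<And>i. i \<in> blocks D \<Longrightarrow> 1 \<le> c i \<and> c i \<le> n i" and B: "B = {i\<in>M. \<beta> i \<noteq> 0}"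
  obtains \<delta> where "derivation_with_values D (delta_values D B c \<beta>) \<delta>"
proof (rule derivation_of_der)
  show "delta_values D B c \<beta> v \<in> mpolys V" for v
    using \<beta>(2) B by (intro delta_values_mpolys) simp
  fix x assume "x \<in> relations D"
  then obtain i j k a b e where x: "i \<in> M" "j \<in> M" "k \<in> M"
    "x = mconst a * Y i + mconst b * Y j + mconst e * Y k"
    "a * kap i + b * kap j + e * kap k = 0" "a * lam i + b * lam j + e * lam k = 0"
    by (rule relation_cases)
  let ?P = "\<Prod>k\<in>B. mpderiv (T k (c k)) (Tpow D k)"
  have "der V (delta_values D B c \<beta>) x = mconst (a * \<beta> i + b * \<beta> j + e * \<beta> k) * ?P"
    using x(1-3) by (simp add: x(4) der_add der_mult der_delta_values_Y[OF \<beta>(2) c B] mconst_add mconst_mult algebra_simps)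
  also have "a * \<beta> i + b * \<beta> j + e * \<beta> k =
      (a * kap i + b * kap j + e * kap k) * \<beta> pb + (a * lam i + b * lam j + e * lam k) * \<beta> qb"
    unfolding \<beta>(1)[OF x(1)] \<beta>(1)[OF x(2)] \<beta>(1)[OF x(3)] by (simp add: algebra_simps)
  finally show "der V (delta_values D B c \<beta>) x \<in> J" unfolding x(5,6) by simp
qed (rule that)

lemma partial_S_derivation:
  assumes "S p \<in> V" obtains \<delta> where "is_partial_S D p \<delta>"
proof -
  let ?g = "\<lambda>v. if v = S p then 1 else 0 :: (tvar, 'k) mpoly"
  have Y: "der V ?g (Y i) = 0" for i
    unfolding der_def by (rule sum.neutral) (auto simp: mpderiv_Y_0)
  obtain \<delta> where "derivation_with_values D ?g \<delta>"
  proof (rule derivation_of_der)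
    show "?g v \<in> mpolys V" for v by simp
    fix x assume "x \<in> relations D"
    then obtain i j k a b e where "x = mconst a * Y i + mconst b * Y j + mconst e * Y k"
      by (rule relation_cases)
    then show "der V ?g x \<in> J" by (simp add: der_add der_mult Y)
  qed
  then show ?thesis using assms that by (simp add: is_partial_S_def)
qed

section \<open>Multiples of derivations\<close>

lemma derivation_eq_multiple:
  assumes \<delta>': "algebra_derivation D \<delta>'" "\<And>v. v \<in> V \<Longrightarrow> \<delta>' (cls D (mvar v)) = cls D (f v)"
    and f: "\<And>v. v \<in> V \<Longrightarrow> f v \<in> mpolys V"
    and \<delta>: "derivation_with_values D g \<delta>" and g: "\<And>v. v \<in> V \<Longrightarrow> g v \<in> mpolys V"
    and q: "q \<in> mpolys V" "\<And>v. v \<in> V \<Longrightarrow> f v \<sim> q * g v" and x: "x \<in> carrier R"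
  shows "\<delta>' x = cls D q \<otimes>\<^bsub>R\<^esub> \<delta> x"
proof -
  obtain p where p: "p \<in> mpolys V" "x = cls D p" using x by (auto simp: carrier_R)
  have 1: "\<delta>' (cls D p) = cls D (der V f p)"
    using \<delta>'(1) f \<delta>'(2) p(1) by (rule derivation_eq_der)
  have 2: "\<delta> (cls D p) = cls D (der V g p)"
    by (rule derivation_eq_der[OF _ g _ p(1)]) (use \<delta> in \<open>auto simp: derivation_with_values_def\<close>)
  have gV: "der V g p \<in> mpolys V" using g p(1) by (rule mpolys_der)
  have "der V f p \<sim> (\<Sum>v\<in>V. q * (g v * mpderiv v p))"
    unfolding der_def
  proof (rule cong_sum)
    fix v assume v: "v \<in> V"
    show "f v * mpderiv v p \<sim> q * (g v * mpderiv v p)"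
      using cong_mult_left[OF q(2)[OF v] mpolys_mpderiv[OF p(1), of v]] by (simp add: mult_ac)
  qed
  then have "der V f p \<sim> q * der V g p" by (simp add: der_def sum_distrib_left)
  then show ?thesis using 1 2 p gV q(1) by (simp add: cls_mult cls_eq_iff)
qed

section \<open>The shape of the factor \<open>h\<close>\<close>

lemma single_eq_monomials:
  assumes "Poly_Mapping.keys t \<subseteq> V"
  shows "(Poly_Mapping.single t 1 :: (tvar, 'k) mpoly) =
    T_monomial (T_indices D) (\<lambda>i j. Poly_Mapping.lookup t (T i j))
    * S_monomial {1..tr_m D} (\<lambda>k. Poly_Mapping.lookup t (S k))"
proof -
  let ?T = "(\<lambda>(i, j). T i j) ` T_indices D" and ?S = "S ` {1..tr_m D}"
  let ?h = "\<lambda>v. mvar v ^ Poly_Mapping.lookup t v :: (tvar, 'k) mpoly"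
  have V: "V = ?T \<union> ?S" by (auto simp: tvars_def)
  have fin: "finite ?T" "finite ?S" using finite_tvars[of D] unfolding V by auto
  have "(Poly_Mapping.single t 1 :: (tvar, 'k) mpoly) = prod ?h (?T \<union> ?S)"
    using single_eq_prod_mvar[OF finite_tvars assms] unfolding V by simp
  also have "\<dots> = prod ?h ?T * prod ?h ?S"
    using fin by (intro prod.union_disjoint) auto
  also have "prod ?h ?T = T_monomial (T_indices D) (\<lambda>i j. Poly_Mapping.lookup t (T i j))"
    unfolding T_monomial_def by (subst prod.reindex) (auto simp: inj_on_def case_prod_beta intro!: prod.cong)
  also have "prod ?h ?S = S_monomial {1..tr_m D} (\<lambda>k. Poly_Mapping.lookup t (S k))"
    unfolding S_monomial_def by (subst prod.reindex) (auto simp: inj_on_def)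
  finally show ?thesis .
qed

lemma finite_T_indices: "finite (T_indices D)"
proof -
  have "T_indices D = Sigma (blocks D) (\<lambda>i. {1..n i})" by (auto simp: T_indices_def)
  then show ?thesis by (simp add: blocks_def)
qed

lemma T_monomial_restrict:
  assumes "U \<subseteq> T_indices D" "\<And>i j. (i, j) \<in> T_indices D \<Longrightarrow> (i, j) \<notin> U \<Longrightarrow> b i j = 0"
  shows "T_monomial (T_indices D) b = (T_monomial U b :: (tvar, 'k) mpoly)"
  unfolding T_monomial_def
  by (rule prod.mono_neutral_right[OF finite_T_indices assms(1)]) (use assms(2) in auto)

lemma S_monomial_restrict:
  assumes "d p = 0" shows "S_monomial {1..tr_m D} d = (S_monomial ({1..tr_m D} - {p}) d :: (tvar, 'k) mpoly)"
  unfolding S_monomial_def by (rule prod.mono_neutral_right) (use assms in auto)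

text \<open>In type 1 the second reference monomial is 1, so the form is already a polynomial in the
  first.\<close>

lemma subst_poly_eq_bf:
  assumes "tr_A D = Type1 a" "degree F \<le> N" shows "subst_poly F (Tpow D 1) = bf N F"
proof -
  have Y: "Y qb = 1" "Y pb = Tpow D 1"
    using assms(1) r_pos by (auto simp: Y_def qb_def pb_def blocks_def iota_def)
  have "subst_poly F (Tpow D 1) = (\<Sum>i\<le>N. coeff (map_poly mconst F) i * Tpow D 1 ^ i)"
    unfolding subst_poly_def poly_altdef
  proof (rule sum.mono_neutral_left)
    have "degree (map_poly mconst F :: (tvar, 'k) mpoly poly) \<le> N"
      using assms(2) by (intro degree_le) (auto simp: coeff_map_poly coeff_eq_0)
    then show "{..degree (map_poly mconst F :: (tvar, 'k) mpoly poly)} \<subseteq> {..N}" by simp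
  qed (auto simp: coeff_eq_0)
  then show ?thesis by (simp add: bf_altdef Y coeff_map_poly)
qed

end

section \<open>From the values on the variables to a basic derivation and its factor\<close>

theorem corollary2:
  fixes D :: "'k::{alg_closed_field, field_char_0} trinomial_data"
    and \<delta>' :: "(tvar, 'k) mpoly set \<Rightarrow> (tvar, 'k) mpoly set"
  assumes data: "trinomial_data D"
    and deriv: "algebra_derivation D \<delta>'"
    and lnd: "locally_nilpotent (trinomial_algebra D) \<delta>'"
    and homog: "homogeneous_map (K0 D) (K0_component D) \<delta>'"
    and nontriv: "(\<exists>x\<in>carrier (trinomial_algebra D). \<delta>' x \<noteq> \<zero>\<^bsub>trinomial_algebra D\<^esub>)
                  \<or> (\<exists>\<delta>. is_basic_derivation D \<delta>)"
  shows "\<exists>\<delta> h. (\<forall>x\<in>carrier (trinomial_algebra D). \<delta>' x = h \<otimes>\<^bsub>trinomial_algebra D\<^esub> \<delta> x) \<and>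
    (case tr_A D of
       Type1 _ \<Rightarrow>
         (\<exists>p. is_partial_S D p \<delta> \<and>
            (\<exists>F b d. h = cls D (subst_poly F (Tpow D 1) * T_monomial (T_indices D) b
                                * S_monomial ({1..tr_m D} - {p}) d)))
         \<or> (\<exists>c. is_delta_C D c \<delta> \<and>
            (\<exists>\<alpha> b d. h = cls D (mconst \<alpha> * T_monomial (T_in_kernel D \<delta>) b
                                * S_monomial {1..tr_m D} d)))
     | Type2 a \<Rightarrow>
         (\<exists>p. is_partial_S D p \<delta> \<and>
            (\<exists>N f b d. h = cls D (subst_binary_form N f (Tpow D (block_p D)) (Tpow D (block_q D))
                                * T_monomial (T_indices D) b
                                * S_monomial ({1..tr_m D} - {p}) d)))
         \<or> (\<exists>c \<beta>. is_delta_C_beta D a c \<beta> \<delta> \<and>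
            (\<exists>\<alpha> s b d. h = cls D (mconst \<alpha>
                                * (mconst (\<beta> (block_q D)) * Tpow D (block_p D)
                                   - mconst (\<beta> (block_p D)) * Tpow D (block_q D)) ^ s
                                * T_monomial (T_in_kernel D \<delta>) b
                                * S_monomial {1..tr_m D} d))))" (is "\<exists>\<delta> h. ?mult \<delta> h \<and> ?form \<delta> h")
proof -
  interpret trinomial D by unfold_locales (rule data)
  obtain f d where f: "\<And>v. v \<in> V \<Longrightarrow> hom (\<lambda>w. unit v w + d w) (f v)"
    and val: "\<And>v. v \<in> V \<Longrightarrow> \<delta>' (cls D (mvar v)) = cls D (f v)"
    using homogeneous_values[OF homog] by metis
  interpret L: trinomial_lnd D f d by (rule trinomial_lnd_of_derivation[OF deriv lnd f val])
  have fV: "f v \<in> mpolys V" if "v \<in> V" for v using f[OF that] hom_mpolys by blast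
  have multiple: "\<delta>' x = cls D q \<otimes>\<^bsub>R\<^esub> \<delta> x"
    if "derivation_with_values D g \<delta>" "\<And>v. v \<in> V \<Longrightarrow> g v \<in> mpolys V" "q \<in> mpolys V"
      "\<And>v. v \<in> V \<Longrightarrow> f v \<sim> q * g v" "x \<in> carrier R" for \<delta> g q x
    using deriv val fV that by (rule derivation_eq_multiple)
  consider (zero) "\<forall>v\<in>V. f v \<in> J" | (partial) p where "S p \<in> V" "f (S p) \<notin> J"
    | (delta) i j where "T i j \<in> V" "f (T i j) \<notin> J"
    by (metis tvar.exhaust)
  then show ?thesis
  proof cases
    case zero
    have \<delta>'0: "\<delta>' x = cls D 0" if x: "x \<in> carrier R" for x
    proof -
      obtain q where q: "q \<in> mpolys V" "x = cls D q" using x by (auto simp: carrier_R)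
      have "\<delta>' x = cls D (der V f q)" unfolding q(2) using deriv fV val q(1) by (rule derivation_eq_der)
      moreover have "der V f q \<in> J"
        unfolding der_def using zero q by (intro J_sum J_mult_right mpolys_mpderiv) auto
      ultimately show ?thesis by (simp add: cls_eq_iff cong_0_iff)
    qed
    \<comment> \<open>The given derivation is zero, so \<open>nontriv\<close> provides some basic
      derivation, and the factor 0 has each of the required shapes.\<close>
    then obtain \<delta> where \<delta>: "is_basic_derivation D \<delta>" using nontriv by (auto simp: zero_R)
    then have "algebra_derivation D \<delta>"
      by (auto simp: is_basic_derivation_def is_partial_S_def is_delta_C_def is_delta_C_beta_def
          derivation_with_values_def split: coeffs.splits)
    then have "\<delta> x \<in> carrier R" if "x \<in> carrier R" for x
      using that by (auto simp: derivation_def)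
    moreover have "cls D 0 \<otimes>\<^bsub>R\<^esub> y = cls D 0" if "y \<in> carrier R" for y
      using that by (auto simp: carrier_R cls_mult)
    ultimately have "?mult \<delta> (cls D 0)" using \<delta>'0 by simp
    moreover have "?form \<delta> (cls D 0)"
    proof (cases "tr_A D")
      case (Type1 a)
      have "\<exists>F b e. cls D 0 = cls D (subst_poly F (Tpow D 1) * T_monomial (T_indices D) b
          * S_monomial ({1..tr_m D} - {p}) e)" for p
        by (intro exI[of _ 0]) (simp add: subst_poly_def)
      moreover have "\<exists>\<alpha> b e. cls D 0 = cls D (mconst \<alpha> * T_monomial (T_in_kernel D \<delta>) b * S_monomial {1..tr_m D} e)"
        by (intro exI[of _ 0]) simp
      moreover have "(\<exists>p. is_partial_S D p \<delta>) \<or> (\<exists>c. is_delta_C D c \<delta>)"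
        using \<delta> Type1 by (simp add: is_basic_derivation_def)
      ultimately show ?thesis unfolding Type1 coeffs.case by blast
    next
      case (Type2 a)
      have e1: "\<exists>N f b e. cls D 0 = cls D (subst_binary_form N f (Tpow D (block_p D)) (Tpow D (block_q D))
          * T_monomial (T_indices D) b * S_monomial ({1..tr_m D} - {p}) e)" for p
        by (intro exI[of _ 0] exI[of _ "\<lambda>_. 0"]) (simp add: subst_binary_form_def)
      have e2: "\<exists>\<alpha> s b e. cls D 0 = cls D (mconst \<alpha> * (mconst (\<beta> (block_q D)) * Tpow D (block_p D)
          - mconst (\<beta> (block_p D)) * Tpow D (block_q D)) ^ s * T_monomial (T_in_kernel D \<delta>) b * S_monomial {1..tr_m D} e)" for \<beta>
        by (intro exI[of _ 0]) simp
      have "(\<exists>p. is_partial_S D p \<delta>) \<or> (\<exists>c \<beta>. is_delta_C_beta D a c \<beta> \<delta>)"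
        using \<delta> Type2 by (simp add: is_basic_derivation_def)
      then show ?thesis
      proof (elim disjE exE)
        fix p assume "is_partial_S D p \<delta>"
        then show ?thesis unfolding Type2 coeffs.case using e1[of p] by blast
      next
        fix c \<beta> assume "is_delta_C_beta D a c \<beta> \<delta>"
        then show ?thesis unfolding Type2 coeffs.case using e2[of \<beta>] by blast
      qed
    qed
    ultimately show ?thesis by blast
  next
    case (partial p)
    obtain t N F where t: "Poly_Mapping.keys t \<subseteq> V" "degree F \<le> N" "f (S p) \<sim> Poly_Mapping.single t 1 * bf N F"
      "Poly_Mapping.lookup t (S p) = 0" "\<And>v. v \<in> V \<Longrightarrow> v \<noteq> S p \<Longrightarrow> f v \<in> J"
      by (rule L.deg_S_case[OF partial]) (rule that)
    obtain \<delta> where \<delta>: "is_partial_S D p \<delta>" by (rule partial_S_derivation[OF partial(1)])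
    let ?g = "\<lambda>v. if v = S p then 1 else 0 :: (tvar, 'k) mpoly"
    let ?h = "Poly_Mapping.single t 1 * bf N F"
    have hV: "?h \<in> mpolys V" using hom_mpolys[OF hom_single_bf[OF t(1)]] .
    have mult: "?mult \<delta> (cls D ?h)"
    proof
      fix x assume x: "x \<in> carrier R"
      show "\<delta>' x = cls D ?h \<otimes>\<^bsub>R\<^esub> \<delta> x"
      proof (rule multiple[OF _ _ hV _ x])
        show "derivation_with_values D ?g \<delta>" using \<delta> by (simp add: is_partial_S_def)
        show "f v \<sim> ?h * ?g v" if "v \<in> V" for v
          using t(3,5) that by (auto simp: cong_0_iff)
      qed auto
    qed
    have h: "?h = bf N F * T_monomial (T_indices D) (\<lambda>i j. Poly_Mapping.lookup t (T i j))
        * S_monomial ({1..tr_m D} - {p}) (\<lambda>k. Poly_Mapping.lookup t (S k))"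
      unfolding single_eq_monomials[OF t(1)] using S_monomial_restrict[of "\<lambda>k. Poly_Mapping.lookup t (S k)" p] t(4)
      by (simp add: mult_ac)
    have "?form \<delta> (cls D ?h)"
    proof (cases "tr_A D")
      case (Type1 a)
      have h': "?h = subst_poly F (Tpow D 1) * T_monomial (T_indices D) (\<lambda>i j. Poly_Mapping.lookup t (T i j))
          * S_monomial ({1..tr_m D} - {p}) (\<lambda>k. Poly_Mapping.lookup t (S k))"
        using h by (simp only: subst_poly_eq_bf[OF Type1 t(2)])
      show ?thesis unfolding Type1 coeffs.case h'
        by (rule disjI1, rule exI[of _ p], rule conjI, rule \<delta>) (intro exI, rule refl)
    next
      case (Type2 a)
      then have "Y pb = Tpow D (block_p D)" "Y qb = Tpow D (block_q D)"
        using r_pos by (auto simp: Y_def pb_def qb_def block_p_def block_q_def blocks_def iota_def)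
      then have h': "?h = subst_binary_form N (coeff F) (Tpow D (block_p D)) (Tpow D (block_q D))
          * T_monomial (T_indices D) (\<lambda>i j. Poly_Mapping.lookup t (T i j))
          * S_monomial ({1..tr_m D} - {p}) (\<lambda>k. Poly_Mapping.lookup t (S k))"
        using h by (simp add: bf_def)
      show ?thesis unfolding Type2 coeffs.case h'
        by (rule disjI1, rule exI[of _ p], rule conjI, rule \<delta>) (intro exI, rule refl)
    qed
    with mult show ?thesis by blast
  next
    case (delta i j)
    obtain \<beta> c \<alpha> N t where
      \<beta>: "\<And>i. i \<in> M \<Longrightarrow> \<beta> i = kap i * \<beta> pb + lam i * \<beta> qb" "(\<beta> pb, \<beta> qb) \<noteq> (0, 0)"
      "{i\<in>M. \<beta> i \<noteq> 0} \<subseteq> blocks D" and c: "\<And>i. i \<in> blocks D \<Longrightarrow> 1 \<le> c i \<and> c i \<le> n i"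
      and linear: "linear_but_one D {i\<in>M. \<beta> i \<noteq> 0} c"
      and t: "Poly_Mapping.keys t \<subseteq> V" "\<And>i. i \<in> M \<Longrightarrow> \<beta> i \<noteq> 0 \<Longrightarrow> Poly_Mapping.lookup t (T i (c i)) = 0"
      and fv: "\<And>v. v \<in> V \<Longrightarrow> f v \<sim> mconst \<alpha> * (mconst (\<beta> qb) * Y pb - mconst (\<beta> pb) * Y qb) ^ N
         * Poly_Mapping.single t 1 * delta_values D {i\<in>M. \<beta> i \<noteq> 0} c \<beta> v"
      by (rule L.delta_case[OF delta]) (rule that)
    define B where "B = {i\<in>M. \<beta> i \<noteq> 0}"
    have B: "B \<subseteq> blocks D" using \<beta>(3) by (simp add: B_def)
    define L where "L = mconst (\<beta> qb) * Y pb - mconst (\<beta> pb) * Y qb"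
    have LV: "L \<in> mpolys V" unfolding L_def by (intro mpolys_intros Y_in_mpolys mpolys_mconst)
    have bc: "block_choice D c" using c by (simp add: block_choice_def)
    obtain \<delta>0 where \<delta>0: "derivation_with_values D (delta_values D B c \<beta>) \<delta>0"
      by (rule delta_derivation[OF \<beta>(1,3) c B_def])
    have monomial: "(Poly_Mapping.single t 1 :: (tvar, 'k) mpoly) = T_monomial (T_in_kernel D \<delta>) (\<lambda>i j. Poly_Mapping.lookup t (T i j))
         * S_monomial {1..tr_m D} (\<lambda>k. Poly_Mapping.lookup t (S k))"
      if \<delta>: "derivation_with_values D (delta_values D B c \<gamma>) \<delta>" and \<gamma>: "\<And>i. i \<in> blocks D - B \<Longrightarrow> \<gamma> i = 0" for \<delta> \<gamma>
    proof -
      \<comment> \<open>A variable outside the kernel has a nonzero value polynomial, hence is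
        \<open>T i (c i)\<close> with \<open>i\<close> in \<open>B\<close>; these do not occur in
        \<open>t\<close>.\<close>
      have zero: "Poly_Mapping.lookup t (T i j) = 0" if ij: "(i, j) \<in> T_indices D" "(i, j) \<notin> T_in_kernel D \<delta>" for i j
      proof -
        have V: "T i j \<in> V" using ij by (auto simp: T_indices_def)
        have ne: "delta_values D B c \<gamma> (T i j) \<noteq> 0"
        proof
          assume 0: "delta_values D B c \<gamma> (T i j) = 0"
          have "\<delta> (cls D (mvar (T i j))) = \<zero>\<^bsub>R\<^esub>"
            using \<delta> V unfolding derivation_with_values_def zero_R 0[symmetric] by blast
          then show False using ij by (simp add: T_in_kernel_def)
        qed
        then have "j = c i" by (simp split: if_splits)
        moreover have "i \<in> B"
        proof (rule ccontr)
          assume "i \<notin> B"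
          then show False using ne \<gamma>[of i] V by (auto split: if_splits)
        qed
        ultimately show ?thesis using t(2)[of i] by (simp add: B_def)
      qed
      have "T_in_kernel D \<delta> \<subseteq> T_indices D" by (auto simp: T_in_kernel_def)
      then have "(T_monomial (T_indices D) (\<lambda>i j. Poly_Mapping.lookup t (T i j)) :: (tvar, 'k) mpoly)
          = T_monomial (T_in_kernel D \<delta>) (\<lambda>i j. Poly_Mapping.lookup t (T i j))"
        using zero by (rule T_monomial_restrict)
      then show ?thesis by (simp only: single_eq_monomials[OF t(1)])
    qed
    show ?thesis
    proof (cases "tr_A D")
      case (Type1 a)
      have Y: "Y qb = 1" and pq: "pb = 1" "qb = 0" and bl: "blocks D = M - {0}"
        using Type1 by (auto simp: Y_def qb_def pb_def blocks_def iota_def)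
      have "0 \<notin> B" using B bl by auto
      then have \<beta>0: "\<beta> qb = 0" using pq by (simp add: B_def)
      have \<beta>1: "\<beta> i = \<beta> pb" if "i \<in> blocks D" for i
      proof -
        have "kap i = 1" using Type1 that by (auto simp: kap_def dt_def col_def pb_def qb_def bl)
        then show ?thesis using \<beta>(1)[of i] that bl \<beta>0 by simp
      qed
      have B_eq: "B = blocks D"
        using B \<beta>1 \<beta>(2) \<beta>0 bl by (auto simp: B_def)
      \<comment> \<open>In type 1 \<open>L\<close> is the constant \<open>- \<beta> pb\<close> and
        \<open>\<beta>\<close> is constant on the blocks, so both become scalars.\<close>
      define \<alpha>' where "\<alpha>' = \<alpha> * (- \<beta> pb) ^ N * \<beta> pb"
      have dv: "delta_values D B c \<beta> v = mconst (\<beta> pb) * delta_values D B c (\<lambda>_. 1) v" if "v \<in> V" for v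
        using that \<beta>1 by (cases v) auto
      \<comment> \<open>The construction of the derivation requires the value 0 at the empty block,
        whereas \<open>is_delta_C\<close> uses 1 everywhere; no variable belongs to block 0.\<close>
      have "derivation_with_values D (delta_values D B c (\<lambda>i. if i = 0 then 0 else 1)) \<delta>
        \<longleftrightarrow> derivation_with_values D (delta_values D B c (\<lambda>_. 1)) \<delta>" for \<delta>
      proof -
        have "delta_values D B c (\<lambda>i. if i = 0 then 0 else 1) v = delta_values D B c (\<lambda>_. 1) v" if "v \<in> V" for v
          using that bl by (cases v) auto
        then show ?thesis by (simp add: derivation_with_values_def)
      qed
      moreover obtain \<delta> where "derivation_with_values D (delta_values D B c (\<lambda>i. if i = 0 then 0 else 1)) \<delta>"
      proof (rule delta_derivation[of "\<lambda>i. if i = 0 then 0 else 1" c B])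
        fix i assume "i \<in> M"
        show "(if i = 0 then 0 else 1) = kap i * (if pb = 0 then 0 else 1) + lam i * (if qb = 0 then 0 else 1)"
          using Type1 by (auto simp: kap_def dt_def col_def pb_def qb_def)
      qed (use bl B_eq c in auto)
      ultimately have \<delta>: "derivation_with_values D (delta_values D B c (\<lambda>_. 1)) \<delta>" by blast
      let ?h = "mconst \<alpha>' * Poly_Mapping.single t 1"
      have mult: "?mult \<delta> (cls D ?h)"
      proof
        fix x assume x: "x \<in> carrier R"
        show "\<delta>' x = cls D ?h \<otimes>\<^bsub>R\<^esub> \<delta> x"
        proof (rule multiple[OF \<delta> _ _ _ x])
          show "delta_values D B c (\<lambda>_. 1) v \<in> mpolys V" for v :: tvar by (rule delta_values_mpolys[OF B])
          show "?h \<in> mpolys V" by (intro mpolys_intros t mpolys_mconst)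
          fix v assume v: "v \<in> V"
          have "mconst \<alpha> * L ^ N * Poly_Mapping.single t 1 * delta_values D B c \<beta> v = ?h * delta_values D B c (\<lambda>_. 1) v"
            unfolding dv[OF v] by (simp add: L_def \<beta>0 Y \<alpha>'_def mconst_mult mconst_power mconst_uminus mult_ac)
          then show "f v \<sim> ?h * delta_values D B c (\<lambda>_. 1) v"
            using fv[OF v] by (simp add: L_def B_def)
        qed
      qed
      have h: "?h = mconst \<alpha>' * T_monomial (T_in_kernel D \<delta>) (\<lambda>i j. Poly_Mapping.lookup t (T i j))
          * S_monomial {1..tr_m D} (\<lambda>k. Poly_Mapping.lookup t (S k))"
        using monomial[OF \<delta>] B_eq by (simp add: mult.assoc)
      have \<delta>c: "is_delta_C D c \<delta>"
        using bc linear \<delta> unfolding is_delta_C_def B_def[symmetric] B_eq by blast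
      have "?form \<delta> (cls D ?h)"
        unfolding Type1 coeffs.case h by (rule disjI2, rule exI[of _ c], rule conjI, rule \<delta>c) (intro exI, rule refl)
      with mult show ?thesis by blast
    next
      case (Type2 a)
      have pq: "pb = block_p D" "qb = block_q D" and bl: "blocks D = M"
        using Type2 by (auto simp: qb_def pb_def blocks_def iota_def)
      have Y: "Y pb = Tpow D (block_p D)" "Y qb = Tpow D (block_q D)"
        using pb_in_M qb_in_M unfolding pq[symmetric] by (simp_all add: Y_def bl)
      let ?h = "mconst \<alpha> * L ^ N * Poly_Mapping.single t 1"
      have mult: "?mult \<delta>0 (cls D ?h)"
      proof
        fix x assume x: "x \<in> carrier R"
        show "\<delta>' x = cls D ?h \<otimes>\<^bsub>R\<^esub> \<delta>0 x"
        proof (rule multiple[OF \<delta>0 _ _ _ x])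
          show "delta_values D B c \<beta> v \<in> mpolys V" for v by (rule delta_values_mpolys[OF B])
          show "?h \<in> mpolys V" by (intro mpolys_intros t mpolys_mconst LV)
          show "f v \<sim> ?h * delta_values D B c \<beta> v" if "v \<in> V" for v
            using fv[OF that] by (simp add: L_def B_def)
        qed
      qed
      have h: "?h = mconst \<alpha> * (mconst (\<beta> (block_q D)) * Tpow D (block_p D)
             - mconst (\<beta> (block_p D)) * Tpow D (block_q D)) ^ N
          * T_monomial (T_in_kernel D \<delta>0) (\<lambda>i j. Poly_Mapping.lookup t (T i j))
          * S_monomial {1..tr_m D} (\<lambda>k. Poly_Mapping.lookup t (S k))"
      proof -
        have "L = mconst (\<beta> (block_q D)) * Tpow D (block_p D) - mconst (\<beta> (block_p D)) * Tpow D (block_q D)"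
          unfolding L_def Y by (simp only: pq)
        moreover have "\<beta> i = 0" if "i \<in> blocks D - B" for i using that bl by (simp add: B_def)
        ultimately show ?thesis using monomial[OF \<delta>0] by (simp add: mult.assoc)
      qed
      have \<delta>c: "is_delta_C_beta D a c \<beta> \<delta>0"
      proof -
        let ?d = "dt pb qb"
        have d: "?d \<noteq> 0" by (rule dt_nonzero[OF pb_in_M qb_in_M pb_neq_qb])
        \<comment> \<open>The row coefficients come from expanding the determinants in
          \<open>kap i\<close> and \<open>lam i\<close> in the entries of
          \<open>col i\<close>.\<close>
        have "\<beta> i = ((snd (col qb) * \<beta> pb - snd (col pb) * \<beta> qb) / ?d) * a i $ 1
            + ((fst (col pb) * \<beta> qb - fst (col qb) * \<beta> pb) / ?d) * a i $ 2" if "i \<in> blocks D" for i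
        proof -
          have ai: "a i $ 1 = fst (col i)" "a i $ 2 = snd (col i)" using Type2 by (simp_all add: col_def)
          have "\<beta> i = (dt i qb * \<beta> pb + dt pb i * \<beta> qb) / ?d"
            using \<beta>(1)[of i] that bl by (simp add: kap_def lam_def add_divide_distrib)
          also have "dt i qb * \<beta> pb + dt pb i * \<beta> qb = (snd (col qb) * \<beta> pb - snd (col pb) * \<beta> qb) * a i $ 1
            + (fst (col pb) * \<beta> qb - fst (col qb) * \<beta> pb) * a i $ 2"
            unfolding ai by (simp add: dt_def algebra_simps)
          finally show ?thesis by (simp add: add_divide_distrib)
        qed
        then have row: "in_row_space D a \<beta>" unfolding in_row_space_def by blast
        show ?thesis
        proof (cases "\<forall>i\<in>blocks D. \<beta> i \<noteq> 0")
          case True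
          then have "B = blocks D" using bl by (auto simp: B_def)
          then show ?thesis using True bc row linear \<delta>0 unfolding is_delta_C_beta_def B_def[symmetric] by simp
        next
          case False
          then obtain i0 where i0: "i0 \<in> blocks D" "\<beta> i0 = 0" by blast
          \<comment> \<open>Two zeros of \<open>\<beta>\<close> would be two independent linear
            equations for \<open>(\<beta> pb, \<beta> qb)\<close>, which is not zero.\<close>
          have only: "\<beta> k \<noteq> 0" if k: "k \<in> blocks D - {i0}" for k
          proof
            assume "\<beta> k = 0"
            then have 1: "kap i0 * \<beta> pb + lam i0 * \<beta> qb = 0" "kap k * \<beta> pb + lam k * \<beta> qb = 0"
              using \<beta>(1)[of i0] \<beta>(1)[of k] i0 k bl by auto
            have det: "kap i0 * lam k - lam i0 * kap k \<noteq> 0"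
              using kap_lam_det[of i0 k] i0 k bl by auto
            have "(kap i0 * lam k - lam i0 * kap k) * \<beta> pb
                = lam k * (kap i0 * \<beta> pb + lam i0 * \<beta> qb) - lam i0 * (kap k * \<beta> pb + lam k * \<beta> qb)"
              "(kap i0 * lam k - lam i0 * kap k) * \<beta> qb
                = kap i0 * (kap k * \<beta> pb + lam k * \<beta> qb) - kap k * (kap i0 * \<beta> pb + lam i0 * \<beta> qb)"
              by (simp_all add: algebra_simps)
            then show False using det \<beta>(2) unfolding 1 by simp
          qed
          then have "B = blocks D - {i0}" using bl i0 by (auto simp: B_def)
          then show ?thesis using only i0 bc row linear \<delta>0 unfolding is_delta_C_beta_def B_def[symmetric] by auto
        qed
      qed
      have "?form \<delta>0 (cls D ?h)"
        unfolding Type2 coeffs.case h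
        by (rule disjI2, rule exI[of _ c], rule exI[of _ \<beta>], rule conjI, rule \<delta>c) (intro exI, rule refl)
      with mult show ?thesis by blast
    qed
  qed
qed

end
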